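(* Let $\mathcal I=\{1,\dots,N\}$, let $r(t)$ be a continuous-time Markov chain on $\mathcal I$ with generator matrix $[q_{ij}]\in\mathbb R^{N\times N}$, and for each $i\in\mathcal I$ let $A(i)\in\mathbb R^{n\times n}$, $B(i)\in\mathbb R^{n\times m}$, $C(i)\in\mathbb R^{p\times n}$, $D(i)\in\mathbb R^{p\times p}$ be given. Consider the Markovian jump system $$\dot x(t)=A(i)x(t)+B(i)u(t),\qquad y(t)=C(i)x(t)+D(i)\omega(t),\qquad i=r(t),$$ where $\omega$ is a standard $p$-dimensional Gaussian white noise. Suppose there exist symmetric positive definite matrices $S(i)\in\mathbb R^{n\times n}$ and $Y(i)\in\mathbb R^{p\times p}$, and matrices $F(i)\in\mathbb R^{m\times p}$, $i\in\mathcal I$, such that for every $i\in\mathcal I$ $$\begin{bmatrix}\Delta(i)&\Lambda_i(S)\\ \Lambda_i(S)^T&-\Xi_i(S)\end{bmatrix}<0,\qquad C(i)S(i)-Y(i)C(i)=0,$$ where $$\Delta(i)=S(i)A(i)^T+C(i)^TF(i)^TB(i)^T+A(i)S(i)+B(i)F(i)C(i)+q_{ii}S(i),$$ $$\Lambda_i(S)=\big[\sqrt{q_{i1}}S(i),\dots,\sqrt{q_{i,i-1}}S(i),\sqrt{q_{i,i+1}}S(i),\dots,\sqrt{q_{iN}}S(i)\big],$$ $$\Xi_i(S)=\mathrm{diag}\big(S(1),\dots,S(i-1),S(i+1),\dots,S(N)\big).$$ Then, with the output feedback control law $u(t)=K(i)y(t)$ (when $r(t)=i$) and gains $K(i)=F(i)Y(i)^{-1}$,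 the origin of the resulting closed-loop system is ultimately bounded stable (UBS) in mean square.
   Context: Generator matrix: $q_{ij}\ge 0$ for $j\neq i$, $q_{ii}=-\sum_{j\ne i}q_{ij}$, and $\Pr(r(t+h)=j\mid r(t)=i)=q_{ij}h+o(h)$ for $j\ne i$, and $=1+q_{ii}h+o(h)$ for $j=i$. With $u=K(i)y$, the closed-loop system is understood as the Itô equation $$dx(t)=[A(i)+B(i)K(i)C(i)]x(t)\,dt+B(i)K(i)D(i)\,dw(t),\quad i=r(t),$$ where $dw=\omega\,dt$, $w$ is a standard $p$-dimensional Wiener process independent of $r$, and the initial condition $x(t_0)=x_0\in\mathbb R^n$, $r(t_0)=r_0\in\mathcal I$ is deterministic. For a symmetric matrix, $M<0$ means negative definite; $\mathrm{diag}$ of matrices denotes the block diagonal matrix. UBS in mean square: there exists $M>0$ such that $\mathbb E[x(t)^Tx(t)]\le M$ as $t\to\infty$, i.e. $\limsup_{t\to\infty}\mathbb E[x(t)^Tx(t)]\le M$ for the solution from every initial condition $(x_0,r_0)$. *)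

theory Defs
  imports "HOL-Probability.Probability"
begin

(* Throughout, real^'n^'m is the type of matrices with 'm rows and 'n columns,
   and the finite type 'i is the set of modes {1,...,N}. *)

section \<open>Markov chains and Wiener processes\<close>

definition generator_matrix :: "('i::finite \<Rightarrow> 'i \<Rightarrow> real) \<Rightarrow> bool" where
  "generator_matrix q \<longleftrightarrow>
     (\<forall>i j. j \<noteq> i \<longrightarrow> q i j \<ge> 0) \<and> (\<forall>i. q i i = - (\<Sum>j\<in>UNIV - {i}. q i j))"

(* Time-homogeneous Markov chain on [t0, oo) with cadlag paths. The transition
   probabilities p h i j are the same for all times t; without this uniformity the
   expansion in h would allow resets at deterministic times. For the discrete
   state space, cadlag means that paths are locally constant to the right and
   eventually constant from the left. *)
definition markov_chain ::
  "'w measure \<Rightarrow> real \<Rightarrow> ('i::finite \<Rightarrow> 'i \<Rightarrow> real) \<Rightarrow> (real \<Rightarrow> 'w \<Rightarrow> 'i) \<Rightarrow> bool" where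
  "markov_chain P t0 q r \<longleftrightarrow>
     (\<forall>t\<ge>t0. r t \<in> measurable P (count_space UNIV)) \<and>
     (AE \<omega> in P. \<forall>t\<ge>t0. (\<forall>\<^sub>F s in at_right t. r s \<omega> = r t \<omega>) \<and>
                        (t > t0 \<longrightarrow> (\<exists>j. \<forall>\<^sub>F s in at_left t. r s \<omega> = j))) \<and>
     (\<exists>p :: real \<Rightarrow> 'i \<Rightarrow> 'i \<Rightarrow> real.
        (\<forall>i j. j \<noteq> i \<longrightarrow> (\<lambda>h. p h i j - q i j * h) \<in> o[at_right 0](\<lambda>h. h)) \<and>
        (\<forall>i. (\<lambda>h. p h i i - (1 + q i i * h)) \<in> o[at_right 0](\<lambda>h. h)) \<and>
        (\<forall>t\<ge>t0. \<forall>h>0. \<forall>T (a :: real \<Rightarrow> 'i) i j. finite T \<longrightarrow> T \<subseteq> {t0..t} \<longrightarrow>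
           \<P>(\<omega> in P. r t \<omega> = i \<and> (\<forall>s\<in>T. r s \<omega> = a s)) > 0 \<longrightarrow>
           \<P>(\<omega> in P. r (t + h) \<omega> = j \<bar> r t \<omega> = i \<and> (\<forall>s\<in>T. r s \<omega> = a s)) = p h i j))"

definition filtered_prob_space :: "'w measure \<Rightarrow> (real \<Rightarrow> 'w measure) \<Rightarrow> bool" where
  "filtered_prob_space P F \<longleftrightarrow>
     prob_space P \<and> filtration (space P) F \<and> (\<forall>t. subalgebra P (F t))"

definition wiener_process ::
  "'w measure \<Rightarrow> (real \<Rightarrow> 'w measure) \<Rightarrow> (real \<Rightarrow> 'w \<Rightarrow> real^'p) \<Rightarrow> bool" where
  "wiener_process P F w \<longleftrightarrow>
     (\<forall>t\<ge>0. w t \<in> borel_measurable (F t)) \<and>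
     (AE \<omega> in P. w 0 \<omega> = 0) \<and>
     (AE \<omega> in P. continuous_on {0..} (\<lambda>t. w t \<omega>)) \<and>
     (\<forall>s t. 0 \<le> s \<longrightarrow> s < t \<longrightarrow>
        (\<forall>k. distributed P lborel (\<lambda>\<omega>. (w t \<omega> - w s \<omega>) $ k) (normal_density 0 (sqrt (t - s)))) \<and>
        prob_space.indep_vars P (\<lambda>_. borel) (\<lambda>k \<omega>. (w t \<omega> - w s \<omega>) $ k) UNIV \<and>
        prob_space.indep_set P (sets (F s))
          {(\<lambda>\<omega>. w t \<omega> - w s \<omega>) -` E \<inter> space P | E. E \<in> sets borel})"

definition independent_processes ::
  "'w measure \<Rightarrow> real \<Rightarrow> (real \<Rightarrow> 'w \<Rightarrow> 'i) \<Rightarrow> (real \<Rightarrow> 'w \<Rightarrow> real^'p) \<Rightarrow> bool" where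
  "independent_processes P t0 r w \<longleftrightarrow>
     prob_space.indep_set P
       (sigma_sets (space P) {r t -` E \<inter> space P | t E. t \<ge> t0})
       (sigma_sets (space P) {w t -` E \<inter> space P | t E. t \<ge> 0 \<and> E \<in> sets borel})"

section \<open>The Ito integral\<close>

(* (k, \<tau>, \<xi>) encodes the elementary process taking the value \<xi> j on [\<tau> j, \<tau> (j+1)), j < k. *)
definition elementary_process ::
  "'w measure \<Rightarrow> (real \<Rightarrow> 'w measure) \<Rightarrow> real \<Rightarrow> real \<Rightarrow>
   nat \<Rightarrow> (nat \<Rightarrow> real) \<Rightarrow> (nat \<Rightarrow> 'w \<Rightarrow> real^'p^'n) \<Rightarrow> bool" where
  "elementary_process P F a b k \<tau> \<xi> \<longleftrightarrow>
     \<tau> 0 = a \<and> \<tau> k = b \<and>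
     (\<forall>j<k. \<tau> j < \<tau> (Suc j) \<and> \<xi> j \<in> borel_measurable (F (\<tau> j)) \<and>
            (\<exists>c. \<forall>\<omega>\<in>space P. norm (\<xi> j \<omega>) \<le> c))"

definition elementary_value ::
  "nat \<Rightarrow> (nat \<Rightarrow> real) \<Rightarrow> (nat \<Rightarrow> 'w \<Rightarrow> real^'p^'n) \<Rightarrow> real \<Rightarrow> 'w \<Rightarrow> real^'p^'n" where
  "elementary_value k \<tau> \<xi> s \<omega> = (\<Sum>j<k. indicator {\<tau> j..<\<tau> (Suc j)} s *\<^sub>R \<xi> j \<omega>)"

definition elementary_integral ::
  "(real \<Rightarrow> 'w \<Rightarrow> real^'p) \<Rightarrow> nat \<Rightarrow> (nat \<Rightarrow> real) \<Rightarrow> (nat \<Rightarrow> 'w \<Rightarrow> real^'p^'n) \<Rightarrow> 'w \<Rightarrow> real^'n" where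
  "elementary_integral w k \<tau> \<xi> \<omega> = (\<Sum>j<k. \<xi> j \<omega> *v (w (\<tau> (Suc j)) \<omega> - w (\<tau> j) \<omega>))"

(* J is (a version of) the Ito integral of H dw over [a, b]: the mean-square limit of the
   integrals of elementary processes approximating H in L^2([a, b] x P). *)
definition has_ito_integral ::
  "'w measure \<Rightarrow> (real \<Rightarrow> 'w measure) \<Rightarrow> (real \<Rightarrow> 'w \<Rightarrow> real^'p) \<Rightarrow> real \<Rightarrow> real \<Rightarrow>
   (real \<Rightarrow> 'w \<Rightarrow> real^'p^'n) \<Rightarrow> ('w \<Rightarrow> real^'n) \<Rightarrow> bool" where
  "has_ito_integral P F w a b H J \<longleftrightarrow>
     (\<forall>s\<in>{a..b}. H s \<in> borel_measurable (F s)) \<and>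
     (\<lambda>(s, \<omega>). H s \<omega>) \<in> borel_measurable (restrict_space borel {a..b} \<Otimes>\<^sub>M P) \<and>
     (\<integral>\<^sup>+\<omega>. (\<integral>\<^sup>+s\<in>{a..b}. ennreal ((norm (H s \<omega>))\<^sup>2) \<partial>lborel) \<partial>P) < \<infinity> \<and>
     J \<in> borel_measurable P \<and>
     (\<exists>(k :: nat \<Rightarrow> nat) (\<tau> :: nat \<Rightarrow> nat \<Rightarrow> real) (\<xi> :: nat \<Rightarrow> nat \<Rightarrow> 'w \<Rightarrow> real^'p^'n).
        (\<forall>l. elementary_process P F a b (k l) (\<tau> l) (\<xi> l)) \<and>
        (\<lambda>l. \<integral>\<^sup>+\<omega>. (\<integral>\<^sup>+s\<in>{a..b}.
               ennreal ((norm (H s \<omega> - elementary_value (k l) (\<tau> l) (\<xi> l) s \<omega>))\<^sup>2) \<partial>lborel) \<partial>P)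
          \<longlonglongrightarrow> 0 \<and>
        (\<lambda>l. \<integral>\<^sup>+\<omega>. ennreal ((norm (J \<omega> - elementary_integral w (k l) (\<tau> l) (\<xi> l) \<omega>))\<^sup>2) \<partial>P)
          \<longlonglongrightarrow> 0)"

section \<open>Markovian jump linear systems and mean-square ultimate boundedness\<close>

(* x solves dx = A(r) x dt + G(r) dw on [t0, oo), x(t0) = x0, r(t0) = r0. *)
definition jump_system_solution ::
  "'w measure \<Rightarrow> (real \<Rightarrow> 'w measure) \<Rightarrow> (real \<Rightarrow> 'w \<Rightarrow> real^'p) \<Rightarrow> (real \<Rightarrow> 'w \<Rightarrow> 'i) \<Rightarrow>
   real \<Rightarrow> ('i::finite \<Rightarrow> 'i \<Rightarrow> real) \<Rightarrow> ('i \<Rightarrow> real^'n^'n) \<Rightarrow> ('i \<Rightarrow> real^'p^'n) \<Rightarrow>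
   real^'n \<Rightarrow> 'i \<Rightarrow> (real \<Rightarrow> 'w \<Rightarrow> real^'n) \<Rightarrow> bool" where
  "jump_system_solution P F w r t0 q A G x0 r0 x \<longleftrightarrow>
     filtered_prob_space P F \<and>
     wiener_process P F w \<and>
     markov_chain P t0 q r \<and> (\<forall>t\<ge>t0. r t \<in> measurable (F t) (count_space UNIV)) \<and>
     independent_processes P t0 r w \<and>
     (AE \<omega> in P. r t0 \<omega> = r0) \<and>
     (AE \<omega> in P. x t0 \<omega> = x0) \<and>
     (\<forall>t\<ge>t0. x t \<in> borel_measurable (F t)) \<and>
     (AE \<omega> in P. continuous_on {t0..} (\<lambda>t. x t \<omega>)) \<and>
     (\<forall>t\<ge>t0. has_ito_integral P F w t0 t (\<lambda>s \<omega>. G (r s \<omega>))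
        (\<lambda>\<omega>. x t \<omega> - x0 - integral {t0..t} (\<lambda>s. A (r s \<omega>) *v x s \<omega>)))"

(* The bound M depends only on the system data; the realisation (probability space,
   Wiener process, chain) and the initial condition are quantified after it. *)
definition ubs_mean_square ::
  "'w itself \<Rightarrow> real \<Rightarrow> ('i::finite \<Rightarrow> 'i \<Rightarrow> real) \<Rightarrow>
   ('i \<Rightarrow> real^'n^'n) \<Rightarrow> ('i \<Rightarrow> real^'p^'n) \<Rightarrow> bool" where
  "ubs_mean_square (_ :: 'w itself) t0 q A G \<longleftrightarrow>
     (\<exists>M>0. \<forall>x0 r0 (P :: 'w measure) F w r x.
        jump_system_solution P F w r t0 q A G x0 r0 x \<longrightarrow>
        Limsup at_top (\<lambda>t. \<integral>\<^sup>+\<omega>. ennreal (x t \<omega> \<bullet> x t \<omega>) \<partial>P) \<le> ennreal M)"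

(* Substituting u = K y = K (C x + D \<omega>) into x' = A x + B u. *)
definition closed_loop_drift ::
  "('i \<Rightarrow> real^'n^'n) \<Rightarrow> ('i \<Rightarrow> real^'m^'n) \<Rightarrow> ('i \<Rightarrow> real^'n^'p) \<Rightarrow> ('i \<Rightarrow> real^'p^'m) \<Rightarrow>
   'i \<Rightarrow> real^'n^'n" where
  "closed_loop_drift A B C K i = A i + B i ** K i ** C i"

definition closed_loop_diffusion ::
  "('i \<Rightarrow> real^'m^'n) \<Rightarrow> ('i \<Rightarrow> real^'p^'p) \<Rightarrow> ('i \<Rightarrow> real^'p^'m) \<Rightarrow> 'i \<Rightarrow> real^'p^'n" where
  "closed_loop_diffusion B D K i = B i ** K i ** D i"

section \<open>The matrix inequality\<close>

definition sym_pos_def :: "real^'k^'k \<Rightarrow> bool" where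
  "sym_pos_def X \<longleftrightarrow> transpose X = X \<and> (\<forall>v. v \<noteq> 0 \<longrightarrow> v \<bullet> (X *v v) > 0)"

(* Negative definiteness of a symmetric matrix whose rows and columns are indexed by a
   finite set I. An index set rather than a type is needed because the block matrix below
   has its blocks indexed by the modes j \<noteq> i. *)
definition neg_def_on :: "'a set \<Rightarrow> ('a \<Rightarrow> 'a \<Rightarrow> real) \<Rightarrow> bool" where
  "neg_def_on I X \<longleftrightarrow>
     (\<forall>a\<in>I. \<forall>b\<in>I. X a b = X b a) \<and>
     (\<forall>v. (\<exists>a\<in>I. v a \<noteq> 0) \<longrightarrow> (\<Sum>a\<in>I. \<Sum>b\<in>I. v a * X a b * v b) < 0)"

definition Delta ::
  "('i \<Rightarrow> 'i \<Rightarrow> real) \<Rightarrow> ('i \<Rightarrow> real^'n^'n) \<Rightarrow> ('i \<Rightarrow> real^'m^'n) \<Rightarrow> ('i \<Rightarrow> real^'n^'p) \<Rightarrow>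
   ('i \<Rightarrow> real^'n^'n) \<Rightarrow> ('i \<Rightarrow> real^'p^'m) \<Rightarrow> 'i \<Rightarrow> real^'n^'n" where
  "Delta q A B C S F i =
     S i ** transpose (A i) + transpose (C i) ** transpose (F i) ** transpose (B i)
     + A i ** S i + B i ** F i ** C i + q i i *\<^sub>R S i"

(* Column (j, b) is column b of the block belonging to mode j. *)
definition Lambda ::
  "('i \<Rightarrow> 'i \<Rightarrow> real) \<Rightarrow> ('i \<Rightarrow> real^'n^'n) \<Rightarrow> 'i \<Rightarrow> 'n \<Rightarrow> 'i \<times> 'n \<Rightarrow> real" where
  "Lambda q S i a = (\<lambda>(j, b). sqrt (q i j) * S i $ a $ b)"

definition Xi :: "('i \<Rightarrow> real^'n^'n) \<Rightarrow> 'i \<times> 'n \<Rightarrow> 'i \<times> 'n \<Rightarrow> real" where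
  "Xi S = (\<lambda>(j, a) (k, b). if j = k then S j $ a $ b else 0)"

fun lmi_matrix ::
  "('i \<Rightarrow> 'i \<Rightarrow> real) \<Rightarrow> ('i \<Rightarrow> real^'n^'n) \<Rightarrow> ('i \<Rightarrow> real^'m^'n) \<Rightarrow> ('i \<Rightarrow> real^'n^'p) \<Rightarrow>
   ('i \<Rightarrow> real^'n^'n) \<Rightarrow> ('i \<Rightarrow> real^'p^'m) \<Rightarrow> 'i \<Rightarrow>
   'n + 'i \<times> 'n \<Rightarrow> 'n + 'i \<times> 'n \<Rightarrow> real" where
  "lmi_matrix q A B C S F i (Inl a) (Inl b) = Delta q A B C S F i $ a $ b"
| "lmi_matrix q A B C S F i (Inl a) (Inr d) = Lambda q S i a d"
| "lmi_matrix q A B C S F i (Inr c) (Inl b) = Lambda q S i b c"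
| "lmi_matrix q A B C S F i (Inr c) (Inr d) = - Xi S c d"

definition lmi_index :: "'i \<Rightarrow> ('n + 'i \<times> 'n) set" where
  "lmi_index i = UNIV <+> ((UNIV - {i}) \<times> UNIV)"

end

theory Submission
  imports Defs
begin

text \<open>
  Congruence with \<open>P i = S i\<^sup>-\<^sup>1\<close> and a Schur complement turn the matrix inequality into
  \<open>A\<^sup>T P i + P i A + (\<Sum>j. q i j P j) < 0\<close> for the closed-loop drift \<open>A\<close>, so \<open>x\<^sup>T P(r) x\<close> is a stochastic
  Lyapunov function. To avoid an Ito formula for the switched system, the decay is proved for the
  Euler scheme of step \<open>h\<close> on \<open>[t0, t]\<close>: the Markov property, the independence of \<open>r\<close> and \<open>w\<close> and
  the martingale property of the increments of \<open>w\<close> give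
  \<open>v (k + 1) \<le> (1 - \<alpha> h) v k + \<beta> h\<close> for \<open>v k = E[x\<^sub>k\<^sup>T P(r) x\<^sub>k]\<close> once \<open>h\<close> is small, where \<open>\<alpha>\<close> and
  \<open>\<beta>\<close> depend only on the matrices. For fixed \<open>t\<close>, the scheme converges almost surely to \<open>x t\<close> along a
  sequence of steps tending to 0: the Ito isometry controls the noise, and the Riemann sums of the
  drift converge because a path of \<open>r\<close> has finitely many jumps. Fatou's lemma then
  transfers the bound to \<open>x t\<close>.
\<close>

section \<open>The Lyapunov inequality\<close>

text \<open>Two features of the definitions dictate the route. The Markov property of
  \<open>r\<close> is stated relative to finitely many past values of the chain, not relative to the
  filtration, so it does not apply directly to \<open>x t\<close>, which is merely adapted. An Euler
  iterate is an explicit function of \<open>w\<close> and of \<open>r\<close> at finitely many grid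
  times, and for such functionals the independence of \<open>r\<close> and \<open>w\<close> does
  give the law of the next mode. Moreover, the Ito integral is characterised separately for each end
  point, by a mean-square limit; the convergence argument therefore uses only errors at single grid
  times and their time average. In each step the next mode is averaged out before the noise, so that
  the weight becomes a function of the current mode and the increment of \<open>w\<close> is
  independent of all other factors. The rate \<alpha> uses half of the margin of the continuous
  Lyapunov inequality; the other half absorbs the terms of higher order in \<open>h\<close>. How
  small \<open>h\<close> has to be may depend on the realisation, but \<open>h\<close> is sent to 0,
  so the final constant does not.\<close>

lemma norm_matrix_vector_mult_le:
  fixes M :: "real^'n^'m"
  shows "norm (M *v v) \<le> norm M * norm v"
proof -
  \<comment> \<open>The norm of a matrix is the Frobenius norm, so Cauchy-Schwarz is applied to each
    row.\<close>
  have "norm (M *v v) = L2_set (\<lambda>i. \<bar>M $ i \<bullet> v\<bar>) UNIV"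
    by (simp add: norm_vec_def matrix_vector_mul_component)
  also have "\<dots> \<le> L2_set (\<lambda>i. norm (M $ i) * norm v) UNIV"
    by (intro L2_set_mono) (auto simp: Cauchy_Schwarz_ineq2)
  also have "\<dots> = norm M * norm v"
    by (simp add: norm_vec_def L2_set_left_distrib)
  finally show ?thesis .
qed

lemma inner_matrix_le:
  fixes M :: "real^'n^'m"
  shows "\<bar>u \<bullet> (M *v v)\<bar> \<le> norm M * norm u * norm v"
proof -
  have "\<bar>u \<bullet> (M *v v)\<bar> \<le> norm u * norm (M *v v)"
    by (rule Cauchy_Schwarz_ineq2)
  also have "\<dots> \<le> norm u * (norm M * norm v)"
    by (intro mult_left_mono norm_matrix_vector_mult_le) auto
  finally show ?thesis by (simp add: mult_ac)
qed

lemma sym_inner_commute: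
  fixes M :: "real^'n^'n"
  assumes "transpose M = M"
  shows "u \<bullet> (M *v v) = (M *v u) \<bullet> v"
  by (metis assms dot_lmul_matrix vector_transpose_matrix)

text \<open>Definiteness makes the kernel trivial, hence \<open>M\<close> invertible; the form of
  the inverse at \<open>v\<close> is the form of \<open>M\<close> at
  \<open>matrix_inv M *v v\<close>.\<close>

lemma
  fixes M :: "real^'n^'n"
  assumes "sym_pos_def M"
  shows sym_pos_def_invertible: "M ** matrix_inv M = mat 1" "matrix_inv M ** M = mat 1"
    and sym_pos_def_inv: "sym_pos_def (matrix_inv M)"
proof -
  have "\<And>v. M *v v = 0 \<Longrightarrow> v = 0"
    using assms unfolding sym_pos_def_def by (metis inner_zero_right less_irrefl)
  then have inv: "invertible M"
    by (metis invertible_left_inverse matrix_left_invertible_ker)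
  then show 1: "M ** matrix_inv M = mat 1" and 2: "matrix_inv M ** M = mat 1"
    unfolding invertible_def matrix_inv_def by (rule someI2_ex, blast)+
  have tr: "transpose M = M"
    using assms by (simp add: sym_pos_def_def)
  have tr': "transpose (matrix_inv M) = matrix_inv M"
    by (metis 1 2 matrix_mul_assoc matrix_mul_lid matrix_mul_rid matrix_transpose_mul tr transpose_mat)
  moreover have "v \<bullet> (matrix_inv M *v v) > 0" if "v \<noteq> 0" for v
  proof -
    define u where "u = matrix_inv M *v v"
    have v: "v = M *v u"
      unfolding u_def by (simp add: matrix_vector_mul_assoc 1)
    then have "u \<noteq> 0" using that by auto
    then have "u \<bullet> (M *v u) > 0"
      using assms by (simp add: sym_pos_def_def)
    then show ?thesis
      unfolding u_def[symmetric] by (subst v) (simp add: inner_commute)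
  qed
  ultimately show "sym_pos_def (matrix_inv M)"
    by (simp add: sym_pos_def_def)
qed

text \<open>By compactness \<open>f\<close> attains a positive minimum on the unit sphere, and
  homogeneity of degree two spreads this bound to all vectors. Used both for the negated Lyapunov
  form and for the weights of the Lyapunov function.\<close>

lemma quadratic_form_coercive:
  fixes f :: "real^'n \<Rightarrow> real"
  assumes cont: "continuous_on UNIV f"
    and hom: "\<And>c v. f (c *\<^sub>R v) = c\<^sup>2 * f v"
    and pos: "\<And>v. v \<noteq> 0 \<Longrightarrow> f v > 0"
  obtains c where "c > 0" "\<And>v. c * (norm v)\<^sup>2 \<le> f v"
proof -
  have "compact (sphere (0::real^'n) 1)" "sphere (0::real^'n) 1 \<noteq> {}"
    by auto
  then obtain u where u: "u \<in> sphere 0 1" "\<And>v. v \<in> sphere 0 1 \<Longrightarrow> f u \<le> f v"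
    using continuous_attains_inf[of "sphere 0 1" f] continuous_on_subset[OF cont] by blast
  show thesis
  proof
    have "u \<noteq> 0" using u(1) by auto
    then show "f u > 0" by (rule pos)
    show "f u * (norm v)\<^sup>2 \<le> f v" for v
    proof (cases "v = 0")
      case True
      then show ?thesis using hom[of 0 0] by simp
    next
      case False
      have "f v = (norm v)\<^sup>2 * f (v /\<^sub>R norm v)"
        using False hom[of "norm v" "v /\<^sub>R norm v"] by simp
      moreover have "f u \<le> f (v /\<^sub>R norm v)"
        using False by (intro u) auto
      ultimately show ?thesis
        using mult_right_mono[of "f u" "f (v /\<^sub>R norm v)" "(norm v)\<^sup>2"] by (simp add: mult.commute)
    qed
  qed
qed

text \<open>Makes constants that exist for each mode uniform over the finitely many modes: smaller
  positive constants stay admissible, so the minimum works.\<close>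

lemma finite_common_lower_bound:
  fixes Q :: "'i::finite \<Rightarrow> real \<Rightarrow> bool"
  assumes "\<And>i. \<exists>c>0. Q i c" and "\<And>i c d. Q i c \<Longrightarrow> 0 < d \<Longrightarrow> d \<le> c \<Longrightarrow> Q i d"
  obtains c where "c > 0" "\<And>i. Q i c"
proof -
  obtain f where f: "\<And>i. f i > 0" "\<And>i. Q i (f i)" using assms(1) by metis
  show thesis
  proof
    show "Min (range f) > 0" using f(1) by (subst Min_gr_iff) auto
    then show "Q i (Min (range f))" for i
      by (rule assms(2)[OF f(2)[of i]]) auto
  qed
qed

section \<open>Coupled Lyapunov inequalities from the block matrix inequality, and their one-step
  form\<close>

lemma lyapunov_of_lmi:
  fixes A :: "'i::finite \<Rightarrow> real^'n^'n" and B :: "'i \<Rightarrow> real^'m^'n" and C :: "'i \<Rightarrow> real^'n^'p"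
  assumes gen: "generator_matrix q" and S: "\<And>i. sym_pos_def (S i)" and Y: "sym_pos_def (Y i)"
    and lmi: "neg_def_on (lmi_index i) (lmi_matrix q A B C S F i)"
    and CS: "C i ** S i - Y i ** C i = 0" and v: "v \<noteq> 0"
  shows "2 * ((matrix_inv (S i) *v v) \<bullet>
            (closed_loop_drift A B C (\<lambda>i. F i ** matrix_inv (Y i)) i *v v))
         + (\<Sum>j\<in>UNIV. q i j * (v \<bullet> (matrix_inv (S j) *v v))) < 0"
proof -
  (* Testing the matrix inequality with (S_i^-1 v, (sqrt q_ij S_j^-1 v)_j) amounts to taking the
     Schur complement. *)
  define a where "a = matrix_inv (S i) *v v"
  define b where "b j = sqrt (q i j) *\<^sub>R (matrix_inv (S j) *v v)" for j
  define z where "z = (\<lambda>k. case k of Inl k \<Rightarrow> a $ k | Inr (j, k) \<Rightarrow> b j $ k)"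
  let ?X = "lmi_matrix q A B C S F i"
  note inv = sym_pos_def_invertible[OF S] and invY = sym_pos_def_invertible[OF Y]
  have Sa: "S i *v a = v" and a0: "a \<noteq> 0"
    using v by (auto simp: a_def matrix_vector_mul_assoc inv)
      (metis inv(1) matrix_vector_mul_assoc matrix_vector_mul_lid matrix_vector_mult_0_right)
  have symS: "transpose (S i) = S i" for i using S[of i] by (simp add: sym_pos_def_def)
  have "\<exists>k. a $ k \<noteq> 0" using a0 by (simp add: vec_eq_iff)
  then have "\<exists>k\<in>lmi_index i. z k \<noteq> 0"
    by (auto simp: lmi_index_def z_def intro!: bexI[of _ "Inl _"])
  then have neg: "(\<Sum>k\<in>lmi_index i. \<Sum>l\<in>lmi_index i. z k * ?X k l * z l) < 0"
    using lmi by (simp add: neg_def_on_def)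
  let ?J = "(UNIV - {i}) \<times> (UNIV :: 'n set)"
  have split: "sum h (lmi_index i) = (\<Sum>k\<in>UNIV. h (Inl k)) + (\<Sum>d\<in>?J. h (Inr d))"
    for h :: "'n + 'i \<times> 'n \<Rightarrow> real"
    unfolding lmi_index_def by (subst sum.Plus) auto
  have cart: "sum h ?J = (\<Sum>j\<in>UNIV-{i}. \<Sum>k\<in>UNIV. h (j, k))" for h :: "'i \<times> 'n \<Rightarrow> real"
    by (simp add: sum.cartesian_product)
  have 1: "(\<Sum>k\<in>UNIV. \<Sum>l\<in>UNIV. z (Inl k) * ?X (Inl k) (Inl l) * z (Inl l))
      = a \<bullet> (Delta q A B C S F i *v a)"
    by (simp add: z_def inner_vec_def matrix_vector_mult_def sum_distrib_left mult_ac)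
  have 2: "(\<Sum>k\<in>UNIV. \<Sum>d\<in>?J. z (Inl k) * ?X (Inl k) (Inr d) * z (Inr d))
      = (\<Sum>j\<in>UNIV-{i}. sqrt (q i j) * (a \<bullet> (S i *v b j)))"
  proof -
    have "(\<Sum>k\<in>UNIV. \<Sum>d\<in>?J. z (Inl k) * ?X (Inl k) (Inr d) * z (Inr d))
       = (\<Sum>k\<in>UNIV. \<Sum>j\<in>UNIV-{i}. \<Sum>l\<in>UNIV. a $ k * (sqrt (q i j) * S i $ k $ l) * b j $ l)"
      by (simp add: z_def Lambda_def sum.cartesian_product case_prod_unfold)
    also have "\<dots> = (\<Sum>j\<in>UNIV-{i}. \<Sum>k\<in>UNIV. \<Sum>l\<in>UNIV. a $ k * (sqrt (q i j) * S i $ k $ l) * b j $ l)"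
      by (rule sum.swap)
    finally show ?thesis
      by (simp add: inner_vec_def matrix_vector_mult_def sum_distrib_left mult_ac)
  qed
  have 3: "(\<Sum>d\<in>?J. \<Sum>k\<in>UNIV. z (Inr d) * ?X (Inr d) (Inl k) * z (Inl k))
      = (\<Sum>k\<in>UNIV. \<Sum>d\<in>?J. z (Inl k) * ?X (Inl k) (Inr d) * z (Inr d))"
    by (subst sum.swap) (simp add: mult_ac)
  have 4: "(\<Sum>d\<in>?J. \<Sum>e\<in>?J. z (Inr d) * ?X (Inr d) (Inr e) * z (Inr e))
      = - (\<Sum>j\<in>UNIV-{i}. b j \<bullet> (S j *v b j))"
  proof -
    have "(\<Sum>d\<in>?J. \<Sum>e\<in>?J. z (Inr d) * ?X (Inr d) (Inr e) * z (Inr e))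
       = (\<Sum>j\<in>UNIV-{i}. \<Sum>k\<in>UNIV. \<Sum>j'\<in>UNIV-{i}. \<Sum>l\<in>UNIV.
            b j $ k * (- (if j = j' then S j $ k $ l else 0)) * b j' $ l)"
      unfolding cart by (simp add: z_def Xi_def)
    also have "\<dots> = (\<Sum>j\<in>UNIV-{i}. \<Sum>k\<in>UNIV. \<Sum>j'\<in>UNIV-{i}.
            if j' = j then \<Sum>l\<in>UNIV. b j $ k * (- S j $ k $ l) * b j $ l else 0)"
      by (intro sum.cong) auto
    also have "\<dots> = (\<Sum>j\<in>UNIV-{i}. \<Sum>k\<in>UNIV. \<Sum>l\<in>UNIV. b j $ k * (- S j $ k $ l) * b j $ l)"
      by (intro sum.cong refl) (simp add: sum.delta)
    finally show ?thesis
      by (simp add: inner_vec_def matrix_vector_mult_def sum_distrib_left sum_negf mult_ac)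
  qed
  have q: "q i j \<ge> 0" if "j \<noteq> i" for j using gen that by (simp add: generator_matrix_def)
  have 5: "sqrt (q i j) * (a \<bullet> (S i *v b j)) = q i j * (v \<bullet> (matrix_inv (S j) *v v))"
    if "j \<noteq> i" for j
    using q[OF that] by (simp add: sym_inner_commute[OF symS] Sa b_def flip: mult.assoc)
  have 6: "b j \<bullet> (S j *v b j) = q i j * (v \<bullet> (matrix_inv (S j) *v v))" if "j \<noteq> i" for j
    using q[OF that]
    by (simp add: b_def matrix_vector_mult_scaleR matrix_vector_mul_assoc inv inner_commute
        flip: mult.assoc)
  \<comment> \<open>The two off-diagonal blocks contribute the coupling sum once each and the lower
    right block subtracts it once, so exactly one copy remains.\<close>
  have main: "a \<bullet> (Delta q A B C S F i *v a)
      + (\<Sum>j\<in>UNIV-{i}. q i j * (v \<bullet> (matrix_inv (S j) *v v))) < 0"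
  proof -
    have 7: "(\<Sum>j\<in>UNIV-{i}. sqrt (q i j) * (a \<bullet> (S i *v b j)))
        = (\<Sum>j\<in>UNIV-{i}. q i j * (v \<bullet> (matrix_inv (S j) *v v)))"
      by (intro sum.cong) (auto simp: 5)
    have 8: "(\<Sum>j\<in>UNIV-{i}. b j \<bullet> (S j *v b j))
        = (\<Sum>j\<in>UNIV-{i}. q i j * (v \<bullet> (matrix_inv (S j) *v v)))"
      by (intro sum.cong) (auto simp: 6)
    show ?thesis
      using neg unfolding split sum.distrib 3 2 1 4 7 8 by simp
  qed
  \<comment> \<open>The equation \<open>C S = Y C\<close> gives \<open>Y C a = C v\<close>. This is
    where the gain enters: \<open>F C a = F Y^-1 C v = K C v\<close>, which reverses the
    substitution \<open>F = K Y\<close> that makes the matrix inequality linear.\<close>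
  have CY: "C i *v a = matrix_inv (Y i) *v (C i *v v)"
  proof -
    have "Y i *v (C i *v a) = C i *v v"
      using CS by (simp add: matrix_vector_mul_assoc flip: Sa)
    then show ?thesis
      by (metis invY(2) matrix_vector_mul_assoc matrix_vector_mul_lid)
  qed
  \<comment> \<open>A matrix and its transpose have the same quadratic form, so each transposed pair
    in \<open>Delta\<close> counts twice.\<close>
  have tr: "a \<bullet> ((transpose (C i) ** transpose (F i) ** transpose (B i)) *v a)
      = a \<bullet> ((B i ** F i ** C i) *v a)"
    by (metis (no_types) dot_lmul_matrix inner_commute matrix_mul_assoc matrix_transpose_mul
        transpose_matrix_vector transpose_transpose)
  have trA: "a \<bullet> ((S i ** transpose (A i)) *v a) = a \<bullet> ((A i ** S i) *v a)"
    by (metis (no_types) dot_lmul_matrix inner_commute matrix_transpose_mul symS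
        transpose_matrix_vector transpose_transpose)
  have A: "(A i ** S i) *v a = A i *v v" by (simp flip: matrix_vector_mul_assoc add: Sa)
  have BF: "(B i ** F i ** C i) *v a = (B i ** (F i ** matrix_inv (Y i)) ** C i) *v v"
    by (simp flip: matrix_vector_mul_assoc add: CY)
  have "a \<bullet> (Delta q A B C S F i *v a) = 2 * (a \<bullet> (A i *v v))
      + 2 * (a \<bullet> ((B i ** (F i ** matrix_inv (Y i)) ** C i) *v v)) + q i i * (a \<bullet> v)"
    unfolding Delta_def matrix_vector_mult_add_rdistrib inner_add_right tr trA
    by (simp add: A BF Sa flip: scaleR_matrix_vector_assoc)
  \<comment> \<open>The term \<open>q i i *\<^sub>R S i\<close> of \<open>Delta\<close> supplies the
    summand j = i, for which the block matrix has no block.\<close>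
  moreover have "(\<Sum>j\<in>UNIV. q i j * (v \<bullet> (matrix_inv (S j) *v v)))
     = q i i * (v \<bullet> a) + (\<Sum>j\<in>UNIV-{i}. q i j * (v \<bullet> (matrix_inv (S j) *v v)))"
    by (subst sum.remove[of _ i]) (auto simp: a_def)
  ultimately show ?thesis
    using main unfolding closed_loop_drift_def a_def[symmetric]
    by (simp add: matrix_vector_mult_add_rdistrib inner_add_right inner_commute algebra_simps)
qed

text \<open>With \<open>p h i j\<close> written as the identity plus \<open>h\<close> times a
  difference quotient tending to \<open>q i j\<close>, the left side is the old value plus
  \<open>h\<close> times the continuous Lyapunov form plus a remainder of smaller order. The rate
  \<alpha> is fixed before \<open>p\<close>, because the final bound must not depend on the
  realisation; only the range of admissible steps may depend on \<open>p\<close>.\<close>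

lemma discrete_lyapunov:
  fixes A P :: "'i::finite \<Rightarrow> real^'n^'n"
  assumes P: "\<And>i. sym_pos_def (P i)"
    and neg: "\<And>i v. v \<noteq> 0 \<Longrightarrow> 2 * ((P i *v v) \<bullet> (A i *v v)) + (\<Sum>j\<in>UNIV. q i j * (v \<bullet> (P j *v v))) < 0"
  obtains \<alpha> where "\<alpha> > 0"
    "\<And>p :: real \<Rightarrow> 'i \<Rightarrow> 'i \<Rightarrow> real.
       (\<And>i j. ((\<lambda>h. (p h i j - (if j = i then 1 else 0)) / h) \<longlongrightarrow> q i j) (at_right 0)) \<Longrightarrow>
       \<forall>\<^sub>F h in at_right 0. \<forall>i v. (\<Sum>j\<in>UNIV. p h i j * ((v + h *\<^sub>R (A i *v v)) \<bullet> (P j *v (v + h *\<^sub>R (A i *v v)))))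
          \<le> (1 - \<alpha> * h) * (v \<bullet> (P i *v v))"
proof -
  define Ly where "Ly i v = 2 * ((P i *v v) \<bullet> (A i *v v)) + (\<Sum>j\<in>UNIV. q i j * (v \<bullet> (P j *v v)))" for i v
  have "\<exists>c>0. \<forall>v. c * (norm v)\<^sup>2 \<le> - Ly i v" for i
  proof -
    have "continuous_on UNIV (\<lambda>v. - Ly i v)"
      unfolding Ly_def by (intro continuous_intros matrix_vector_mult_linear_continuous_on)
    moreover have "- Ly i (c *\<^sub>R v) = c\<^sup>2 * - Ly i v" for c v
      by (simp add: Ly_def matrix_vector_mult_scaleR power2_eq_square sum_distrib_left algebra_simps)
    ultimately show ?thesis
      using neg[of _ i] quadratic_form_coercive[of "\<lambda>v. - Ly i v"]
      unfolding Ly_def[symmetric] by (metis neg_0_less_iff_less)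
  qed
  moreover have "d * (norm v)\<^sup>2 \<le> x" if "c * (norm v)\<^sup>2 \<le> x" "d \<le> c" for c d x and v :: "real^'n"
    using order_trans[OF mult_right_mono[OF that(2), of "(norm v)\<^sup>2"] that(1)] by simp
  ultimately obtain c where c: "c > 0" "\<And>i v. c * (norm v)\<^sup>2 \<le> - Ly i v"
    using finite_common_lower_bound[of "\<lambda>i c. \<forall>v. c * (norm v)\<^sup>2 \<le> - Ly i v"] by blast
  \<comment> \<open>\<open>K * (norm v)\<^sup>2\<close> dominates the three forms in the expansion
    of one step: with \<open>p\<close> and \<open>a\<close> the largest norms of weights and drifts,
    these are at most \<open>p\<close>, \<open>p * a\<close> and \<open>p * a\<^sup>2\<close> times
    \<open>(norm v)\<^sup>2\<close>. The summand 1 makes positivity immediate.\<close>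
  define K where "K = Max (range (\<lambda>i. norm (P i))) * (1 + Max (range (\<lambda>i. norm (A i))))\<^sup>2 + 1"
  \<comment> \<open>By this choice \<open>2 * \<alpha> * K = c\<close>: half of the margin
    \<open>c\<close> absorbs the remainder \<open>err\<close>, the other half is left as
    decay.\<close>
  define \<alpha> where "\<alpha> = c / (2 * K)"
  have PM: "norm (P i) \<le> Max (range (\<lambda>i. norm (P i)))" and AM: "norm (A i) \<le> Max (range (\<lambda>i. norm (A i)))" for i
    by auto
  have PM0: "0 \<le> Max (range (\<lambda>i. norm (P i)))" and AM0: "0 \<le> Max (range (\<lambda>i. norm (A i)))"
    using PM AM norm_ge_zero order_trans by blast+
  have K: "K > 0" unfolding K_def using PM0 by (simp add: add_nonneg_pos)
  have KK: "x * 1 \<le> x * (1 + y)\<^sup>2 + 1" "x * y \<le> x * (1 + y)\<^sup>2 + 1" "x * y\<^sup>2 \<le> x * (1 + y)\<^sup>2 + 1"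
    if "0 \<le> x" "0 \<le> y" for x y :: real
  proof -
    have "1 \<le> (1 + y)\<^sup>2" "y \<le> (1 + y)\<^sup>2" "y\<^sup>2 \<le> (1 + y)\<^sup>2"
      using that by (simp_all add: power2_eq_square algebra_simps)
    then show "x * 1 \<le> x * (1 + y)\<^sup>2 + 1" "x * y \<le> x * (1 + y)\<^sup>2 + 1" "x * y\<^sup>2 \<le> x * (1 + y)\<^sup>2 + 1"
      using that mult_left_mono[of _ "(1 + y)\<^sup>2" x] by (meson add_increasing2 zero_le_one)+
  qed
  have b1: "\<bar>v \<bullet> (P j *v v)\<bar> \<le> K * (norm v)\<^sup>2"
    and b2: "\<bar>(P j *v v) \<bullet> (A i *v v)\<bar> \<le> K * (norm v)\<^sup>2"
    and b3: "\<bar>(A i *v v) \<bullet> (P j *v (A i *v v))\<bar> \<le> K * (norm v)\<^sup>2" for i j v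
  proof -
    let ?p = "Max (range (\<lambda>i. norm (P i)))" and ?a = "Max (range (\<lambda>i. norm (A i)))"
    have Av: "norm (A i *v v) \<le> ?a * norm v"
      using norm_matrix_vector_mult_le[of "A i" v] mult_right_mono[OF AM, of "norm v"] order_trans by fastforce
    have Pv: "norm (P j *v v) \<le> ?p * norm v" for v
      using norm_matrix_vector_mult_le[of "P j" v] mult_right_mono[OF PM, of "norm v"] order_trans by fastforce
    have "\<bar>v \<bullet> (P j *v v)\<bar> \<le> norm v * (?p * norm v)"
      using Cauchy_Schwarz_ineq2[of v "P j *v v"] mult_left_mono[OF Pv[of v], of "norm v"] by simp
    also have "\<dots> = ?p * 1 * (norm v)\<^sup>2" by (simp add: power2_eq_square)
    also have "\<dots> \<le> K * (norm v)\<^sup>2"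
      unfolding K_def by (intro mult_right_mono KK[OF PM0 AM0]) simp
    finally show "\<bar>v \<bullet> (P j *v v)\<bar> \<le> K * (norm v)\<^sup>2" .
    have "\<bar>(P j *v v) \<bullet> (A i *v v)\<bar> \<le> (?p * norm v) * (?a * norm v)"
      using Cauchy_Schwarz_ineq2[of "P j *v v" "A i *v v"] mult_mono[OF Pv[of v] Av] PM0 by simp
    also have "\<dots> = (?p * ?a) * (norm v)\<^sup>2" by (simp add: power2_eq_square)
    also have "\<dots> \<le> K * (norm v)\<^sup>2"
      unfolding K_def by (intro mult_right_mono KK[OF PM0 AM0]) simp
    finally show "\<bar>(P j *v v) \<bullet> (A i *v v)\<bar> \<le> K * (norm v)\<^sup>2" .
    have "\<bar>(A i *v v) \<bullet> (P j *v (A i *v v))\<bar> \<le> (?a * norm v) * (?p * (?a * norm v))"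
      using Cauchy_Schwarz_ineq2[of "A i *v v" "P j *v (A i *v v)"]
        mult_mono[OF Av order_trans[OF Pv mult_left_mono[OF Av PM0]]] AM0 by simp
    also have "\<dots> = (?p * ?a\<^sup>2) * (norm v)\<^sup>2" by (simp add: power2_eq_square)
    also have "\<dots> \<le> K * (norm v)\<^sup>2"
      unfolding K_def by (intro mult_right_mono KK[OF PM0 AM0]) simp
    finally show "\<bar>(A i *v v) \<bullet> (P j *v (A i *v v))\<bar> \<le> K * (norm v)\<^sup>2" .
  qed
  show thesis
  proof (rule that)
    show "\<alpha> > 0" using c K by (simp add: \<alpha>_def)
    fix p :: "real \<Rightarrow> 'i \<Rightarrow> 'i \<Rightarrow> real"
    assume p: "\<And>i j. ((\<lambda>h. (p h i j - (if j = i then 1 else 0)) / h) \<longlongrightarrow> q i j) (at_right 0)"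
    define d where "d i j = (if j = i then 1 else 0 :: real)" for i j :: 'i
    define g where "g h i j = (p h i j - d i j) / h" for h i j
    have g: "((\<lambda>h. g h i j) \<longlongrightarrow> q i j) (at_right 0)" for i j
      using p[of i j] unfolding g_def d_def .
    \<comment> \<open>Relative to \<open>K * (norm v)\<^sup>2\<close>, the summands bound the error
      of the rates, the product of mode change and drift, and the quadratic Euler term; each tends
      to 0 with \<open>h\<close>.\<close>
    define err where "err h i = (\<Sum>j\<in>UNIV. \<bar>g h i j - q i j\<bar> + 2 * \<bar>h * g h i j\<bar> + \<bar>h * (d i j + h * g h i j)\<bar>)" for h i
    have h0: "((\<lambda>h. h) \<longlongrightarrow> 0) (at_right (0::real))" by (rule tendsto_ident_at)
    have "((\<lambda>h. err h i) \<longlongrightarrow> (\<Sum>j\<in>UNIV. \<bar>q i j - q i j\<bar> + 2 * \<bar>0 * q i j\<bar> + \<bar>0 * (d i j + 0 * q i j)\<bar>)) (at_right 0)" for i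
      unfolding err_def by (intro tendsto_intros g h0)
    then have "((\<lambda>h. err h i) \<longlongrightarrow> 0) (at_right 0)" for i by simp
    then have "\<forall>\<^sub>F h in at_right 0. err h i < \<alpha>" for i
      using \<open>\<alpha> > 0\<close> by (rule order_tendstoD)
    then have "\<forall>\<^sub>F h in at_right 0. \<forall>i. err h i < \<alpha>"
      by (simp add: eventually_all_finite)
    moreover have "\<forall>\<^sub>F h in at_right (0::real). h > 0" by (simp add: eventually_at_right_less)
    ultimately show "\<forall>\<^sub>F h in at_right 0. \<forall>i v. (\<Sum>j\<in>UNIV. p h i j * ((v + h *\<^sub>R (A i *v v)) \<bullet> (P j *v (v + h *\<^sub>R (A i *v v)))))
          \<le> (1 - \<alpha> * h) * (v \<bullet> (P i *v v))"
    proof eventually_elim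
      case (elim h)
      show ?case
      proof (intro allI)
        fix i v
        have ph: "p h i j = d i j + h * g h i j" for j using elim by (simp add: g_def)
        let ?a = "A i *v v"
        have "transpose (P j) = P j" for j using P by (simp add: sym_pos_def_def)
        then have sym: "v \<bullet> (P j *v ?a) = (P j *v v) \<bullet> ?a" for j by (rule sym_inner_commute)
        have expand: "(v + h *\<^sub>R ?a) \<bullet> (P j *v (v + h *\<^sub>R ?a))
          = v \<bullet> (P j *v v) + 2 * h * ((P j *v v) \<bullet> ?a) + h\<^sup>2 * (?a \<bullet> (P j *v ?a))" for j
          by (simp add: matrix_vector_right_distrib matrix_vector_mult_scaleR inner_add_left
              inner_add_right sym inner_commute[of ?a "P j *v v"] power2_eq_square algebra_simps)
        \<comment> \<open>Grouped by order: the value before the step, the two parts of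
          \<open>Ly\<close> at first order in \<open>h\<close>, and the remainder measured by
          \<open>err\<close>.\<close>
        have "p h i j * ((v + h *\<^sub>R ?a) \<bullet> (P j *v (v + h *\<^sub>R ?a)))
            = d i j * (v \<bullet> (P j *v v)) + h * (d i j * 2 * ((P j *v v) \<bullet> ?a)) + h * (q i j * (v \<bullet> (P j *v v)))
            + h * ((g h i j - q i j) * (v \<bullet> (P j *v v)) + 2 * (h * g h i j) * ((P j *v v) \<bullet> ?a)
              + h * (d i j + h * g h i j) * (?a \<bullet> (P j *v ?a)))" for j
          unfolding ph expand by (simp add: algebra_simps power2_eq_square)
        moreover have "h * ((g h i j - q i j) * (v \<bullet> (P j *v v)) + 2 * (h * g h i j) * ((P j *v v) \<bullet> ?a)
              + h * (d i j + h * g h i j) * (?a \<bullet> (P j *v ?a)))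
           \<le> h * ((\<bar>g h i j - q i j\<bar> + 2 * \<bar>h * g h i j\<bar> + \<bar>h * (d i j + h * g h i j)\<bar>) * (K * (norm v)\<^sup>2))" for j
        proof -
          have m: "x * y \<le> \<bar>x\<bar> * z" if "\<bar>y\<bar> \<le> z" for x y z :: real
            using mult_left_mono[OF that, of "\<bar>x\<bar>"] by (simp add: abs_mult[symmetric])
          show ?thesis
            using add_mono[OF add_mono[OF m[OF b1[of v j], of "g h i j - q i j"] m[OF b2[of j v i], of "2 * (h * g h i j)"]]
              m[OF b3[of i v j], of "h * (d i j + h * g h i j)"]] elim(2)
            unfolding distrib_right abs_mult[of 2] abs_numeral by (intro mult_left_mono) simp_all
        qed
        ultimately have "(\<Sum>j\<in>UNIV. p h i j * ((v + h *\<^sub>R ?a) \<bullet> (P j *v (v + h *\<^sub>R ?a))))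
           \<le> (\<Sum>j\<in>UNIV. d i j * (v \<bullet> (P j *v v)) + h * (d i j * 2 * ((P j *v v) \<bullet> ?a)) + h * (q i j * (v \<bullet> (P j *v v)))
              + h * ((\<bar>g h i j - q i j\<bar> + 2 * \<bar>h * g h i j\<bar> + \<bar>h * (d i j + h * g h i j)\<bar>) * (K * (norm v)\<^sup>2)))"
          by (intro sum_mono) (metis add_left_mono)
        also have "\<dots> = v \<bullet> (P i *v v) + h * Ly i v + h * (err h i * (K * (norm v)\<^sup>2))"
        proof -
          have "(\<Sum>j\<in>UNIV. d i j * f j) = f i" for f :: "'i \<Rightarrow> real"
            by (simp add: d_def if_distrib[of "\<lambda>x. x * _"] cong: if_cong)
          then show ?thesis
            unfolding sum.distrib sum_distrib_left[symmetric] sum_distrib_right[symmetric] err_def Ly_def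
            by (simp add: mult.assoc sum.distrib distrib_left)
        qed
        also have "\<dots> \<le> v \<bullet> (P i *v v) - h * (\<alpha> * (v \<bullet> (P i *v v)))"
        proof -
          have "err h i * (K * (norm v)\<^sup>2) \<le> \<alpha> * (K * (norm v)\<^sup>2)"
            using elim K by (intro mult_right_mono) (auto intro: less_imp_le)
          moreover have "\<alpha> * (v \<bullet> (P i *v v)) \<le> \<alpha> * (K * (norm v)\<^sup>2)"
            using b1[of v i] \<open>\<alpha> > 0\<close> by (intro mult_left_mono) auto
          moreover have "2 * (\<alpha> * (K * (norm v)\<^sup>2)) = c * (norm v)\<^sup>2"
            using K by (simp add: \<alpha>_def)
          ultimately have "Ly i v + err h i * (K * (norm v)\<^sup>2) \<le> - (\<alpha> * (v \<bullet> (P i *v v)))"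
            using c(2)[of v i] by linarith
          then have "h * (Ly i v + err h i * (K * (norm v)\<^sup>2)) \<le> h * (- (\<alpha> * (v \<bullet> (P i *v v))))"
            using elim by (intro mult_left_mono) auto
          then show ?thesis by (simp add: algebra_simps)
        qed
        finally show "(\<Sum>j\<in>UNIV. p h i j * ((v + h *\<^sub>R ?a) \<bullet> (P j *v (v + h *\<^sub>R ?a))))
          \<le> (1 - \<alpha> * h) * (v \<bullet> (P i *v v))" by (simp add: algebra_simps)
      qed
    qed
  qed
qed

section \<open>Riemann sums along cadlag paths\<close>

text \<open>An accumulation point of jump times in the compact interval would contradict the
  one-sided limits: on either side of it lies an open interval on which the path is constant, and no
  point inside such an interval is a jump.\<close>

lemma cadlag_finite_jumps:
  fixes \<rho> :: "real \<Rightarrow> 'i"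
  assumes cadlag: "\<And>s. s \<ge> a \<Longrightarrow> (\<forall>\<^sub>F u in at_right s. \<rho> u = \<rho> s) \<and>
      (s > a \<longrightarrow> (\<exists>j. \<forall>\<^sub>F u in at_left s. \<rho> u = j))"
  shows "finite {s \<in> {a<..b}. \<not> (\<forall>\<^sub>F u in at s. \<rho> u = \<rho> s)}"
proof (rule ccontr)
  define J where "J = {s \<in> {a<..b}. \<not> (\<forall>\<^sub>F u in at s. \<rho> u = \<rho> s)}"
  have const: "u \<notin> J" if "x < u" "u < y" "\<And>v. x < v \<Longrightarrow> v < y \<Longrightarrow> \<rho> v = j" for x u y j
  proof -
    have "\<forall>\<^sub>F v in at u. v \<in> {x<..<y}"
      using that(1,2) by (intro eventually_at_in_open') auto
    then have "\<forall>\<^sub>F v in at u. \<rho> v = \<rho> u"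
      by eventually_elim (use that in auto)
    then show ?thesis by (simp add: J_def)
  qed
  assume "infinite {s \<in> {a<..b}. \<not> (\<forall>\<^sub>F u in at s. \<rho> u = \<rho> s)}"
  then have "infinite J" "J \<subseteq> {a..b}" by (auto simp: J_def)
  then obtain s where s: "s \<in> {a..b}" "s islimpt J"
    using compact_Icc[of a b] unfolding compact_eq_Bolzano_Weierstrass by blast
  have "\<forall>\<^sub>F u in at_right s. \<rho> u = \<rho> s" using cadlag[of s] s by auto
  then obtain y where y: "y > s" "\<And>v. s < v \<Longrightarrow> v < y \<Longrightarrow> \<rho> v = \<rho> s"
    by (auto simp: eventually_at_right_field)
  have "\<forall>\<^sub>F u in at_right s. u \<in> {s<..<y}"
    using y(1) by (intro eventually_at_right_real)
  then have right: "\<forall>\<^sub>F u in at_right s. u \<notin> J"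
    by eventually_elim (use const[of s _ y "\<rho> s"] y in auto)
  have left: "\<forall>\<^sub>F u in at_left s. u \<notin> J"
  proof (cases "s = a")
    \<comment> \<open>At s = a nothing is known to the left, but jump times are collected in
      \<open>{a<..b}\<close> only.\<close>
    case True
    have "\<forall>\<^sub>F u in at_left s. u \<in> {s-1<..<s}" by (intro eventually_at_left_real) auto
    then show ?thesis by eventually_elim (auto simp: J_def True)
  next
    case False
    then obtain j where "\<forall>\<^sub>F u in at_left s. \<rho> u = j" using cadlag[of s] s by auto
    then obtain x where x: "x < s" "\<And>v. x < v \<Longrightarrow> v < s \<Longrightarrow> \<rho> v = j"
      by (auto simp: eventually_at_left_field)
    have "\<forall>\<^sub>F u in at_left s. u \<in> {x<..<s}"
      using x(1) by (intro eventually_at_left_real)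
    then show ?thesis
      by eventually_elim (use const[of x _ s j] x in auto)
  qed
  have "\<forall>\<^sub>F u in at s. u \<notin> J"
    using left right by (simp add: eventually_at_split)
  then show False using s by (simp add: islimpt_iff_eventually)
qed

section \<open>Equidistant grids, left-point step functions and Riemann sums\<close>

definition grid :: "real \<Rightarrow> real \<Rightarrow> nat \<Rightarrow> real" where
  "grid a h k = a + real k * h"

text \<open>Interpolation by left end points, in the shape of \<open>elementary_value\<close>, so
  that the same facts serve the Riemann sums of the drift and the approximation of the Ito
  integrand. On a grid it vanishes outside the half-open range, in particular at the last grid
  point.\<close>

definition step_fun :: "(nat \<Rightarrow> real) \<Rightarrow> nat \<Rightarrow> (real \<Rightarrow> 'a::real_vector) \<Rightarrow> real \<Rightarrow> 'a" where
  "step_fun \<tau> k f s = (\<Sum>j<k. indicator {\<tau> j..<\<tau> (Suc j)} s *\<^sub>R f (\<tau> j))"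

lemma grid_0 [simp]: "grid a h 0 = a"
  by (simp add: grid_def)

lemma grid_Suc: "grid a h (Suc k) = grid a h k + h"
  by (simp add: grid_def algebra_simps)

lemma grid_last: "N > 0 \<Longrightarrow> grid a ((b - a) / real N) N = b"
  by (simp add: grid_def)

lemma grid_le_iff: "h > 0 \<Longrightarrow> grid a h i \<le> grid a h j \<longleftrightarrow> i \<le> j"
  by (simp add: grid_def)

lemma grid_less_iff: "h > 0 \<Longrightarrow> grid a h i < grid a h j \<longleftrightarrow> i < j"
  by (simp add: grid_def)

lemma step_fun_grid:
  assumes h: "h > 0" and i: "i < k" and s: "grid a h i \<le> s" "s < grid a h (Suc i)"
  shows "step_fun (grid a h) k f s = f (grid a h i)"
proof -
  have "s \<notin> {grid a h j..<grid a h (Suc j)}" if "j \<noteq> i" for j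
  proof
    assume "s \<in> {grid a h j..<grid a h (Suc j)}"
    then have "grid a h j < grid a h (Suc i)" "grid a h i < grid a h (Suc j)" using s by auto
    then show False using that h by (simp add: grid_less_iff)
  qed
  then have "step_fun (grid a h) k f s = (\<Sum>j<k. if j = i then f (grid a h i) else 0)"
    unfolding step_fun_def using s by (intro sum.cong) auto
  then show ?thesis using i by simp
qed

text \<open>The index is the floor of \<open>(s - a) / h\<close>; the essential point is that the
  sampled argument lies less than \<open>h\<close> to the left of \<open>s\<close>.\<close>

lemma step_fun_cell:
  assumes h: "h > 0" and s: "a \<le> s" "s < grid a h k"
  obtains i where "i < k" "s - h < grid a h i" "grid a h i \<le> s" "step_fun (grid a h) k f s = f (grid a h i)"
proof -
  define i where "i = nat \<lfloor>(s - a) / h\<rfloor>"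
  have "real i = of_int \<lfloor>(s - a) / h\<rfloor>" using h s by (simp add: i_def)
  then have "real i \<le> (s - a) / h" "(s - a) / h < real i + 1" by linarith+
  then have i: "grid a h i \<le> s" "s < grid a h (Suc i)"
    using h by (simp_all add: grid_def field_simps)
  then have "grid a h i < grid a h k" using s by simp
  then have "i < k" using h by (simp add: grid_less_iff)
  then show thesis
    using i h by (intro that[of i] step_fun_grid) (auto simp: grid_Suc)
qed

lemma step_fun_bound:
  assumes h: "h > 0" and s: "a \<le> s" "s \<le> grid a h k"
    and B: "\<And>u. a \<le> u \<Longrightarrow> u \<le> grid a h k \<Longrightarrow> norm (f u) \<le> B"
  shows "norm (step_fun (grid a h) k f s) \<le> B"
proof (cases "s = grid a h k")
  \<comment> \<open>Cells are half-open, so none of them contains the last grid point.\<close>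
  case True
  then have "step_fun (grid a h) k f s = 0"
    using h unfolding step_fun_def by (intro sum.neutral) (auto simp: grid_less_iff not_less)
  moreover have "0 \<le> B" using B[of s] s norm_ge_zero order_trans by blast
  ultimately show ?thesis by simp
next
  case False
  then obtain i where "i < k" "grid a h i \<le> s" "step_fun (grid a h) k f s = f (grid a h i)"
    using step_fun_cell[OF h s(1)] s(2) by (metis less_le)
  moreover have "a \<le> grid a h i" using h by (simp add: grid_def)
  ultimately show ?thesis using B s by auto
qed

text \<open>The sampled arguments lie within one step of \<open>s\<close>, hence converge to
  \<open>s\<close>. Continuity is asked at this point alone, so the lemma applies at every time
  between jumps.\<close>

lemma step_fun_tendsto:
  fixes f :: "real \<Rightarrow> 'a::real_normed_vector"
  assumes s: "a \<le> s" "s < b" and cont: "isCont f s"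
  shows "(\<lambda>N. step_fun (grid a ((b - a) / real N)) N f s) \<longlonglongrightarrow> f s"
proof -
  have "\<exists>u. s - (b - a) / real N < u \<and> u \<le> s \<and> step_fun (grid a ((b - a) / real N)) N f s = f u"
    if "N > 0" for N
  proof -
    have "(b - a) / real N > 0" using s that by simp
    moreover have "s < grid a ((b - a) / real N) N" using s that by (simp add: grid_last)
    ultimately show ?thesis using step_fun_cell[OF _ s(1)] by metis
  qed
  then obtain u where u: "\<And>N. N > 0 \<Longrightarrow> s - (b - a) / real N < u N \<and> u N \<le> s \<and>
      step_fun (grid a ((b - a) / real N)) N f s = f (u N)" by metis
  have "(\<lambda>N. (b - a) / real N) \<longlonglongrightarrow> 0" by (rule lim_const_over_n)
  then have l: "(\<lambda>N. s - (b - a) / real N) \<longlonglongrightarrow> s" using tendsto_diff[OF tendsto_const[of s]] by force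
  have ev: "\<forall>\<^sub>F N in sequentially. 0 < (N::nat)" by (rule eventually_gt_at_top)
  have "u \<longlonglongrightarrow> s"
  proof (rule tendsto_sandwich[OF _ _ l tendsto_const])
    show "\<forall>\<^sub>F N in sequentially. s - (b - a) / real N \<le> u N"
      using ev by eventually_elim (use u less_imp_le in blast)
    show "\<forall>\<^sub>F N in sequentially. u N \<le> s"
      using ev by eventually_elim (use u in blast)
  qed
  then have "(\<lambda>N. f (u N)) \<longlonglongrightarrow> f s" by (rule isCont_tendsto_compose[OF cont])
  moreover have "\<forall>\<^sub>F N in sequentially. f (u N) = step_fun (grid a ((b - a) / real N)) N f s"
    using ev by eventually_elim (use u in metis)
  ultimately show ?thesis by (rule Lim_transform_eventually)
qed

text \<open>The step function lives on all \<open>k\<close> cells while the integral stops at any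
  grid point \<open>j\<close>; the sums for all \<open>j\<close> are thus integrals of one and the
  same function.\<close>

lemma step_fun_has_integral:
  fixes f :: "real \<Rightarrow> 'a::euclidean_space"
  assumes h: "h > 0" and j: "j \<le> k"
  shows "(step_fun (grid a h) k f has_integral (\<Sum>i<j. h *\<^sub>R f (grid a h i))) {a..grid a h j}"
  using j
proof (induction j)
  case 0
  then show ?case by (simp add: has_integral_refl)
next
  case (Suc j)
  have "((\<lambda>s. f (grid a h j)) has_integral h *\<^sub>R f (grid a h j)) {grid a h j..grid a h (Suc j)}"
    using has_integral_const_real[of "f (grid a h j)" "grid a h j" "grid a h (Suc j)"] h by (simp add: grid_Suc)
  \<comment> \<open>The right end point of a cell belongs to the next cell, hence the exceptional
    point.\<close>
  then have "(step_fun (grid a h) k f has_integral h *\<^sub>R f (grid a h j)) {grid a h j..grid a h (Suc j)}"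
    by (rule has_integral_spike_finite[of "{grid a h (Suc j)}", rotated 2])
      (use Suc.prems h in \<open>auto intro!: step_fun_grid\<close>)
  moreover have "a \<le> grid a h j" "grid a h j \<le> grid a h (Suc j)"
    using h by (simp_all add: grid_def)
  ultimately show ?case
    using has_integral_combine[OF _ _ Suc.IH] Suc.prems by simp
qed

text \<open>A single null sequence bounds the errors up to all grid points at once: it is the L1
  distance on the whole interval between \<open>f\<close> and its step function, which dominates
  every partial error. It tends to 0 by dominated convergence, \<open>f\<close> being bounded and
  continuous off a finite set; dominated convergence also yields the integrability of
  \<open>f\<close>.\<close>

lemma riemann_sums_converge:
  fixes f :: "real \<Rightarrow> 'a::euclidean_space"
  assumes ab: "a < b" and E: "finite E" and cont: "\<And>s. s \<in> {a..b} - E \<Longrightarrow> isCont f s"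
    and B: "\<And>s. s \<in> {a..b} \<Longrightarrow> norm (f s) \<le> B"
  obtains \<rho> where "\<rho> \<longlonglongrightarrow> 0"
    "\<And>N j. j \<le> N \<Longrightarrow> N > 0 \<Longrightarrow>
       norm (integral {a..grid a ((b - a) / real N) j} f
         - (\<Sum>i<j. ((b - a) / real N) *\<^sub>R f (grid a ((b - a) / real N) i))) \<le> \<rho> N"
proof -
  \<comment> \<open>Indexing by \<open>Suc N\<close> keeps the step size positive; the shift is
    undone at the end.\<close>
  define g where "g N = step_fun (grid a ((b - a) / real (Suc N))) (Suc N) f" for N
  \<comment> \<open>On this set the step functions converge to \<open>f\<close>. Besides
    \<open>E\<close> the right end point is removed, where they are all 0.\<close>
  let ?S = "{a..b} - insert b E"
  have h: "(b - a) / real (Suc N) > 0" for N using ab by simp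
  have last: "grid a ((b - a) / real (Suc N)) (Suc N) = b" for N using grid_last[of "Suc N"] by simp
  have spike: "u integrable_on ?S \<longleftrightarrow> u integrable_on {a..b}" "integral ?S u = integral {a..b} u" for u :: "real \<Rightarrow> 'b::banach"
  proof -
    have fin: "finite {s \<in> ?S - {a..b}. u s \<noteq> 0}" "finite {s \<in> {a..b} - ?S. u s \<noteq> 0}"
      using E by (auto intro: finite_subset[of _ "insert b E"])
    have "finite ((?S - {a..b}) \<union> ({a..b} - ?S))"
      using E by (auto intro: finite_subset[of _ "insert b E"])
    then show "u integrable_on ?S \<longleftrightarrow> u integrable_on {a..b}"
      by (intro integrable_spike_set_eq negligible_finite)
    show "integral ?S u = integral {a..b} u"
      by (intro integral_spike_set negligible_finite fin)
  qed
  have gint: "g N integrable_on {a..b}" for N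
    using step_fun_has_integral[OF h[of N] order_refl[of "Suc N"], where a=a and f=f]
    unfolding last g_def by blast
  have gB: "norm (g N s) \<le> B" if "s \<in> {a..b}" for N s
    unfolding g_def using that B by (intro step_fun_bound h) (auto simp: last simp del: of_nat_Suc)
  have glim: "(\<lambda>N. g N s) \<longlonglongrightarrow> f s" if "s \<in> ?S" for s
    unfolding g_def using that cont
    by (intro LIMSEQ_Suc step_fun_tendsto) auto
  have "f integrable_on ?S"
  proof (rule dominated_convergence(1))
    show "g N integrable_on ?S" for N using gint by (simp only: spike)
    show "(\<lambda>_. B) integrable_on ?S" unfolding spike by (rule integrable_const_ivl)
    show "norm (g N s) \<le> B" if "s \<in> ?S" for N s using gB that by simp
    show "(\<lambda>N. g N s) \<longlonglongrightarrow> f s" if "s \<in> ?S" for s by (rule glim[OF that])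
  qed
  then have fint: "f integrable_on {a..b}" by (simp only: spike)
  have diffB: "norm (f s - g N s) \<le> 2 * B" if "s \<in> {a..b}" for N s
    using norm_triangle_ineq4[of "f s" "g N s"] B[OF that] gB[OF that, of N] by linarith
  have "(\<lambda>s. f s - g N s) absolutely_integrable_on {a..b}" for N
    using diffB by (intro absolutely_integrable_integrable_bound[of _ _ "\<lambda>_. 2 * B"]
        integrable_diff fint gint integrable_const_ivl)
  then have nint: "(\<lambda>s. norm (f s - g N s)) integrable_on {a..b}" for N
    by (simp add: absolutely_integrable_on_def)
  define \<rho> where "\<rho> N = integral {a..b} (\<lambda>s. norm (f s - g N s))" for N
  have "(\<lambda>N. integral ?S (\<lambda>s. norm (f s - g N s))) \<longlonglongrightarrow> integral ?S (\<lambda>s. 0)"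
  proof (rule dominated_convergence)
    show "(\<lambda>_. 2 * B) integrable_on ?S" unfolding spike by (rule integrable_const_ivl)
    show "(\<lambda>s. norm (f s - g N s)) integrable_on ?S" for N unfolding spike by (rule nint)
    show "norm (norm (f s - g N s)) \<le> 2 * B" if "s \<in> ?S" for N s using diffB that by simp
    show "(\<lambda>N. norm (f s - g N s)) \<longlonglongrightarrow> 0" if "s \<in> ?S" for s
      using tendsto_norm[OF tendsto_diff[OF tendsto_const glim[OF that], of "f s"]] by simp
  qed
  then have "\<rho> \<longlonglongrightarrow> 0" unfolding spike \<rho>_def by simp
  then have "(\<lambda>N. \<rho> (N - 1)) \<longlonglongrightarrow> 0"
    by (subst filterlim_sequentially_Suc[symmetric]) simp
  moreover have "norm (integral {a..grid a ((b - a) / real N) j} f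
         - (\<Sum>i<j. ((b - a) / real N) *\<^sub>R f (grid a ((b - a) / real N) i))) \<le> \<rho> (N - 1)"
    if "j \<le> N" "N > 0" for N j
  proof -
    let ?h = "(b - a) / real N"
    have N: "Suc (N - 1) = N" using that by simp
    have h: "?h > 0" using ab that by simp
    have "grid a ?h j \<le> grid a ?h N" using h that by (simp add: grid_le_iff)
    then have sub: "{a..grid a ?h j} \<subseteq> {a..b}" using that by (auto simp: grid_last)
    have "(g (N - 1) has_integral (\<Sum>i<j. ?h *\<^sub>R f (grid a ?h i))) {a..grid a ?h j}"
      unfolding g_def N using that by (intro step_fun_has_integral h)
    then have "integral {a..grid a ?h j} f - (\<Sum>i<j. ?h *\<^sub>R f (grid a ?h i))
       = integral {a..grid a ?h j} (\<lambda>s. f s - g (N - 1) s)"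
      using integrable_on_subinterval[OF fint sub] by (subst integral_diff) (auto simp: integral_unique)
    also have "norm \<dots> \<le> integral {a..grid a ?h j} (\<lambda>s. norm (f s - g (N - 1) s))"
      using sub by (intro integral_norm_bound_integral integrable_diff integrable_on_subinterval[OF nint]
          integrable_on_subinterval[OF fint] integrable_on_subinterval[OF gint]) auto
    also have "\<dots> \<le> \<rho> (N - 1)"
      unfolding \<rho>_def using sub by (intro integral_subset_le integrable_on_subinterval[OF nint] nint) auto
    finally show ?thesis .
  qed
  ultimately show thesis by (rule that)
qed

text \<open>Induction on the summed inequality, followed by
  \<open>(1 + c) ^ N \<le> exp (c * real N)\<close>. The bound retains the sum of the
  \<open>b i\<close> instead of their maximum: the noise errors are controlled in mean square at
  each grid time separately, and with \<open>c\<close> proportional to the step the sum becomes a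
  time average.\<close>

lemma discrete_gronwall:
  fixes e b :: "nat \<Rightarrow> real"
  assumes e: "\<And>j. j \<le> N \<Longrightarrow> e j \<le> b j + c * (\<Sum>i<j. e i)" and b: "\<And>j. b j \<ge> 0" and c: "c \<ge> 0"
  shows "e N \<le> b N + c * exp (c * real N) * (\<Sum>i<N. b i)"
proof -
  have "(\<Sum>i<j. e i) \<le> (1 + c) ^ j * (\<Sum>i<j. b i)" if "j \<le> N" for j
    using that
  proof (induction j)
    case (Suc j)
    have "(\<Sum>i<Suc j. e i) \<le> (1 + c) * (\<Sum>i<j. e i) + b j"
      using e[of j] Suc.prems by (simp add: algebra_simps)
    also have "\<dots> \<le> (1 + c) * ((1 + c) ^ j * (\<Sum>i<j. b i)) + (1 + c) ^ Suc j * b j"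
    proof (rule add_mono)
      show "(1 + c) * (\<Sum>i<j. e i) \<le> (1 + c) * ((1 + c) ^ j * (\<Sum>i<j. b i))"
        using Suc c by (intro mult_left_mono) auto
      have "1 \<le> (1 + c) ^ Suc j" using c by (intro one_le_power) auto
      then show "b j \<le> (1 + c) ^ Suc j * b j" using mult_right_mono[OF _ b[of j]] by fastforce
    qed
    finally show ?case by (simp add: algebra_simps)
  qed simp
  then have "(\<Sum>i<N. e i) \<le> (1 + c) ^ N * (\<Sum>i<N. b i)" by simp
  also have "\<dots> \<le> exp (c * real N) * (\<Sum>i<N. b i)"
  proof (rule mult_right_mono)
    have "(1 + c) ^ N \<le> exp c ^ N" using c by (intro power_mono exp_ge_add_one_self) auto
    then show "(1 + c) ^ N \<le> exp (c * real N)" using exp_of_nat_mult[of N c] by (simp add: mult.commute)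
  qed (simp add: sum_nonneg b)
  finally have "c * (\<Sum>i<N. e i) \<le> c * (exp (c * real N) * (\<Sum>i<N. b i))"
    by (rule mult_left_mono[OF _ c])
  then show ?thesis using e[of N] by (simp add: mult_ac)
qed

lemma step_fun_eq_0:
  assumes "h \<ge> 0" "s \<notin> {a..<grid a h k}"
  shows "step_fun (grid a h) k f s = 0"
proof -
  have "s \<notin> {grid a h j..<grid a h (Suc j)}" if "j < k" for j
  proof -
    have "a \<le> grid a h j" "grid a h (Suc j) \<le> grid a h k"
      using assms(1) that by (auto simp: grid_def intro: mult_right_mono)
    then show ?thesis using assms(2) by auto
  qed
  then show ?thesis unfolding step_fun_def by (intro sum.neutral) auto
qed

section \<open>Wiener increments and the Ito isometry\<close>

text \<open>Independence is carried by two sigma-algebras, given as measures on the same space: the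
  past and one increment of \<open>w\<close> in the martingale arguments, the chain and the whole of
  \<open>w\<close> in the Markov argument.\<close>

lemma (in prob_space) has_bochner_integral_indep_mult:
  fixes X Y :: "'a \<Rightarrow> real"
  assumes indep: "indep_set (sets M1) (sets M2)"
    and sp: "space M1 = space M" "space M2 = space M"
    and X: "X \<in> borel_measurable M1" "integrable M X"
    and Y: "Y \<in> borel_measurable M2" "has_bochner_integral M Y y"
  shows "has_bochner_integral M (\<lambda>\<omega>. X \<omega> * Y \<omega>) (expectation X * y)"
proof -
  have sub: "sigma_sets (space M) {Z -` A \<inter> space M | A. A \<in> sets borel} \<subseteq> sets N"
    if "Z \<in> borel_measurable N" "space N = space M" for Z :: "'a \<Rightarrow> real" and N
    using sets.sigma_sets_subset[of "{Z -` A \<inter> space M | A. A \<in> sets borel}" N]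
      measurable_sets[OF that(1)] that(2) by auto
  have Yi: "integrable M Y" "expectation Y = y"
    using Y(2) by (auto simp: has_bochner_integral_iff)
  have "indep_set (sigma_sets (space M) {X -` A \<inter> space M | A. A \<in> sets borel})
      (sigma_sets (space M) {Y -` A \<inter> space M | A. A \<in> sets borel})"
    unfolding indep_set_def
    by (rule indep_sets_mono_sets[OF indep[unfolded indep_set_def]])
      (use sub[OF X(1) sp(1)] sub[OF Y(1) sp(2)] in \<open>simp split: bool.split\<close>)
  then have "indep_var borel X borel Y"
    using X(2) Yi(1) by (simp add: indep_var_eq)
  then show ?thesis
    using indep_var_lebesgue_integral[of X Y, OF _ X(2) Yi(1)] indep_var_integrable[of X Y, OF _ X(2) Yi(1)] Yi(2)
    by (simp add: has_bochner_integral_iff)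
qed

section \<open>Moments and orthogonality of Wiener increments\<close>

locale wiener_filtration =
  fixes P :: "'w measure" and F :: "real \<Rightarrow> 'w measure" and w :: "real \<Rightarrow> 'w \<Rightarrow> real^'p"
  assumes filtered: "filtered_prob_space P F" and wiener: "wiener_process P F w"
begin

sublocale prob_space P
  using filtered by (simp add: filtered_prob_space_def)

lemma space_filtration: "space (F t) = space P"
  using filtered by (simp add: filtered_prob_space_def subalgebra_def)

lemma measurable_filtration: "f \<in> measurable (F t) N \<Longrightarrow> f \<in> measurable P N"
  using filtered measurable_from_subalg unfolding filtered_prob_space_def by blast

lemma measurable_filtration_mono:
  assumes "f \<in> measurable (F s) N" "s \<le> t"
  shows "f \<in> measurable (F t) N"
proof -
  have "subalgebra (F t) (F s)"
    using assms(2) filtered filtration.sets_F_mono[of "space P" F s t]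
    by (auto simp: subalgebra_def filtered_prob_space_def)
  then show ?thesis using assms(1) by (rule measurable_from_subalg)
qed

lemma wiener_measurable: "0 \<le> s \<Longrightarrow> s \<le> t \<Longrightarrow> w s \<in> borel_measurable (F t)"
  using wiener by (auto simp: wiener_process_def intro: measurable_filtration_mono)

lemma wiener_measurable_P: "0 \<le> s \<Longrightarrow> w s \<in> borel_measurable P"
  using wiener_measurable measurable_filtration by blast

lemma increment_moments:
  assumes s: "0 \<le> s" "s \<le> t"
  shows "has_bochner_integral P (\<lambda>\<omega>. (w t \<omega> - w s \<omega>) $ k) 0"
    and "has_bochner_integral P (\<lambda>\<omega>. (w t \<omega> - w s \<omega>) $ k * (w t \<omega> - w s \<omega>) $ l) (if k = l then t - s else 0)"
proof -
  let ?X = "\<lambda>k \<omega>. (w t \<omega> - w s \<omega>) $ k"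
  have *: "has_bochner_integral P (?X k) 0 \<and>
      has_bochner_integral P (\<lambda>\<omega>. ?X k \<omega> * ?X l \<omega>) (if k = l then t - s else 0)"
  \<comment> \<open>The law of an increment is prescribed for s < t only, since the normal density
    degenerates at variance 0.\<close>
  proof (cases "s = t")
    case True
    then show ?thesis by (simp add: has_bochner_integral_zero)
  next
    case False
    then have "s < t" using s by simp
    then have st: "s < t" "0 < sqrt (t - s)" by simp_all
    from st(1) have D: "distributed P lborel (?X k) (normal_density 0 (sqrt (t - s)))" for k
      using wiener s by (auto simp: wiener_process_def)
    have ind: "indep_vars (\<lambda>_. borel) ?X UNIV"
      using wiener s(1) st(1) by (auto simp: wiener_process_def)
    have "integrable lborel (\<lambda>x. normal_density 0 (sqrt (t - s)) x * (x - 0) ^ 1)"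
      by (rule integrable_normal_moment[OF st(2)])
    then have i1: "integrable P (?X k)" for k
      using distributed_integrable[OF D[of k], of "\<lambda>x. x"] by simp
    have e1: "expectation (?X k) = 0" for k
      by (rule normal_distributed_expectation[OF st(2) D])
    have "integrable lborel (\<lambda>x. normal_density 0 (sqrt (t - s)) x * (x - 0) ^ 2)"
      by (rule integrable_normal_moment[OF st(2)])
    then have i2: "integrable P (\<lambda>\<omega>. (?X k \<omega>)\<^sup>2)" for k
      using distributed_integrable[OF D[of k], of "\<lambda>x. x\<^sup>2"] by simp
    have e2: "expectation (\<lambda>\<omega>. (?X k \<omega>)\<^sup>2) = t - s" for k
      using normal_distributed_variance[OF st(2) D[of k]] st unfolding e1 by simp
    have "has_bochner_integral P (\<lambda>\<omega>. ?X k \<omega> * ?X l \<omega>) 0" if "k \<noteq> l"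
    proof -
      have "indep_vars (\<lambda>_. borel) ?X {k, l}"
        using ind by (rule indep_vars_subset) simp
      from indep_vars_lebesgue_integral[OF _ this] indep_vars_integrable[OF _ this] show ?thesis
        using that i1 e1 by (auto simp: has_bochner_integral_iff)
    qed
    then show ?thesis
      using i1 e1 i2 e2 by (auto simp: has_bochner_integral_iff power2_eq_square)
  qed
  then show "has_bochner_integral P (?X k) 0"
    and "has_bochner_integral P (\<lambda>\<omega>. ?X k \<omega> * ?X l \<omega>) (if k = l then t - s else 0)"
    by auto
qed

text \<open>The increment after time \<open>c\<close> is independent of \<open>F c\<close>, so the
  expectation factorises. Taking a coordinate, or a product of two coordinates, for \<open>f\<close>
  gives the martingale property and the quadratic variation.\<close>

lemma has_bochner_integral_mult_increment:
  fixes f :: "real^'p \<Rightarrow> real"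
  assumes c: "0 \<le> c" "c < d"
    and X: "X \<in> borel_measurable (F c)" "integrable P X"
    and f: "f \<in> borel_measurable borel" "has_bochner_integral P (\<lambda>\<omega>. f (w d \<omega> - w c \<omega>)) y"
  shows "has_bochner_integral P (\<lambda>\<omega>. X \<omega> * f (w d \<omega> - w c \<omega>)) (expectation X * y)"
proof (rule has_bochner_integral_indep_mult)
  let ?V = "vimage_algebra (space P) (\<lambda>\<omega>. w d \<omega> - w c \<omega>) borel"
  have "indep_set (sets (F c)) {(\<lambda>\<omega>. w d \<omega> - w c \<omega>) -` E \<inter> space P | E. E \<in> sets borel}"
    using wiener c by (auto simp: wiener_process_def)
  then show "indep_set (sets (F c)) (sets ?V)"
    by (simp add: sets_vimage_algebra2)
  have "(\<lambda>\<omega>. w d \<omega> - w c \<omega>) \<in> measurable ?V borel"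
    by (rule measurable_vimage_algebra1) simp
  then show "(\<lambda>\<omega>. f (w d \<omega> - w c \<omega>)) \<in> borel_measurable ?V"
    using f(1) by (rule measurable_compose)
qed (use assms space_filtration in auto)

lemma martingale_increment:
  assumes c: "0 \<le> c" "c \<le> d" and X: "X \<in> borel_measurable (F c)" "integrable P X"
  shows "has_bochner_integral P (\<lambda>\<omega>. X \<omega> * (w d \<omega> - w c \<omega>) $ k) 0"
proof (cases "c = d")
  case False
  then show ?thesis
    using has_bochner_integral_mult_increment[OF c(1) _ X, of d "\<lambda>v. v $ k" 0]
      increment_moments(1)[OF c] c by simp
qed (simp add: has_bochner_integral_zero)

lemma quadratic_increment:
  assumes c: "0 \<le> c" "c \<le> d" and X: "X \<in> borel_measurable (F c)" "integrable P X"
  shows "has_bochner_integral P (\<lambda>\<omega>. X \<omega> * ((w d \<omega> - w c \<omega>) $ k * (w d \<omega> - w c \<omega>) $ l))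
     (if k = l then (d - c) * expectation X else 0)"
proof (cases "c = d")
  case False
  then have "c < d" using c by simp
  then have "has_bochner_integral P (\<lambda>\<omega>. X \<omega> * ((w d \<omega> - w c \<omega>) $ k * (w d \<omega> - w c \<omega>) $ l))
      (expectation X * (if k = l then d - c else 0))"
    by (rule has_bochner_integral_mult_increment[OF c(1) _ X, where f = "\<lambda>v. v $ k * v $ l"])
      (use increment_moments(2)[OF c, of k l] in simp_all)
  moreover have "expectation X * (if k = l then d - c else 0) = (if k = l then (d - c) * expectation X else 0)"
    by simp
  ultimately show ?thesis by simp
qed (simp add: has_bochner_integral_zero)

text \<open>The Ito isometry in polarised form for one pair of cells. The weight is the length of
  the overlap of the two time intervals, so elementary processes on unrelated partitions can be
  compared without a common refinement. For \<open>a \<le> c\<close> the first increment is split at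
  \<open>c\<close> and at the end of the overlap; products of increments over disjoint intervals
  have mean 0, and only the product over the overlap itself survives.\<close>

lemma increments_orthogonal:
  fixes U V :: "'w \<Rightarrow> real"
  assumes ab: "0 \<le> a" "a \<le> b" and cd: "0 \<le> c" "c \<le> d"
    and U: "U \<in> borel_measurable (F a)" "\<And>\<omega>. \<omega> \<in> space P \<Longrightarrow> \<bar>U \<omega>\<bar> \<le> B"
    and V: "V \<in> borel_measurable (F c)" "\<And>\<omega>. \<omega> \<in> space P \<Longrightarrow> \<bar>V \<omega>\<bar> \<le> B"
  shows "has_bochner_integral P (\<lambda>\<omega>. U \<omega> * (w b \<omega> - w a \<omega>) $ k * (V \<omega> * (w d \<omega> - w c \<omega>) $ l))
     (if k = l then max 0 (min b d - max a c) * expectation (\<lambda>\<omega>. U \<omega> * V \<omega>) else 0)"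
proof -
  have ordered: "has_bochner_integral P (\<lambda>\<omega>. U \<omega> * V \<omega> * (w b \<omega> - w a \<omega>) $ k * (w d \<omega> - w c \<omega>) $ l)
     (if k = l then max 0 (min b d - c) * expectation (\<lambda>\<omega>. U \<omega> * V \<omega>) else 0)"
    if h: "0 \<le> a" "a \<le> b" "0 \<le> c" "c \<le> d" "a \<le> c" "U \<in> borel_measurable (F a)" "V \<in> borel_measurable (F c)"
      "\<And>\<omega>. \<omega> \<in> space P \<Longrightarrow> \<bar>U \<omega>\<bar> \<le> B" "\<And>\<omega>. \<omega> \<in> space P \<Longrightarrow> \<bar>V \<omega>\<bar> \<le> B"
    for a b c d :: real and U V :: "'w \<Rightarrow> real" and k l
  proof -
    have UV: "(\<lambda>\<omega>. U \<omega> * V \<omega>) \<in> borel_measurable (F s)" if "c \<le> s" for s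
      using that h(5) by (intro borel_measurable_times measurable_filtration_mono[OF h(6)]
          measurable_filtration_mono[OF h(7)]) auto
    have UVB: "\<bar>U \<omega> * V \<omega>\<bar> \<le> B * B" if "\<omega> \<in> space P" for \<omega>
      unfolding abs_mult using h(8,9)[OF that] by (intro mult_mono) auto
    have "integrable P (\<lambda>\<omega>. U \<omega> * V \<omega>)"
      by (rule integrable_const_bound[of _ "B * B"])
        (use UVB UV[OF order_refl] measurable_filtration in auto)
    note UVi = UV[OF order_refl] this
    have inc_meas: "(\<lambda>\<omega>. (w t \<omega> - w s \<omega>) $ k) \<in> borel_measurable (F r)"
      if "0 \<le> s" "0 \<le> t" "s \<le> r" "t \<le> r" for s t r k
      using wiener_measurable that by (intro measurable_compose[OF _ borel_measurable_nth] borel_measurable_diff) auto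
    have int1: "integrable P (\<lambda>\<omega>. U \<omega> * V \<omega> * (w t \<omega> - w s \<omega>) $ k)" if "0 \<le> s" "s \<le> t" for s t k
    proof (rule Bochner_Integration.integrable_bound)
      show "integrable P (\<lambda>\<omega>. B * B * (w t \<omega> - w s \<omega>) $ k)"
        using increment_moments(1)[OF that] by (simp add: has_bochner_integral_iff)
      show "(\<lambda>\<omega>. U \<omega> * V \<omega> * (w t \<omega> - w s \<omega>) $ k) \<in> borel_measurable P"
        using UV[OF order_refl] inc_meas[of s t t k] that
        by (intro borel_measurable_times[of "\<lambda>\<omega>. U \<omega> * V \<omega>"]) (auto intro: measurable_filtration)
      show "AE \<omega> in P. norm (U \<omega> * V \<omega> * (w t \<omega> - w s \<omega>) $ k) \<le> norm (B * B * (w t \<omega> - w s \<omega>) $ k)"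
      proof (rule AE_I2)
        fix \<omega> assume "\<omega> \<in> space P"
        then show "norm (U \<omega> * V \<omega> * (w t \<omega> - w s \<omega>) $ k) \<le> norm (B * B * (w t \<omega> - w s \<omega>) $ k)"
          unfolding norm_mult[of "U \<omega> * V \<omega>"] norm_mult[of "B * B"]
          using UVB[of \<omega>] by (intro mult_right_mono) auto
      qed
    qed
    \<comment> \<open>The factor \<open>U * V\<close> and the earlier increment are known at time
      \<open>u\<close>, so the martingale property of the later increment applies.\<close>
    have cross: "has_bochner_integral P (\<lambda>\<omega>. U \<omega> * V \<omega> * (w t \<omega> - w s \<omega>) $ k * (w v \<omega> - w u \<omega>) $ l) 0"
      if "0 \<le> s" "s \<le> t" "t \<le> u" "u \<le> v" "c \<le> u" for s t u v k l
      using that by (intro martingale_increment int1 borel_measurable_times[of "\<lambda>\<omega>. U \<omega> * V \<omega>"] UV inc_meas) auto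
    show ?thesis
    proof (cases "b \<le> c")
      case True
      then show ?thesis using cross[of a b c d k l] h by (auto simp: max_def min_def)
    next
      case False
      \<comment> \<open>The end of the overlap. The facts \<open>1\<close> to \<open>4\<close> are
        the products that arise when the first increment is split at \<open>c\<close> and
        \<open>m\<close> and, for its middle part, the second increment is split at
        \<open>m\<close>.\<close>
      define m where "m = min b d"
      have m: "c \<le> m" "m \<le> b" "m \<le> d" using False h by (auto simp: m_def)
      have 1: "has_bochner_integral P (\<lambda>\<omega>. U \<omega> * V \<omega> * (w c \<omega> - w a \<omega>) $ k * (w d \<omega> - w c \<omega>) $ l) 0"
        using h by (intro cross) auto
      have 2: "has_bochner_integral P (\<lambda>\<omega>. U \<omega> * V \<omega> * ((w m \<omega> - w c \<omega>) $ k * (w m \<omega> - w c \<omega>) $ l))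
         (if k = l then (m - c) * expectation (\<lambda>\<omega>. U \<omega> * V \<omega>) else 0)"
        using h m by (intro quadratic_increment UVi) auto
      have 3: "has_bochner_integral P (\<lambda>\<omega>. U \<omega> * V \<omega> * (w b \<omega> - w m \<omega>) $ k * (w d \<omega> - w c \<omega>) $ l) 0"
      proof (cases "b \<le> d")
        case True
        then show ?thesis by (simp add: m_def has_bochner_integral_zero)
      next
        case False
        then have "has_bochner_integral P (\<lambda>\<omega>. U \<omega> * V \<omega> * (w d \<omega> - w c \<omega>) $ l * (w b \<omega> - w d \<omega>) $ k) 0"
          using h by (intro cross) auto
        then show ?thesis using False by (simp add: m_def mult_ac)
      qed
      have 4: "has_bochner_integral P (\<lambda>\<omega>. U \<omega> * V \<omega> * (w m \<omega> - w c \<omega>) $ k * (w d \<omega> - w m \<omega>) $ l) 0"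
        using h m by (intro cross) auto
      have "has_bochner_integral P
          (\<lambda>\<omega>. U \<omega> * V \<omega> * (w c \<omega> - w a \<omega>) $ k * (w d \<omega> - w c \<omega>) $ l
             + U \<omega> * V \<omega> * ((w m \<omega> - w c \<omega>) $ k * (w m \<omega> - w c \<omega>) $ l)
             + U \<omega> * V \<omega> * (w b \<omega> - w m \<omega>) $ k * (w d \<omega> - w c \<omega>) $ l
             + U \<omega> * V \<omega> * (w m \<omega> - w c \<omega>) $ k * (w d \<omega> - w m \<omega>) $ l)
          (0 + (if k = l then (m - c) * expectation (\<lambda>\<omega>. U \<omega> * V \<omega>) else 0) + 0 + 0)"
        by (intro has_bochner_integral_add 1 2 3 4)
      also have "(\<lambda>\<omega>. U \<omega> * V \<omega> * (w c \<omega> - w a \<omega>) $ k * (w d \<omega> - w c \<omega>) $ l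
             + U \<omega> * V \<omega> * ((w m \<omega> - w c \<omega>) $ k * (w m \<omega> - w c \<omega>) $ l)
             + U \<omega> * V \<omega> * (w b \<omega> - w m \<omega>) $ k * (w d \<omega> - w c \<omega>) $ l
             + U \<omega> * V \<omega> * (w m \<omega> - w c \<omega>) $ k * (w d \<omega> - w m \<omega>) $ l)
          = (\<lambda>\<omega>. U \<omega> * V \<omega> * (w b \<omega> - w a \<omega>) $ k * (w d \<omega> - w c \<omega>) $ l)"
        by (rule ext) (simp add: algebra_simps)
      finally have "has_bochner_integral P (\<lambda>\<omega>. U \<omega> * V \<omega> * (w b \<omega> - w a \<omega>) $ k * (w d \<omega> - w c \<omega>) $ l)
          (if k = l then (m - c) * expectation (\<lambda>\<omega>. U \<omega> * V \<omega>) else 0)"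
        by (simp only: add_0_left add_0_right)
      moreover have "max 0 (min b d - c) = m - c" using m(1) by (simp add: m_def)
      ultimately show ?thesis by (simp only:)
    qed
  qed
  show ?thesis
  proof (cases "a \<le> c")
    case True
    then have "max a c = c" by simp
    then show ?thesis
      using ordered[OF ab cd True U(1) V(1) U(2) V(2), of k l] by (simp only: mult_ac)
  next
    \<comment> \<open>The formula is symmetric, so the two cells exchange roles.\<close>
    case False
    then have "c \<le> a" by simp
    from ordered[OF cd ab this V(1) U(1) V(2) U(2), of l k] this show ?thesis
      by (simp only: mult_ac max_absorb1 min.commute eq_commute[of l k])
  qed
qed

end

section \<open>The isometry for elementary processes and its passage to Ito integrals\<close>

lemma norm_add_sq_le:
  fixes x y :: "'a::real_inner"
  shows "(norm (x + y))\<^sup>2 \<le> 2 * (norm x)\<^sup>2 + 2 * (norm y)\<^sup>2"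
proof -
  have "(norm (x + y))\<^sup>2 + (norm (x - y))\<^sup>2 = 2 * (norm x)\<^sup>2 + 2 * (norm y)\<^sup>2"
    by (simp add: power2_norm_eq_inner inner_add_left inner_add_right inner_diff_left inner_diff_right)
  then show ?thesis using zero_le_power2[of "norm (x - y)"] by linarith
qed

lemma nn_integral_sq_triangle:
  fixes f g h :: "'a \<Rightarrow> 'b::euclidean_space"
  assumes [measurable]: "f \<in> borel_measurable M" "g \<in> borel_measurable M" "h \<in> borel_measurable M"
  shows "(\<integral>\<^sup>+x. ennreal ((norm (f x - h x))\<^sup>2) \<partial>M)
    \<le> 2 * (\<integral>\<^sup>+x. ennreal ((norm (f x - g x))\<^sup>2) \<partial>M) + 2 * (\<integral>\<^sup>+x. ennreal ((norm (g x - h x))\<^sup>2) \<partial>M)"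
proof -
  have "ennreal ((norm (f x - h x))\<^sup>2) \<le> 2 * ennreal ((norm (f x - g x))\<^sup>2) + 2 * ennreal ((norm (g x - h x))\<^sup>2)" for x
    using norm_add_sq_le[of "f x - g x" "g x - h x"]
    by (simp add: ennreal_mult[symmetric] ennreal_plus[symmetric] flip: ennreal_numeral del: ennreal_plus)
  then have "(\<integral>\<^sup>+x. ennreal ((norm (f x - h x))\<^sup>2) \<partial>M)
    \<le> (\<integral>\<^sup>+x. 2 * ennreal ((norm (f x - g x))\<^sup>2) + 2 * ennreal ((norm (g x - h x))\<^sup>2) \<partial>M)"
    by (intro nn_integral_mono) auto
  also have "\<dots> = 2 * (\<integral>\<^sup>+x. ennreal ((norm (f x - g x))\<^sup>2) \<partial>M) + 2 * (\<integral>\<^sup>+x. ennreal ((norm (g x - h x))\<^sup>2) \<partial>M)"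
    by (simp add: nn_integral_add nn_integral_cmult)
  finally show ?thesis .
qed

lemma borel_measurable_matrix_vector_mult:
  fixes f :: "'a \<Rightarrow> real^'p^'n"
  assumes "f \<in> borel_measurable M" "g \<in> borel_measurable M"
  shows "(\<lambda>x. f x *v g x) \<in> borel_measurable M"
  using assms
proof (rule borel_measurable_continuous_Pair)
  show "continuous_on UNIV (\<lambda>x. (fst x :: real^'p^'n) *v snd x)"
    unfolding matrix_vector_mult_def by (intro continuous_intros)
qed

lemma inner_matrix_vector_expand:
  fixes M N :: "real^'p^'n"
  shows "(M *v u) \<bullet> (N *v v) = (\<Sum>i\<in>UNIV. \<Sum>k\<in>UNIV. \<Sum>l\<in>UNIV. M $ i $ k * u $ k * (N $ i $ l * v $ l))"
  by (simp add: inner_vec_def matrix_vector_mult_def sum_product)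

text \<open>The value is the weight that occurs in \<open>increments_orthogonal\<close>; this
  agreement, cell by cell, is the isometry.\<close>

lemma has_bochner_integral_overlap:
  assumes "a \<le> b" "c \<le> (d::real)"
  shows "has_bochner_integral lborel (\<lambda>s. indicator {a..<b} s * indicator {c..<d} s :: real) (max 0 (min b d - max a c))"
proof -
  have "has_bochner_integral lborel (indicator {max a c..<min b d} :: real \<Rightarrow> real) (measure lborel {max a c..<min b d})"
    by (intro has_bochner_integral_real_indicator)
      (auto intro: order.strict_trans1[OF emeasure_mono[of _ "{max a c..min b d}"]] simp: emeasure_lborel_Icc_eq)
  moreover have "measure lborel {max a c..<min b d} = max 0 (min b d - max a c)"
  proof (cases "max a c \<le> min b d")
    case True
    then have "measure lborel {max a c..<min b d} = min b d - max a c" by (rule measure_lborel_Ico)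
    then show ?thesis using True by linarith
  next
    case False
    then have "{max a c..<min b d} = {}" by auto
    then have "measure lborel {max a c..<min b d} = 0" by (simp only: measure_empty)
    then show ?thesis using False by linarith
  qed
  moreover have "(indicator {max a c..<min b d} :: real \<Rightarrow> real) = (\<lambda>s. indicator {a..<b} s * indicator {c..<d} s)"
    by (rule ext) (auto simp: indicator_def)
  ultimately show ?thesis by (simp only:)
qed

context wiener_filtration
begin

text \<open>\<open>increments_orthogonal\<close> is applied to the entries: distinct coordinates of
  the noise are uncorrelated, so only the terms k = l remain, and they add up to the Frobenius inner
  product of the coefficients.\<close>

lemma increments_inner:
  fixes \<xi> \<eta> :: "'w \<Rightarrow> real^'p^'n"
  assumes ab: "0 \<le> a" "a \<le> b" and cd: "0 \<le> c" "c \<le> d"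
    and \<xi>: "\<xi> \<in> borel_measurable (F a)" "\<And>\<omega>. \<omega> \<in> space P \<Longrightarrow> norm (\<xi> \<omega>) \<le> B"
    and \<eta>: "\<eta> \<in> borel_measurable (F c)" "\<And>\<omega>. \<omega> \<in> space P \<Longrightarrow> norm (\<eta> \<omega>) \<le> B"
  shows "integrable P (\<lambda>\<omega>. \<xi> \<omega> \<bullet> \<eta> \<omega>)"
    and "has_bochner_integral P (\<lambda>\<omega>. (\<xi> \<omega> *v (w b \<omega> - w a \<omega>)) \<bullet> (\<eta> \<omega> *v (w d \<omega> - w c \<omega>)))
     (max 0 (min b d - max a c) * expectation (\<lambda>\<omega>. \<xi> \<omega> \<bullet> \<eta> \<omega>))"
proof -
  let ?ov = "max 0 (min b d - max a c)"
  have entry: "(\<lambda>M :: real^'p^'n. M $ i $ k) \<in> borel_measurable borel" for i k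
    by (intro borel_measurable_continuous_onI continuous_intros)
  have meas: "(\<lambda>\<omega>. \<xi> \<omega> $ i $ k) \<in> borel_measurable (F a)" "(\<lambda>\<omega>. \<eta> \<omega> $ i $ k) \<in> borel_measurable (F c)" for i k
    using measurable_compose[OF \<xi>(1) entry] measurable_compose[OF \<eta>(1) entry] .
  have le: "\<bar>M $ i $ k\<bar> \<le> norm M" for M :: "real^'p^'n" and i k
    by (meson Finite_Cartesian_Product.norm_nth_le component_le_norm_cart order_trans)
  then have bd: "\<bar>\<xi> \<omega> $ i $ k\<bar> \<le> B" "\<bar>\<eta> \<omega> $ i $ k\<bar> \<le> B" if "\<omega> \<in> space P" for \<omega> i k
    using \<xi>(2)[OF that] \<eta>(2)[OF that] order_trans by blast+
  have ent_int: "integrable P (\<lambda>\<omega>. \<xi> \<omega> $ i $ k * \<eta> \<omega> $ i $ k)" for i k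
  proof (rule integrable_const_bound[of _ "B * B"])
    show "AE \<omega> in P. norm (\<xi> \<omega> $ i $ k * \<eta> \<omega> $ i $ k) \<le> B * B"
      unfolding real_norm_def abs_mult using bd order_trans[OF abs_ge_zero bd(1)] by (intro AE_I2 mult_mono) auto
    show "(\<lambda>\<omega>. \<xi> \<omega> $ i $ k * \<eta> \<omega> $ i $ k) \<in> borel_measurable P"
      by (intro borel_measurable_times measurable_filtration[OF meas(1)] measurable_filtration[OF meas(2)])
  qed
  have inner: "(\<lambda>\<omega>. \<xi> \<omega> \<bullet> \<eta> \<omega>) = (\<lambda>\<omega>. \<Sum>i\<in>UNIV. \<Sum>k\<in>UNIV. \<xi> \<omega> $ i $ k * \<eta> \<omega> $ i $ k)"
    by (simp add: inner_vec_def)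
  show "integrable P (\<lambda>\<omega>. \<xi> \<omega> \<bullet> \<eta> \<omega>)"
    unfolding inner by (intro Bochner_Integration.integrable_sum ent_int)
  have "has_bochner_integral P (\<lambda>\<omega>. \<xi> \<omega> $ i $ k * (w b \<omega> - w a \<omega>) $ k * (\<eta> \<omega> $ i $ l * (w d \<omega> - w c \<omega>) $ l))
     (if k = l then ?ov * expectation (\<lambda>\<omega>. \<xi> \<omega> $ i $ k * \<eta> \<omega> $ i $ l) else 0)" for i k l
    by (rule increments_orthogonal[OF ab cd meas(1) bd(1) meas(2) bd(2)])
  then have "has_bochner_integral P (\<lambda>\<omega>. (\<xi> \<omega> *v (w b \<omega> - w a \<omega>)) \<bullet> (\<eta> \<omega> *v (w d \<omega> - w c \<omega>)))
     (\<Sum>i\<in>UNIV. \<Sum>k\<in>UNIV. \<Sum>l\<in>UNIV. if k = l then ?ov * expectation (\<lambda>\<omega>. \<xi> \<omega> $ i $ k * \<eta> \<omega> $ i $ l) else 0)"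
    unfolding inner_matrix_vector_expand by (intro has_bochner_integral_sum)
  also have "(\<Sum>i\<in>UNIV. \<Sum>k\<in>UNIV. \<Sum>l\<in>UNIV. if k = l then ?ov * expectation (\<lambda>\<omega>. \<xi> \<omega> $ i $ k * \<eta> \<omega> $ i $ l) else 0)
     = ?ov * expectation (\<lambda>\<omega>. \<xi> \<omega> \<bullet> \<eta> \<omega>)"
    unfolding inner
    by (simp add: Bochner_Integration.integral_sum Bochner_Integration.integrable_sum ent_int sum_distrib_left)
  finally show "has_bochner_integral P (\<lambda>\<omega>. (\<xi> \<omega> *v (w b \<omega> - w a \<omega>)) \<bullet> (\<eta> \<omega> *v (w d \<omega> - w c \<omega>)))
     (?ov * expectation (\<lambda>\<omega>. \<xi> \<omega> \<bullet> \<eta> \<omega>))" .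
qed

lemma elementary_times:
  assumes "elementary_process P F a b k \<tau> \<xi>" "j \<le> k"
  shows "a \<le> \<tau> j" "\<tau> j \<le> b"
proof -
  have 1: "\<tau> 0 = a" "\<tau> k = b" and 2: "\<And>j. j < k \<Longrightarrow> \<tau> j < \<tau> (Suc j)"
    using assms(1) by (auto simp: elementary_process_def)
  have mono: "\<tau> i \<le> \<tau> j" if "i \<le> j" "j \<le> k" for i j
    using that
  proof (induction rule: dec_induct)
    case (step j)
    then show ?case using 2[of j] by simp
  qed simp
  show "a \<le> \<tau> j" "\<tau> j \<le> b"
    using mono[of 0 j] mono[of j k] assms(2) 1 by auto
qed

lemma elementary_integral_measurable:
  assumes "elementary_process P F a b k \<tau> \<xi>" "0 \<le> a"
  shows "elementary_integral w k \<tau> \<xi> \<in> borel_measurable P"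
proof -
  have "(\<lambda>\<omega>. \<xi> j \<omega> *v (w (\<tau> (Suc j)) \<omega> - w (\<tau> j) \<omega>)) \<in> borel_measurable P" if "j < k" for j
  proof -
    have "\<xi> j \<in> borel_measurable P"
      using assms(1) that by (auto simp: elementary_process_def intro: measurable_filtration)
    moreover have "0 \<le> \<tau> j" "0 \<le> \<tau> (Suc j)"
      using elementary_times(1)[OF assms(1), of j] elementary_times(1)[OF assms(1), of "Suc j"] assms(2) that
      by linarith+
    ultimately show ?thesis
      by (intro borel_measurable_matrix_vector_mult borel_measurable_diff wiener_measurable_P)
  qed
  then show ?thesis unfolding elementary_integral_def[abs_def] by (intro borel_measurable_sum) auto
qed

text \<open>\<open>Q\<close> is the time integral of the inner product of the two processes along a
  path, a finite sum of overlap lengths times inner products of coefficients. Both sides of the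
  isometry are computed through this explicit sum.\<close>

lemma elementary_inner:
  fixes \<xi> \<eta> :: "nat \<Rightarrow> 'w \<Rightarrow> real^'p^'n"
  assumes \<xi>: "elementary_process P F a b k \<tau> \<xi>" "0 \<le> a"
    and \<eta>: "elementary_process P F c d l \<sigma> \<eta>" "0 \<le> c"
  obtains Q where "integrable P Q"
    "has_bochner_integral P (\<lambda>\<omega>. elementary_integral w k \<tau> \<xi> \<omega> \<bullet> elementary_integral w l \<sigma> \<eta> \<omega>) (expectation Q)"
    "\<And>\<omega>. has_bochner_integral lborel (\<lambda>s. elementary_value k \<tau> \<xi> s \<omega> \<bullet> elementary_value l \<sigma> \<eta> s \<omega>) (Q \<omega>)"
proof -
  define ov where "ov i j = max 0 (min (\<tau> (Suc i)) (\<sigma> (Suc j)) - max (\<tau> i) (\<sigma> j))" for i j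
  define Q where "Q \<omega> = (\<Sum>i<k. \<Sum>j<l. ov i j * (\<xi> i \<omega> \<bullet> \<eta> j \<omega>))" for \<omega>
  have \<tau>: "0 \<le> \<tau> i" "\<tau> i \<le> \<tau> (Suc i)" if "i < k" for i
    using elementary_times[OF \<xi>(1), of i] \<xi> that by (auto simp: elementary_process_def intro: less_imp_le)
  have \<sigma>: "0 \<le> \<sigma> i" "\<sigma> i \<le> \<sigma> (Suc i)" if "i < l" for i
    using elementary_times[OF \<eta>(1), of i] \<eta> that by (auto simp: elementary_process_def intro: less_imp_le)
  have cell: "integrable P (\<lambda>\<omega>. \<xi> i \<omega> \<bullet> \<eta> j \<omega>)"
    "has_bochner_integral P (\<lambda>\<omega>. (\<xi> i \<omega> *v (w (\<tau> (Suc i)) \<omega> - w (\<tau> i) \<omega>)) \<bullet> (\<eta> j \<omega> *v (w (\<sigma> (Suc j)) \<omega> - w (\<sigma> j) \<omega>)))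
       (ov i j * expectation (\<lambda>\<omega>. \<xi> i \<omega> \<bullet> \<eta> j \<omega>))" if ij: "i < k" "j < l" for i j
  proof -
    obtain c1 c2 where "\<And>\<omega>. \<omega> \<in> space P \<Longrightarrow> norm (\<xi> i \<omega>) \<le> c1" "\<And>\<omega>. \<omega> \<in> space P \<Longrightarrow> norm (\<eta> j \<omega>) \<le> c2"
      using \<xi>(1) \<eta>(1) ij unfolding elementary_process_def by metis
    then have "\<And>\<omega>. \<omega> \<in> space P \<Longrightarrow> norm (\<xi> i \<omega>) \<le> max c1 c2" "\<And>\<omega>. \<omega> \<in> space P \<Longrightarrow> norm (\<eta> j \<omega>) \<le> max c1 c2"
      by (auto intro: max.coboundedI1 max.coboundedI2)
    moreover have "\<xi> i \<in> borel_measurable (F (\<tau> i))" "\<eta> j \<in> borel_measurable (F (\<sigma> j))"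
      using \<xi>(1) \<eta>(1) ij by (auto simp: elementary_process_def)
    ultimately show "integrable P (\<lambda>\<omega>. \<xi> i \<omega> \<bullet> \<eta> j \<omega>)"
      and "has_bochner_integral P (\<lambda>\<omega>. (\<xi> i \<omega> *v (w (\<tau> (Suc i)) \<omega> - w (\<tau> i) \<omega>)) \<bullet> (\<eta> j \<omega> *v (w (\<sigma> (Suc j)) \<omega> - w (\<sigma> j) \<omega>)))
       (ov i j * expectation (\<lambda>\<omega>. \<xi> i \<omega> \<bullet> \<eta> j \<omega>))"
      using increments_inner[OF \<tau>[OF ij(1)] \<sigma>[OF ij(2)], of "\<xi> i" "max c1 c2" "\<eta> j"]
      unfolding ov_def by blast+
  qed
  show thesis
  proof
    have "has_bochner_integral P Q (\<Sum>i<k. \<Sum>j<l. ov i j * expectation (\<lambda>\<omega>. \<xi> i \<omega> \<bullet> \<eta> j \<omega>))"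
      unfolding Q_def[abs_def]
      by (intro has_bochner_integral_sum has_bochner_integral_mult_right has_bochner_integral_integrable cell(1))
        simp_all
    then have "integrable P Q"
      and eq: "expectation Q = (\<Sum>i<k. \<Sum>j<l. ov i j * expectation (\<lambda>\<omega>. \<xi> i \<omega> \<bullet> \<eta> j \<omega>))"
      by (simp_all only: has_bochner_integral_iff)
    then show "integrable P Q" by simp
    have "has_bochner_integral P (\<lambda>\<omega>. \<Sum>i<k. \<Sum>j<l. (\<xi> i \<omega> *v (w (\<tau> (Suc i)) \<omega> - w (\<tau> i) \<omega>)) \<bullet> (\<eta> j \<omega> *v (w (\<sigma> (Suc j)) \<omega> - w (\<sigma> j) \<omega>)))
        (expectation Q)"
      unfolding eq by (intro has_bochner_integral_sum cell(2)) simp_all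
    moreover have "elementary_integral w k \<tau> \<xi> \<omega> \<bullet> elementary_integral w l \<sigma> \<eta> \<omega>
       = (\<Sum>i<k. \<Sum>j<l. (\<xi> i \<omega> *v (w (\<tau> (Suc i)) \<omega> - w (\<tau> i) \<omega>)) \<bullet> (\<eta> j \<omega> *v (w (\<sigma> (Suc j)) \<omega> - w (\<sigma> j) \<omega>)))" for \<omega>
      unfolding elementary_integral_def inner_sum_left inner_sum_right by (rule sum.swap)
    ultimately show "has_bochner_integral P (\<lambda>\<omega>. elementary_integral w k \<tau> \<xi> \<omega> \<bullet> elementary_integral w l \<sigma> \<eta> \<omega>) (expectation Q)"
      by (simp only:)
    fix \<omega>
    have "has_bochner_integral lborel (\<lambda>s. \<Sum>i<k. \<Sum>j<l. indicator {\<tau> i..<\<tau> (Suc i)} s * indicator {\<sigma> j..<\<sigma> (Suc j)} s * (\<xi> i \<omega> \<bullet> \<eta> j \<omega>)) (Q \<omega>)"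
      unfolding Q_def ov_def
      by (intro has_bochner_integral_sum has_bochner_integral_mult_left has_bochner_integral_overlap \<tau> \<sigma>) auto
    moreover have "elementary_value k \<tau> \<xi> s \<omega> \<bullet> elementary_value l \<sigma> \<eta> s \<omega>
       = (\<Sum>i<k. \<Sum>j<l. indicator {\<tau> i..<\<tau> (Suc i)} s * indicator {\<sigma> j..<\<sigma> (Suc j)} s * (\<xi> i \<omega> \<bullet> \<eta> j \<omega>))" for s
      unfolding elementary_value_def inner_sum_left inner_sum_right
      by (subst sum.swap) (simp only: inner_scaleR_left inner_scaleR_right mult_ac)
    ultimately show "has_bochner_integral lborel (\<lambda>s. elementary_value k \<tau> \<xi> s \<omega> \<bullet> elementary_value l \<sigma> \<eta> s \<omega>) (Q \<omega>)"
      by (simp only:)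
  qed
qed

text \<open>The partitions may differ, so the square of the difference is expanded and the polarised
  identity is used for each of the three products.\<close>

lemma elementary_isometry:
  fixes \<xi> \<eta> :: "nat \<Rightarrow> 'w \<Rightarrow> real^'p^'n"
  assumes \<xi>: "elementary_process P F a b k \<tau> \<xi>" "0 \<le> a"
    and \<eta>: "elementary_process P F c d l \<sigma> \<eta>" "0 \<le> c"
  shows "(\<integral>\<^sup>+\<omega>. ennreal ((norm (elementary_integral w k \<tau> \<xi> \<omega> - elementary_integral w l \<sigma> \<eta> \<omega>))\<^sup>2) \<partial>P)
    = (\<integral>\<^sup>+\<omega>. \<integral>\<^sup>+s. ennreal ((norm (elementary_value k \<tau> \<xi> s \<omega> - elementary_value l \<sigma> \<eta> s \<omega>))\<^sup>2) \<partial>lborel \<partial>P)"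
proof -
  let ?I = "elementary_integral w k \<tau> \<xi>" and ?J = "elementary_integral w l \<sigma> \<eta>"
  let ?X = "elementary_value k \<tau> \<xi>" and ?Y = "elementary_value l \<sigma> \<eta>"
  obtain Q1 where Q1: "integrable P Q1" "has_bochner_integral P (\<lambda>\<omega>. ?I \<omega> \<bullet> ?I \<omega>) (expectation Q1)"
    "\<And>\<omega>. has_bochner_integral lborel (\<lambda>s. ?X s \<omega> \<bullet> ?X s \<omega>) (Q1 \<omega>)"
    by (rule elementary_inner[OF \<xi> \<xi>]) (rule that)
  obtain Q2 where Q2: "integrable P Q2" "has_bochner_integral P (\<lambda>\<omega>. ?I \<omega> \<bullet> ?J \<omega>) (expectation Q2)"
    "\<And>\<omega>. has_bochner_integral lborel (\<lambda>s. ?X s \<omega> \<bullet> ?Y s \<omega>) (Q2 \<omega>)"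
    by (rule elementary_inner[OF \<xi> \<eta>]) (rule that)
  obtain Q3 where Q3: "integrable P Q3" "has_bochner_integral P (\<lambda>\<omega>. ?J \<omega> \<bullet> ?J \<omega>) (expectation Q3)"
    "\<And>\<omega>. has_bochner_integral lborel (\<lambda>s. ?Y s \<omega> \<bullet> ?Y s \<omega>) (Q3 \<omega>)"
    by (rule elementary_inner[OF \<eta> \<eta>]) (rule that)
  define Q where "Q \<omega> = Q1 \<omega> - 2 * Q2 \<omega> + Q3 \<omega>" for \<omega>
  have sq: "(norm (x - y))\<^sup>2 = x \<bullet> x - 2 * (x \<bullet> y) + y \<bullet> y" for x y :: "'z::real_inner"
    by (simp add: power2_norm_eq_inner inner_diff_left inner_diff_right inner_commute)
  have Qi: "integrable P Q" "expectation Q = expectation Q1 - 2 * expectation Q2 + expectation Q3"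
    unfolding Q_def[abs_def] using Q1(1) Q2(1) Q3(1) by simp_all
  have val: "has_bochner_integral lborel (\<lambda>s. (norm (?X s \<omega> - ?Y s \<omega>))\<^sup>2) (Q \<omega>)" for \<omega>
    unfolding sq Q_def
    by (intro has_bochner_integral_add has_bochner_integral_diff has_bochner_integral_mult_right Q1(3) Q2(3) Q3(3))
  have "has_bochner_integral P (\<lambda>\<omega>. (norm (?I \<omega> - ?J \<omega>))\<^sup>2) (expectation Q)"
    unfolding sq Qi(2)
    by (intro has_bochner_integral_add has_bochner_integral_diff has_bochner_integral_mult_right Q1(2) Q2(2) Q3(2))
  then have "(\<integral>\<^sup>+\<omega>. ennreal ((norm (?I \<omega> - ?J \<omega>))\<^sup>2) \<partial>P) = ennreal (expectation Q)"
    by (subst nn_integral_eq_integral) (auto simp: has_bochner_integral_iff)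
  also have "\<dots> = (\<integral>\<^sup>+\<omega>. ennreal (Q \<omega>) \<partial>P)"
  proof (rule nn_integral_eq_integral[symmetric, OF Qi(1)])
    have "0 \<le> Q \<omega>" for \<omega>
    proof -
      have "0 \<le> (LBINT s. (norm (?X s \<omega> - ?Y s \<omega>))\<^sup>2)" by (rule Bochner_Integration.integral_nonneg) simp
      then show ?thesis using has_bochner_integral_integral_eq[OF val[of \<omega>]] by simp
    qed
    then show "AE \<omega> in P. 0 \<le> Q \<omega>" by simp
  qed
  also have "\<dots> = (\<integral>\<^sup>+\<omega>. \<integral>\<^sup>+s. ennreal ((norm (?X s \<omega> - ?Y s \<omega>))\<^sup>2) \<partial>lborel \<partial>P)"
    using val by (intro nn_integral_cong, subst nn_integral_eq_integral) (auto simp: has_bochner_integral_iff)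
  finally show ?thesis .
qed

text \<open>The definition supplies only some approximating sequence. An arbitrary elementary
  process is compared with that sequence through the isometry; in the limit, the distance of the
  integrands bounds the distance of its integral from \<open>J\<close>. The factor 4 comes from two
  uses of \<open>nn_integral_sq_triangle\<close>.\<close>

lemma ito_integral_error:
  fixes H :: "real \<Rightarrow> 'w \<Rightarrow> real^'p^'n"
  assumes ito: "has_ito_integral P F w a b H J" and \<eta>: "elementary_process P F a b k \<tau> \<eta>" and a: "0 \<le> a"
  shows "J \<in> borel_measurable P"
    and "(\<lambda>(\<omega>, s). indicator {a..b} s *\<^sub>R H s \<omega>) \<in> borel_measurable (P \<Otimes>\<^sub>M lborel)"
    and "(\<lambda>(\<omega>, s). elementary_value k \<tau> \<eta> s \<omega>) \<in> borel_measurable (P \<Otimes>\<^sub>M lborel)"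
    and "(\<integral>\<^sup>+\<omega>. ennreal ((norm (J \<omega> - elementary_integral w k \<tau> \<eta> \<omega>))\<^sup>2) \<partial>P)
      \<le> 4 * (\<integral>\<^sup>+(\<omega>, s). ennreal ((norm (indicator {a..b} s *\<^sub>R H s \<omega> - elementary_value k \<tau> \<eta> s \<omega>))\<^sup>2) \<partial>(P \<Otimes>\<^sub>M lborel))"
proof -
  show J: "J \<in> borel_measurable P" using ito by (simp add: has_ito_integral_def)
  have ab: "a \<le> b" using elementary_times[OF \<eta>, of 0] by auto
  define Hf where "Hf = (\<lambda>(\<omega>, s). indicator {a..b} s *\<^sub>R H s \<omega>)"
  show Hf: "(\<lambda>(\<omega>, s). indicator {a..b} s *\<^sub>R H s \<omega>) \<in> borel_measurable (P \<Otimes>\<^sub>M lborel)"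
  proof -
    \<comment> \<open>Joint measurability of \<open>H\<close> is given over \<open>{a..b}\<close>
      only; clamping the time maps the line into this interval, and the indicator hides the change
      outside.\<close>
    let ?c = "\<lambda>s. max a (min b s)"
    have "?c \<in> measurable lborel (restrict_space borel {a..b})"
      using ab by (intro measurable_restrict_space2) auto
    then have "(\<lambda>x. (?c (snd x), fst x)) \<in> measurable (P \<Otimes>\<^sub>M lborel) (restrict_space borel {a..b} \<Otimes>\<^sub>M P)"
      by (intro measurable_Pair measurable_compose[OF measurable_snd] measurable_fst)
    moreover have "(\<lambda>(s, \<omega>). H s \<omega>) \<in> borel_measurable (restrict_space borel {a..b} \<Otimes>\<^sub>M P)"
      using ito by (simp add: has_ito_integral_def)
    ultimately have "(\<lambda>x. H (?c (snd x)) (fst x)) \<in> borel_measurable (P \<Otimes>\<^sub>M lborel)"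
      by (auto dest: measurable_compose)
    then have "(\<lambda>x. indicator {a..b} (snd x) *\<^sub>R H (?c (snd x)) (fst x)) \<in> borel_measurable (P \<Otimes>\<^sub>M lborel)"
      by (intro borel_measurable_scaleR measurable_compose[OF measurable_snd] borel_measurable_indicator) auto
    moreover have "indicator {a..b} (snd x) *\<^sub>R H (?c (snd x)) (fst x) = (case x of (\<omega>, s) \<Rightarrow> indicator {a..b} s *\<^sub>R H s \<omega>)" for x
      by (auto simp: indicator_def max_def min_def split: prod.split)
    ultimately show ?thesis by (simp only:)
  qed
  have ev: "(\<lambda>(\<omega>, s). elementary_value k \<tau> \<xi> s \<omega>) \<in> borel_measurable (P \<Otimes>\<^sub>M lborel)"
    if "elementary_process P F a b k \<tau> \<xi>" for k \<tau> and \<xi> :: "nat \<Rightarrow> 'w \<Rightarrow> real^'p^'n"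
    unfolding elementary_value_def[abs_def] case_prod_unfold
  proof (rule borel_measurable_sum)
    fix j assume "j \<in> {..<k}"
    then have "\<xi> j \<in> borel_measurable P"
      using that by (auto simp: elementary_process_def intro: measurable_filtration)
    then show "(\<lambda>x. indicator {\<tau> j..<\<tau> (Suc j)} (snd x) *\<^sub>R \<xi> j (fst x)) \<in> borel_measurable (P \<Otimes>\<^sub>M lborel)"
      by (intro borel_measurable_scaleR measurable_compose[OF measurable_snd]
          measurable_compose[OF measurable_fst] borel_measurable_indicator) auto
  qed
  show "(\<lambda>(\<omega>, s). elementary_value k \<tau> \<eta> s \<omega>) \<in> borel_measurable (P \<Otimes>\<^sub>M lborel)" by (rule ev[OF \<eta>])
  \<comment> \<open>Since elementary processes vanish off \<open>{a..b}\<close>, integrals over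
    \<open>{a..b}\<close> become integrals over the whole line, the form in which the isometry is
    stated.\<close>
  have supp: "elementary_value k \<tau> \<xi> s \<omega> = 0"
    if "elementary_process P F a b k \<tau> \<xi>" "s \<notin> {a..b}" for k \<tau> s \<omega> and \<xi> :: "nat \<Rightarrow> 'w \<Rightarrow> real^'p^'n"
  proof -
    have "s \<notin> {\<tau> j..<\<tau> (Suc j)}" if j: "j < k" for j
      using elementary_times[OF \<open>elementary_process P F a b k \<tau> \<xi>\<close>, of j]
        elementary_times[OF \<open>elementary_process P F a b k \<tau> \<xi>\<close>, of "Suc j"] j \<open>s \<notin> {a..b}\<close> by auto
    then show ?thesis unfolding elementary_value_def by (intro sum.neutral) auto
  qed
  define Ef where "Ef = (\<lambda>(\<omega>, s). elementary_value k \<tau> \<eta> s \<omega>)"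
  let ?K = "P \<Otimes>\<^sub>M lborel"
  let ?R = "\<integral>\<^sup>+x. ennreal ((norm (Hf x - Ef x))\<^sup>2) \<partial>?K"
  obtain kk :: "nat \<Rightarrow> nat" and tt :: "nat \<Rightarrow> nat \<Rightarrow> real" and xx :: "nat \<Rightarrow> nat \<Rightarrow> 'w \<Rightarrow> real^'p^'n"
    where el: "\<And>l. elementary_process P F a b (kk l) (tt l) (xx l)"
      and lim1: "(\<lambda>l. \<integral>\<^sup>+\<omega>. (\<integral>\<^sup>+s\<in>{a..b}. ennreal ((norm (H s \<omega> - elementary_value (kk l) (tt l) (xx l) s \<omega>))\<^sup>2) \<partial>lborel) \<partial>P) \<longlonglongrightarrow> 0"
      and lim2: "(\<lambda>l. \<integral>\<^sup>+\<omega>. ennreal ((norm (J \<omega> - elementary_integral w (kk l) (tt l) (xx l) \<omega>))\<^sup>2) \<partial>P) \<longlonglongrightarrow> 0"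
    using ito unfolding has_ito_integral_def by blast
  define Xf where "Xf l = (\<lambda>(\<omega>, s). elementary_value (kk l) (tt l) (xx l) s \<omega>)" for l
  let ?I = "\<lambda>l. elementary_integral w (kk l) (tt l) (xx l)"
  have meas [measurable]: "Hf \<in> borel_measurable ?K" "Ef \<in> borel_measurable ?K" "Xf l \<in> borel_measurable ?K" for l
    using Hf ev[OF \<eta>] ev[OF el] unfolding Hf_def Ef_def Xf_def .
  have K1: "(\<integral>\<^sup>+\<omega>. (\<integral>\<^sup>+s\<in>{a..b}. ennreal ((norm (H s \<omega> - elementary_value (kk l) (tt l) (xx l) s \<omega>))\<^sup>2) \<partial>lborel) \<partial>P)
      = (\<integral>\<^sup>+x. ennreal ((norm (Hf x - Xf l x))\<^sup>2) \<partial>?K)" for l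
  proof -
    have "(\<integral>\<^sup>+\<omega>. (\<integral>\<^sup>+s\<in>{a..b}. ennreal ((norm (H s \<omega> - elementary_value (kk l) (tt l) (xx l) s \<omega>))\<^sup>2) \<partial>lborel) \<partial>P)
      = (\<integral>\<^sup>+\<omega>. \<integral>\<^sup>+s. ennreal ((norm (Hf (\<omega>, s) - Xf l (\<omega>, s)))\<^sup>2) \<partial>lborel \<partial>P)"
      by (intro nn_integral_cong) (auto simp: Hf_def Xf_def supp[OF el] indicator_def)
    also have "\<dots> = (\<integral>\<^sup>+x. ennreal ((norm (Hf x - Xf l x))\<^sup>2) \<partial>?K)"
      by (rule lborel.nn_integral_fst[where f = "\<lambda>x. ennreal ((norm (Hf x - Xf l x))\<^sup>2)"]) measurable
    finally show ?thesis .
  qed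
  have K2: "(\<integral>\<^sup>+\<omega>. ennreal ((norm (?I l \<omega> - elementary_integral w k \<tau> \<eta> \<omega>))\<^sup>2) \<partial>P)
      = (\<integral>\<^sup>+x. ennreal ((norm (Xf l x - Ef x))\<^sup>2) \<partial>?K)" for l
  proof -
    have "(\<integral>\<^sup>+\<omega>. ennreal ((norm (?I l \<omega> - elementary_integral w k \<tau> \<eta> \<omega>))\<^sup>2) \<partial>P)
      = (\<integral>\<^sup>+\<omega>. \<integral>\<^sup>+s. ennreal ((norm (Xf l (\<omega>, s) - Ef (\<omega>, s)))\<^sup>2) \<partial>lborel \<partial>P)"
      unfolding Xf_def Ef_def prod.case by (rule elementary_isometry[OF el a \<eta> a])
    also have "\<dots> = (\<integral>\<^sup>+x. ennreal ((norm (Xf l x - Ef x))\<^sup>2) \<partial>?K)"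
      by (rule lborel.nn_integral_fst[where f = "\<lambda>x. ennreal ((norm (Xf l x - Ef x))\<^sup>2)"]) measurable
    finally show ?thesis .
  qed
  let ?n1 = "\<lambda>l. \<integral>\<^sup>+\<omega>. ennreal ((norm (J \<omega> - ?I l \<omega>))\<^sup>2) \<partial>P"
  let ?n2 = "\<lambda>l. \<integral>\<^sup>+x. ennreal ((norm (Hf x - Xf l x))\<^sup>2) \<partial>?K"
  have le: "(\<integral>\<^sup>+\<omega>. ennreal ((norm (J \<omega> - elementary_integral w k \<tau> \<eta> \<omega>))\<^sup>2) \<partial>P)
     \<le> 2 * ?n1 l + 2 * (2 * ?n2 l + 2 * ?R)" for l
  proof -
    have "(\<integral>\<^sup>+x. ennreal ((norm (Xf l x - Ef x))\<^sup>2) \<partial>?K)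
       \<le> 2 * (\<integral>\<^sup>+x. ennreal ((norm (Xf l x - Hf x))\<^sup>2) \<partial>?K) + 2 * ?R"
      by (rule nn_integral_sq_triangle[OF meas(3,1,2)])
    then have "(\<integral>\<^sup>+\<omega>. ennreal ((norm (?I l \<omega> - elementary_integral w k \<tau> \<eta> \<omega>))\<^sup>2) \<partial>P) \<le> 2 * ?n2 l + 2 * ?R"
      unfolding K2 by (simp only: norm_minus_commute)
    moreover have "(\<integral>\<^sup>+\<omega>. ennreal ((norm (J \<omega> - elementary_integral w k \<tau> \<eta> \<omega>))\<^sup>2) \<partial>P)
       \<le> 2 * ?n1 l + 2 * (\<integral>\<^sup>+\<omega>. ennreal ((norm (?I l \<omega> - elementary_integral w k \<tau> \<eta> \<omega>))\<^sup>2) \<partial>P)"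
      by (intro nn_integral_sq_triangle J elementary_integral_measurable[OF el a] elementary_integral_measurable[OF \<eta> a])
    ultimately show ?thesis
      by (meson add_left_mono mult_left_mono order_trans zero_le)
  qed
  \<comment> \<open>Both terms that involve the approximating sequence vanish in the limit, and
    \<open>4 * ?R\<close> is left.\<close>
  have "(\<lambda>l. 2 * ?n1 l + 2 * (2 * ?n2 l + 2 * ?R)) \<longlonglongrightarrow> 2 * 0 + 2 * (2 * 0 + 2 * ?R)"
    using lim1 lim2 unfolding K1
    by (intro tendsto_add ennreal_tendsto_cmult tendsto_const) auto
  then have "(\<integral>\<^sup>+\<omega>. ennreal ((norm (J \<omega> - elementary_integral w k \<tau> \<eta> \<omega>))\<^sup>2) \<partial>P) \<le> 2 * 0 + 2 * (2 * 0 + 2 * ?R)"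
    by (rule LIMSEQ_le_const) (use le in auto)
  also have "\<dots> = 4 * ?R"
    by (simp flip: mult.assoc)
  finally show "(\<integral>\<^sup>+\<omega>. ennreal ((norm (J \<omega> - elementary_integral w k \<tau> \<eta> \<omega>))\<^sup>2) \<partial>P)
      \<le> 4 * (\<integral>\<^sup>+(\<omega>, s). ennreal ((norm (indicator {a..b} s *\<^sub>R H s \<omega> - elementary_value k \<tau> \<eta> s \<omega>))\<^sup>2) \<partial>?K)"
    by (simp add: Hf_def Ef_def case_prod_unfold)
qed

end

section \<open>The Euler scheme and its energy\<close>

text \<open>The scheme is a function of a mode path and a noise path rather than of random
  processes. It can thus be run along a frozen mode path with random noise, as in the Markov
  argument, and along a fixed outcome, as in the convergence argument.\<close>

primrec euler :: "('i \<Rightarrow> real^'n^'n) \<Rightarrow> ('i \<Rightarrow> real^'p^'n) \<Rightarrow> real \<Rightarrow> real \<Rightarrow> real^'n \<Rightarrow>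
    (real \<Rightarrow> 'i) \<Rightarrow> (real \<Rightarrow> real^'p) \<Rightarrow> nat \<Rightarrow> real^'n" where
  "euler A G a h x0 \<rho> \<nu> 0 = x0"
| "euler A G a h x0 \<rho> \<nu> (Suc k) = euler A G a h x0 \<rho> \<nu> k
     + h *\<^sub>R (A (\<rho> (grid a h k)) *v euler A G a h x0 \<rho> \<nu> k)
     + G (\<rho> (grid a h k)) *v (\<nu> (grid a h (Suc k)) - \<nu> (grid a h k))"

text \<open>The summed form mirrors the integral equation of the solution, with which it is compared
  term by term.\<close>

lemma euler_eq_sum:
  "euler A G a h x0 \<rho> \<nu> k = x0 + (\<Sum>i<k. h *\<^sub>R (A (\<rho> (grid a h i)) *v euler A G a h x0 \<rho> \<nu> i))
     + (\<Sum>i<k. G (\<rho> (grid a h i)) *v (\<nu> (grid a h (Suc i)) - \<nu> (grid a h i)))"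
  by (induction k) (simp_all add: algebra_simps)

text \<open>Only the modes at grid points before \<open>k\<close> enter; the mode reached at grid
  point \<open>k\<close> affects the energy but not the iterate.\<close>

lemma euler_cong:
  assumes "\<And>i. i < k \<Longrightarrow> \<rho> (grid a h i) = \<rho>' (grid a h i)"
  shows "euler A G a h x0 \<rho> \<nu> k = euler A G a h x0 \<rho>' \<nu> k"
  using assms by (induction k) simp_all

text \<open>\<open>M\<close> is arbitrary because two kinds of sigma-algebra occur: members of the
  filtration, and the one generated by \<open>w\<close> when the mode path is frozen.\<close>

lemma euler_measurable:
  fixes r :: "real \<Rightarrow> 'w \<Rightarrow> 'i"
  assumes r: "\<And>i. i < k \<Longrightarrow> r (grid a h i) \<in> measurable M (count_space UNIV)"
    and w: "\<And>i. i \<le> k \<Longrightarrow> w (grid a h i) \<in> borel_measurable M"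
  shows "(\<lambda>\<omega>. euler A G a h x0 (\<lambda>t. r t \<omega>) (\<lambda>t. w t \<omega>) k) \<in> borel_measurable M"
  using assms
proof (induction k)
  case (Suc k)
  have comp: "(\<lambda>\<omega>. f (r (grid a h k) \<omega>)) \<in> borel_measurable M" for f :: "'i \<Rightarrow> real^'d^'e"
    by (rule measurable_compose[OF Suc.prems(1)]) auto
  show ?case
    unfolding euler.simps using Suc
    by (intro borel_measurable_add borel_measurable_scaleR borel_measurable_const borel_measurable_diff
        borel_measurable_matrix_vector_mult comp Suc.IH Suc.prems) auto
qed simp

text \<open>All terms linear in \<open>u\<close> are collected as one inner product with a vector
  that depends on \<open>y\<close> alone, the form in which the martingale property removes them.
  Both transposes appear because \<open>R\<close> is a general matrix.\<close>

lemma quadratic_form_expand: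
  fixes R :: "real^'n^'n" and G :: "real^'p^'n"
  shows "(y + G *v u) \<bullet> (R *v (y + G *v u)) = y \<bullet> (R *v y)
    + ((transpose (R ** G) + transpose G ** R) *v y) \<bullet> u + (G *v u) \<bullet> (R *v (G *v u))"
proof -
  have "y \<bullet> (R *v (G *v u)) = (transpose (R ** G) *v y) \<bullet> u"
    by (simp add: matrix_vector_mul_assoc dot_lmul_matrix transpose_matrix_vector)
  moreover have "(G *v u) \<bullet> (R *v y) = ((transpose G ** R) *v y) \<bullet> u"
    by (subst inner_commute) (simp add: dot_lmul_matrix transpose_matrix_vector flip: matrix_vector_mul_assoc)
  ultimately show ?thesis
    by (simp add: matrix_vector_right_distrib matrix_vector_mult_add_rdistrib inner_add_left inner_add_right)
qed

text \<open>The sum over all modes serves as a bound that is uniform in the random mode.\<close>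

lemma norm_finite_le_sum:
  fixes f :: "'i::finite \<Rightarrow> 'a::real_normed_vector"
  shows "norm (f i) \<le> (\<Sum>j\<in>UNIV. norm (f j))"
  by (rule member_le_sum) auto

lemma (in prob_space) square_integrable_add:
  fixes X Y :: "'a \<Rightarrow> 'b::euclidean_space"
  assumes "X \<in> borel_measurable M" "integrable M (\<lambda>\<omega>. (norm (X \<omega>))\<^sup>2)"
    and "Y \<in> borel_measurable M" "integrable M (\<lambda>\<omega>. (norm (Y \<omega>))\<^sup>2)"
  shows "integrable M (\<lambda>\<omega>. (norm (X \<omega> + Y \<omega>))\<^sup>2)"
proof (rule Bochner_Integration.integrable_bound)
  show "integrable M (\<lambda>\<omega>. 2 * (norm (X \<omega>))\<^sup>2 + 2 * (norm (Y \<omega>))\<^sup>2)"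
    using assms by simp
  show "(\<lambda>\<omega>. (norm (X \<omega> + Y \<omega>))\<^sup>2) \<in> borel_measurable M"
    using assms(1,3) by measurable
  show "AE \<omega> in M. norm ((norm (X \<omega> + Y \<omega>))\<^sup>2) \<le> norm (2 * (norm (X \<omega>))\<^sup>2 + 2 * (norm (Y \<omega>))\<^sup>2)"
    using norm_add_sq_le by (intro AE_I2) (auto intro: order_trans[OF _ abs_ge_self])
qed

lemma (in prob_space) square_integrable_matrix:
  fixes L :: "'i::finite \<Rightarrow> real^'p^'n"
  assumes "s \<in> measurable M (count_space UNIV)" "X \<in> borel_measurable M" "integrable M (\<lambda>\<omega>. (norm (X \<omega>))\<^sup>2)"
  shows "integrable M (\<lambda>\<omega>. (norm (L (s \<omega>) *v X \<omega>))\<^sup>2)"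
proof (rule Bochner_Integration.integrable_bound)
  let ?c = "(\<Sum>j\<in>UNIV. norm (L j))"
  show "integrable M (\<lambda>\<omega>. ?c\<^sup>2 * (norm (X \<omega>))\<^sup>2)"
    using assms by simp
  have "(\<lambda>\<omega>. L (s \<omega>)) \<in> borel_measurable M"
    by (rule measurable_compose[OF assms(1)]) simp
  then have "(\<lambda>\<omega>. L (s \<omega>) *v X \<omega>) \<in> borel_measurable M"
    using assms(2) by (rule borel_measurable_matrix_vector_mult)
  then show "(\<lambda>\<omega>. (norm (L (s \<omega>) *v X \<omega>))\<^sup>2) \<in> borel_measurable M"
    by measurable
  have "(norm (L j *v x))\<^sup>2 \<le> ?c\<^sup>2 * (norm x)\<^sup>2" for j x
    unfolding power_mult_distrib[symmetric]
    by (intro power_mono order_trans[OF norm_matrix_vector_mult_le] mult_right_mono norm_finite_le_sum) auto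
  then show "AE \<omega> in M. norm ((norm (L (s \<omega>) *v X \<omega>))\<^sup>2) \<le> norm (?c\<^sup>2 * (norm (X \<omega>))\<^sup>2)"
    by (intro AE_I2) (auto intro: order_trans[OF _ abs_ge_self])
qed

lemma (in prob_space) integrable_quadratic_form:
  fixes L :: "'i::finite \<Rightarrow> real^'n^'n"
  assumes s: "s \<in> measurable M (count_space UNIV)" and X: "X \<in> borel_measurable M" "integrable M (\<lambda>\<omega>. (norm (X \<omega>))\<^sup>2)"
  shows "integrable M (\<lambda>\<omega>. X \<omega> \<bullet> (L (s \<omega>) *v X \<omega>))"
proof (rule Bochner_Integration.integrable_bound)
  have LX: "(\<lambda>\<omega>. L (s \<omega>) *v X \<omega>) \<in> borel_measurable M"
    by (intro borel_measurable_matrix_vector_mult X measurable_compose[OF s]) simp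
  show "integrable M (\<lambda>\<omega>. (\<Sum>j\<in>UNIV. norm (L j)) * (norm (X \<omega>))\<^sup>2)"
    using X by simp
  show "(\<lambda>\<omega>. X \<omega> \<bullet> (L (s \<omega>) *v X \<omega>)) \<in> borel_measurable M"
    by (intro borel_measurable_inner X LX)
  have "\<bar>x \<bullet> (L j *v x)\<bar> \<le> (\<Sum>j\<in>UNIV. norm (L j)) * (norm x)\<^sup>2" for j x
    using inner_matrix_le[of x "L j" x] mult_right_mono[OF norm_finite_le_sum[of L j], of "(norm x)\<^sup>2"]
    by (simp add: power2_eq_square mult.assoc)
  then show "AE \<omega> in M. norm (X \<omega> \<bullet> (L (s \<omega>) *v X \<omega>)) \<le> norm ((\<Sum>j\<in>UNIV. norm (L j)) * (norm (X \<omega>))\<^sup>2)"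
    by (intro AE_I2) (auto intro: order_trans[OF _ abs_ge_self])
qed

section \<open>Energy of the Euler scheme\<close>

context wiener_filtration
begin

lemma increment_sq:
  assumes "0 \<le> s" "s \<le> t"
  shows "has_bochner_integral P (\<lambda>\<omega>. (norm (w t \<omega> - w s \<omega>))\<^sup>2) (real CARD('p) * (t - s))"
proof -
  have "has_bochner_integral P (\<lambda>\<omega>. \<Sum>k\<in>UNIV. (w t \<omega> - w s \<omega>) $ k * (w t \<omega> - w s \<omega>) $ k) (\<Sum>k\<in>(UNIV :: 'p set). t - s)"
    using increment_moments(2)[OF assms, of k k for k] by (intro has_bochner_integral_sum) auto
  then show ?thesis by (simp add: power2_norm_eq_inner inner_vec_def)
qed

lemma martingale_increment_inner:
  assumes c: "0 \<le> c" "c \<le> d" and U: "U \<in> borel_measurable (F c)" "integrable P (\<lambda>\<omega>. (norm (U \<omega>))\<^sup>2)"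
  shows "has_bochner_integral P (\<lambda>\<omega>. U \<omega> \<bullet> (w d \<omega> - w c \<omega>)) 0"
proof -
  have "integrable P (\<lambda>\<omega>. U \<omega> $ k)" for k
  proof (rule Bochner_Integration.integrable_bound)
    show "integrable P (\<lambda>\<omega>. 1 + (norm (U \<omega>))\<^sup>2)" using U(2) by simp
    show "(\<lambda>\<omega>. U \<omega> $ k) \<in> borel_measurable P"
      by (rule measurable_compose[OF measurable_filtration[OF U(1)] borel_measurable_nth])
    have "\<bar>v $ k\<bar> \<le> 1 + (norm v)\<^sup>2" for v :: "real^'p"
      using component_le_norm_cart[of v k] zero_le_power2[of "norm v - 1 / 2"]
      by (simp add: power2_eq_square algebra_simps)
    then show "AE \<omega> in P. norm (U \<omega> $ k) \<le> norm (1 + (norm (U \<omega>))\<^sup>2)"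
      by (intro AE_I2) (auto intro: order_trans[OF _ abs_ge_self])
  qed
  then have "has_bochner_integral P (\<lambda>\<omega>. \<Sum>k\<in>UNIV. U \<omega> $ k * (w d \<omega> - w c \<omega>) $ k) (\<Sum>k\<in>(UNIV :: 'p set). 0)"
    by (intro has_bochner_integral_sum martingale_increment c measurable_compose[OF U(1) borel_measurable_nth])
  then show ?thesis by (simp add: inner_vec_def)
qed

text \<open>The weight \<open>R\<close> is evaluated at the old mode, so everything except the
  increment \<open>D\<close> is known at time \<open>c\<close>: the cross term has mean 0, and the
  quadratic noise term contributes at most a multiple of \<open>h\<close>. The change of mode is
  treated by \<open>markov_expectation\<close>.\<close>

lemma euler_step:
  fixes r :: "real \<Rightarrow> 'w \<Rightarrow> 'i::finite" and A :: "'i \<Rightarrow> real^'n^'n" and G :: "'i \<Rightarrow> real^'p^'n"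
  assumes c: "0 \<le> c" "0 \<le> h" and s: "s \<in> measurable (F c) (count_space UNIV)"
    and X: "X \<in> borel_measurable (F c)" "integrable P (\<lambda>\<omega>. (norm (X \<omega>))\<^sup>2)"
  defines "Y \<equiv> \<lambda>\<omega>. X \<omega> + h *\<^sub>R (A (s \<omega>) *v X \<omega>)"
    and "D \<equiv> \<lambda>\<omega>. w (c + h) \<omega> - w c \<omega>"
  shows "integrable P (\<lambda>\<omega>. (norm (Y \<omega> + G (s \<omega>) *v D \<omega>))\<^sup>2)"
    and "expectation (\<lambda>\<omega>. (Y \<omega> + G (s \<omega>) *v D \<omega>) \<bullet> (R (s \<omega>) *v (Y \<omega> + G (s \<omega>) *v D \<omega>)))
      \<le> expectation (\<lambda>\<omega>. Y \<omega> \<bullet> (R (s \<omega>) *v Y \<omega>)) + h * (real CARD('p) * (\<Sum>i\<in>UNIV. norm (R i) * (norm (G i))\<^sup>2))"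
proof -
  let ?\<beta> = "\<Sum>i\<in>UNIV. norm (R i) * (norm (G i))\<^sup>2"
  have comp: "(\<lambda>\<omega>. f (s \<omega>)) \<in> borel_measurable (F c)" for f :: "'i \<Rightarrow> real^'d^'e"
    by (rule measurable_compose[OF s]) auto
  note sP = measurable_filtration[OF s] and XP = measurable_filtration[OF X(1)]
  have AX: "(\<lambda>\<omega>. A (s \<omega>) *v X \<omega>) \<in> borel_measurable (F c)"
    by (intro borel_measurable_matrix_vector_mult comp X)
  have hAX: "(\<lambda>\<omega>. h *\<^sub>R (A (s \<omega>) *v X \<omega>)) \<in> borel_measurable (F c)"
    by (intro borel_measurable_scaleR borel_measurable_const AX)
  have YF: "Y \<in> borel_measurable (F c)"
    unfolding Y_def by (intro borel_measurable_add X hAX)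
  have "integrable P (\<lambda>\<omega>. (norm (h *\<^sub>R (A (s \<omega>) *v X \<omega>)))\<^sup>2)"
    using square_integrable_matrix[OF sP XP X(2), of A] by (simp add: power_mult_distrib)
  then have Y2: "integrable P (\<lambda>\<omega>. (norm (Y \<omega>))\<^sup>2)"
    unfolding Y_def by (intro square_integrable_add XP X(2) measurable_filtration[OF hAX])
  have DP: "D \<in> borel_measurable P"
    unfolding D_def using c by (intro borel_measurable_diff wiener_measurable_P) auto
  have D: "has_bochner_integral P (\<lambda>\<omega>. (norm (D \<omega>))\<^sup>2) (real CARD('p) * h)"
    using increment_sq[of c "c + h"] c by (simp add: D_def)
  then have D2: "integrable P (\<lambda>\<omega>. (norm (D \<omega>))\<^sup>2)" by (simp add: has_bochner_integral_iff)
  have GD: "(\<lambda>\<omega>. G (s \<omega>) *v D \<omega>) \<in> borel_measurable P"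
    by (intro borel_measurable_matrix_vector_mult measurable_filtration[OF comp] DP)
  have GD2: "integrable P (\<lambda>\<omega>. (norm (G (s \<omega>) *v D \<omega>))\<^sup>2)"
    by (rule square_integrable_matrix[OF sP DP D2])
  show "integrable P (\<lambda>\<omega>. (norm (Y \<omega> + G (s \<omega>) *v D \<omega>))\<^sup>2)"
    by (intro square_integrable_add measurable_filtration[OF YF] Y2 GD GD2)
  have q1: "integrable P (\<lambda>\<omega>. Y \<omega> \<bullet> (R (s \<omega>) *v Y \<omega>))"
    by (rule integrable_quadratic_form[OF sP measurable_filtration[OF YF] Y2])
  have q2: "integrable P (\<lambda>\<omega>. (G (s \<omega>) *v D \<omega>) \<bullet> (R (s \<omega>) *v (G (s \<omega>) *v D \<omega>)))"
    by (rule integrable_quadratic_form[OF sP GD GD2])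
  let ?N = "\<lambda>i. transpose (R i ** G i) + transpose (G i) ** R i"
  have cross: "has_bochner_integral P (\<lambda>\<omega>. (?N (s \<omega>) *v Y \<omega>) \<bullet> D \<omega>) 0"
    unfolding D_def
    using c by (intro martingale_increment_inner borel_measurable_matrix_vector_mult comp YF
        square_integrable_matrix[OF sP measurable_filtration[OF YF] Y2]) auto
  have "expectation (\<lambda>\<omega>. (Y \<omega> + G (s \<omega>) *v D \<omega>) \<bullet> (R (s \<omega>) *v (Y \<omega> + G (s \<omega>) *v D \<omega>)))
     = expectation (\<lambda>\<omega>. Y \<omega> \<bullet> (R (s \<omega>) *v Y \<omega>))
       + expectation (\<lambda>\<omega>. (G (s \<omega>) *v D \<omega>) \<bullet> (R (s \<omega>) *v (G (s \<omega>) *v D \<omega>)))"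
    unfolding quadratic_form_expand using q1 q2 cross by (simp add: has_bochner_integral_iff)
  also have "expectation (\<lambda>\<omega>. (G (s \<omega>) *v D \<omega>) \<bullet> (R (s \<omega>) *v (G (s \<omega>) *v D \<omega>)))
     \<le> expectation (\<lambda>\<omega>. ?\<beta> * (norm (D \<omega>))\<^sup>2)"
  proof (rule integral_mono[OF q2])
    show "integrable P (\<lambda>\<omega>. ?\<beta> * (norm (D \<omega>))\<^sup>2)" using D2 by simp
    have "(G i *v u) \<bullet> (R i *v (G i *v u)) \<le> ?\<beta> * (norm u)\<^sup>2" for i u
    proof -
      have "(G i *v u) \<bullet> (R i *v (G i *v u)) \<le> norm (R i) * (norm (G i *v u))\<^sup>2"
        using inner_matrix_le[of "G i *v u" "R i" "G i *v u"] by (simp add: power2_eq_square mult.assoc)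
      also have "\<dots> \<le> norm (R i) * (norm (G i) * norm u)\<^sup>2"
        by (intro mult_left_mono power_mono norm_matrix_vector_mult_le) auto
      also have "\<dots> = norm (R i) * (norm (G i))\<^sup>2 * (norm u)\<^sup>2" by (simp add: power_mult_distrib)
      also have "\<dots> \<le> ?\<beta> * (norm u)\<^sup>2"
        by (intro mult_right_mono member_le_sum) auto
      finally show ?thesis .
    qed
    then show "(G (s \<omega>) *v D \<omega>) \<bullet> (R (s \<omega>) *v (G (s \<omega>) *v D \<omega>)) \<le> ?\<beta> * (norm (D \<omega>))\<^sup>2" for \<omega> .
  qed
  also have "expectation (\<lambda>\<omega>. ?\<beta> * (norm (D \<omega>))\<^sup>2) = h * (real CARD('p) * ?\<beta>)"
    using D by (simp add: has_bochner_integral_iff)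
  finally show "expectation (\<lambda>\<omega>. (Y \<omega> + G (s \<omega>) *v D \<omega>) \<bullet> (R (s \<omega>) *v (Y \<omega> + G (s \<omega>) *v D \<omega>)))
      \<le> expectation (\<lambda>\<omega>. Y \<omega> \<bullet> (R (s \<omega>) *v Y \<omega>)) + h * (real CARD('p) * ?\<beta>)"
    by simp
qed

text \<open>Any adapted mode process is allowed; the lemma is also applied to a deterministic mode
  path.\<close>

lemma euler_square_integrable:
  fixes r :: "real \<Rightarrow> 'w \<Rightarrow> 'i::finite"
  assumes a: "0 \<le> a" "0 \<le> h" and r: "\<And>t. a \<le> t \<Longrightarrow> r t \<in> measurable (F t) (count_space UNIV)"
  shows "(\<lambda>\<omega>. euler A G a h x0 (\<lambda>t. r t \<omega>) (\<lambda>t. w t \<omega>) k) \<in> borel_measurable (F (grid a h k))"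
    and "integrable P (\<lambda>\<omega>. (norm (euler A G a h x0 (\<lambda>t. r t \<omega>) (\<lambda>t. w t \<omega>) k))\<^sup>2)"
proof -
  have le: "a \<le> grid a h i" for i using a by (simp add: grid_def)
  have mono: "grid a h i \<le> grid a h j" if "i \<le> j" for i j
    using that a by (simp add: grid_def mult_right_mono)
  have meas: "(\<lambda>\<omega>. euler A G a h x0 (\<lambda>t. r t \<omega>) (\<lambda>t. w t \<omega>) k) \<in> borel_measurable (F (grid a h k))" for k
    using a le by (intro euler_measurable measurable_filtration_mono[OF r] wiener_measurable mono)
      (auto intro: order_trans)
  then show "(\<lambda>\<omega>. euler A G a h x0 (\<lambda>t. r t \<omega>) (\<lambda>t. w t \<omega>) k) \<in> borel_measurable (F (grid a h k))" .
  show "integrable P (\<lambda>\<omega>. (norm (euler A G a h x0 (\<lambda>t. r t \<omega>) (\<lambda>t. w t \<omega>) k))\<^sup>2)"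
  proof (induction k)
    case (Suc k)
    have "0 \<le> grid a h k" using a(1) le by (rule order_trans)
    from euler_step(1)[OF this a(2) r[OF le] meas Suc.IH, of A G] show ?case
      by (simp add: grid_Suc)
  qed simp
qed

text \<open>In expectations of a functional of \<open>w\<close> and of the chain on
  \<open>T\<close>, the indicator of the next mode may be replaced by its transition probability.
  The functional may involve \<open>w\<close> after time \<open>t\<close>, since the whole of
  \<open>w\<close> is independent of the chain; the noise of the current step can therefore be
  included.\<close>

lemma markov_expectation:
  fixes r :: "real \<Rightarrow> 'w \<Rightarrow> 'i::finite" and Z :: "(real \<Rightarrow> 'i) \<Rightarrow> 'w \<Rightarrow> real"
  assumes indep: "independent_processes P t0 r w"
    and r: "\<And>t. t0 \<le> t \<Longrightarrow> r t \<in> measurable P (count_space UNIV)"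
    and kernel: "\<And>a i j. \<P>(\<omega> in P. r t \<omega> = i \<and> (\<forall>s\<in>T. r s \<omega> = a s)) > 0 \<Longrightarrow>
           \<P>(\<omega> in P. r (t + h) \<omega> = j \<bar> r t \<omega> = i \<and> (\<forall>s\<in>T. r s \<omega> = a s)) = \<pi> i j"
    and T: "finite T" "T \<subseteq> {t0..}" "t \<in> T" and h: "0 \<le> h"
    and Z: "\<And>a. Z a \<in> borel_measurable (sigma (space P) {w t -` E \<inter> space P | t E. t \<ge> 0 \<and> E \<in> sets borel})"
      "\<And>a. integrable P (Z a)"
    and cong: "\<And>a b. (\<And>s. s \<in> T \<Longrightarrow> a s = b s) \<Longrightarrow> Z a = Z b"
  shows "integrable P (\<lambda>\<omega>. \<pi> (r t \<omega>) j * Z (\<lambda>s. r s \<omega>) \<omega>)"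
    and "has_bochner_integral P (\<lambda>\<omega>. (if r (t + h) \<omega> = j then 1 else 0) * Z (\<lambda>s. r s \<omega>) \<omega>)
      (expectation (\<lambda>\<omega>. \<pi> (r t \<omega>) j * Z (\<lambda>s. r s \<omega>) \<omega>))"
proof -
  let ?S1 = "{r t -` E \<inter> space P | t E. t \<ge> t0}"
  let ?S2 = "{w t -` E \<inter> space P | t E. t \<ge> 0 \<and> E \<in> sets borel}"
  define M1 where "M1 = sigma (space P) ?S1"
  define M2 where "M2 = sigma (space P) ?S2"
  (* On the event H a, where r follows the path a on T, the variable Z is a function of w alone. *)
  define Paths where "Paths = T \<rightarrow>\<^sub>E (UNIV :: 'i set)"
  define H where "H a = {\<omega> \<in> space P. \<forall>s\<in>T. r s \<omega> = a s}" for a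
  define J where "J = {\<omega> \<in> space P. r (t + h) \<omega> = j}"
  have fin: "finite Paths" unfolding Paths_def using T(1) by (intro finite_PiE) auto
  have pow: "?S1 \<subseteq> Pow (space P)" "?S2 \<subseteq> Pow (space P)" by auto
  have sp: "space M1 = space P" "space M2 = space P"
    unfolding M1_def M2_def by (rule space_measure_of[OF pow(1)], rule space_measure_of[OF pow(2)])
  have S: "sets M1 = sigma_sets (space P) ?S1" "sets M2 = sigma_sets (space P) ?S2"
    unfolding M1_def M2_def by (rule sets_measure_of[OF pow(1)], rule sets_measure_of[OF pow(2)])
  have ind: "indep_set (sets M1) (sets M2)"
    using indep unfolding S independent_processes_def .
  have ev: "{\<omega> \<in> space P. r s \<omega> = i} \<in> sets M1" if "t0 \<le> s" for s i
  proof -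
    have "{\<omega> \<in> space P. r s \<omega> = i} = r s -` {i} \<inter> space P" by auto
    then show ?thesis unfolding S using that by (intro sigma_sets.Basic) blast
  qed
  have HM: "H a \<in> sets M1" for a
    unfolding H_def sp(1)[symmetric]
    using ev T by (intro sets.sets_Collect_finite_All') (auto simp: sp)
  have JM: "J \<in> sets M1"
    unfolding J_def using T h by (intro ev) auto
  have prod: "has_bochner_integral P (\<lambda>\<omega>. indicator E \<omega> * Z a \<omega>) (prob E * expectation (Z a))"
    if "E \<in> sets M1" for E a
  proof -
    have "E \<in> events" using indep_setD_ev1[OF ind] that by auto
    then have "integrable P (indicator E :: 'w \<Rightarrow> real)" "expectation (indicator E :: 'w \<Rightarrow> real) = prob E"
      by (auto simp: integrable_indicator_iff emeasure_eq_measure)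
    moreover have "has_bochner_integral P (Z a) (expectation (Z a))"
      using Z(2) by (rule has_bochner_integral_integrable)
    ultimately show ?thesis
      using has_bochner_integral_indep_mult[OF ind sp, of "indicator E" "Z a" "expectation (Z a)"] that Z(1)[of a]
      by (simp add: M2_def)
  qed
  have Hev: "H a \<in> events" "J \<in> events" for a using HM JM indep_setD_ev1[OF ind] by auto
  \<comment> \<open>The kernel is prescribed on events of positive probability; if
    \<open>H a\<close> is a null event, both sides are 0.\<close>
  have trans: "prob (J \<inter> H a) = \<pi> (a t) j * prob (H a)" for a
  proof -
    have eq: "{\<omega> \<in> space P. r t \<omega> = a t \<and> (\<forall>s\<in>T. r s \<omega> = a s)} = H a"
      using T(3) by (auto simp: H_def)
    have eq': "{\<omega> \<in> space P. r (t + h) \<omega> = j \<and> r t \<omega> = a t \<and> (\<forall>s\<in>T. r s \<omega> = a s)} = J \<inter> H a"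
      using T(3) by (auto simp: H_def J_def)
    show ?thesis
    proof (cases "prob (H a) = 0")
      case True
      then have "prob (J \<inter> H a) \<le> 0" using finite_measure_mono[of "J \<inter> H a" "H a"] Hev by auto
      then show ?thesis using True by (simp add: measure_le_0_iff)
    next
      case False
      then have "prob (H a) > 0" by (simp add: zero_less_measure_iff)
      then have "prob (J \<inter> H a) / prob (H a) = \<pi> (a t) j"
        using kernel[of "a t" a j] unfolding cond_prob_def eq eq' by simp
      then show ?thesis using False by (simp add: field_simps)
    qed
  qed
  \<comment> \<open>Of the finitely many extensional paths on \<open>T\<close>, exactly one, the
    restriction of the actual path, has \<omega> in its event. Values outside \<open>T\<close> do
    not affect \<open>f\<close>.\<close>
  have split: "f (\<lambda>s. r s \<omega>) = (\<Sum>a\<in>Paths. indicator (H a) \<omega> * f a)"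
    if \<omega>: "\<omega> \<in> space P" and f: "\<And>a b. (\<And>s. s \<in> T \<Longrightarrow> a s = b s) \<Longrightarrow> f a = f b" for \<omega> and f :: "(real \<Rightarrow> 'i) \<Rightarrow> real"
  proof -
    let ?a = "restrict (\<lambda>s. r s \<omega>) T"
    have "indicator (H a) \<omega> * f a = (if a = ?a then f ?a else 0)" if "a \<in> Paths" for a
    proof (cases "a = ?a")
      case False
      have "a = ?a" if "\<omega> \<in> H a"
        using that \<open>a \<in> Paths\<close> by (intro ext) (auto simp: H_def Paths_def PiE_def extensional_def)
      then have "\<omega> \<notin> H a" using False by blast
      then show ?thesis using False by simp
    qed (use \<omega> in \<open>simp add: H_def\<close>)
    then have "(\<Sum>a\<in>Paths. indicator (H a) \<omega> * f a) = (\<Sum>a\<in>Paths. if a = ?a then f ?a else 0)"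
      by (rule sum.cong[OF refl])
    also have "\<dots> = f ?a"
      using fin by (simp add: Paths_def)
    also have "\<dots> = f (\<lambda>s. r s \<omega>)" by (rule f) simp
    finally show ?thesis by simp
  qed
  let ?v = "\<Sum>a\<in>Paths. \<pi> (a t) j * (prob (H a) * expectation (Z a))"
  have R: "has_bochner_integral P (\<lambda>\<omega>. \<pi> (r t \<omega>) j * Z (\<lambda>s. r s \<omega>) \<omega>) ?v"
  proof -
    have "has_bochner_integral P (\<lambda>\<omega>. \<Sum>a\<in>Paths. \<pi> (a t) j * (indicator (H a) \<omega> * Z a \<omega>)) ?v"
      by (intro has_bochner_integral_sum has_bochner_integral_mult_right prod HM)
    moreover have "(\<Sum>a\<in>Paths. \<pi> (a t) j * (indicator (H a) \<omega> * Z a \<omega>)) = \<pi> (r t \<omega>) j * Z (\<lambda>s. r s \<omega>) \<omega>"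
      if "\<omega> \<in> space P" for \<omega>
    proof -
      have "\<pi> (a t) j * Z a \<omega> = \<pi> (b t) j * Z b \<omega>" if "\<And>s. s \<in> T \<Longrightarrow> a s = b s" for a b
        using cong[OF that] that[OF T(3)] by simp
      then have "\<pi> (r t \<omega>) j * Z (\<lambda>s. r s \<omega>) \<omega> = (\<Sum>a\<in>Paths. indicator (H a) \<omega> * (\<pi> (a t) j * Z a \<omega>))"
        by (rule split[OF that, of "\<lambda>a. \<pi> (a t) j * Z a \<omega>"])
      then show ?thesis by (simp only: mult.left_commute)
    qed
    ultimately show ?thesis
      by (rule iffD1[OF has_bochner_integral_cong[OF refl _ refl], rotated])
  qed
  then show "integrable P (\<lambda>\<omega>. \<pi> (r t \<omega>) j * Z (\<lambda>s. r s \<omega>) \<omega>)" by (simp add: has_bochner_integral_iff)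
  have "has_bochner_integral P (\<lambda>\<omega>. \<Sum>a\<in>Paths. indicator (J \<inter> H a) \<omega> * Z a \<omega>) (\<Sum>a\<in>Paths. prob (J \<inter> H a) * expectation (Z a))"
    by (intro has_bochner_integral_sum prod sets.Int JM HM)
  moreover have "(\<Sum>a\<in>Paths. indicator (J \<inter> H a) \<omega> * Z a \<omega>) = (if r (t + h) \<omega> = j then 1 else 0) * Z (\<lambda>s. r s \<omega>) \<omega>"
    if "\<omega> \<in> space P" for \<omega>
  proof -
    have "Z a \<omega> = Z b \<omega>" if "\<And>s. s \<in> T \<Longrightarrow> a s = b s" for a b
      using cong[OF that] by simp
    then have "Z (\<lambda>s. r s \<omega>) \<omega> = (\<Sum>a\<in>Paths. indicator (H a) \<omega> * Z a \<omega>)"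
      by (rule split[OF that, of "\<lambda>a. Z a \<omega>"])
    moreover have "indicator J \<omega> = (if r (t + h) \<omega> = j then 1 else 0 :: real)"
      using that by (simp add: J_def)
    ultimately show ?thesis
      by (simp only: indicator_inter_arith sum_distrib_left mult.assoc)
  qed
  ultimately have "has_bochner_integral P (\<lambda>\<omega>. (if r (t + h) \<omega> = j then 1 else 0) * Z (\<lambda>s. r s \<omega>) \<omega>)
      (\<Sum>a\<in>Paths. prob (J \<inter> H a) * expectation (Z a))"
    by (rule iffD1[OF has_bochner_integral_cong[OF refl _ refl], rotated])
  also have "(\<Sum>a\<in>Paths. prob (J \<inter> H a) * expectation (Z a)) = ?v"
    by (simp only: trans mult.assoc)
  finally have "has_bochner_integral P (\<lambda>\<omega>. (if r (t + h) \<omega> = j then 1 else 0) * Z (\<lambda>s. r s \<omega>) \<omega>) ?v" .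
  then show "has_bochner_integral P (\<lambda>\<omega>. (if r (t + h) \<omega> = j then 1 else 0) * Z (\<lambda>s. r s \<omega>) \<omega>)
      (expectation (\<lambda>\<omega>. \<pi> (r t \<omega>) j * Z (\<lambda>s. r s \<omega>) \<omega>))"
    using has_bochner_integral_integral_eq[OF R] by simp
qed


text \<open>Averaging over the next mode turns the weight into \<open>R (r t \<omega>)\<close>,
  where \<open>R i\<close> is the mean of the \<open>Q j\<close> under the transition from
  \<open>i\<close>; \<open>euler_step\<close> with this weight removes the noise, and
  \<open>contr\<close> bounds the remaining drift part. As \<open>near\<close> compares
  \<open>R\<close> with \<open>Q\<close>, the noise constant is free of \<open>h\<close> and of the
  transition probabilities.\<close>

lemma euler_energy_step:
  fixes r :: "real \<Rightarrow> 'w \<Rightarrow> 'i::finite" and A Q :: "'i \<Rightarrow> real^'n^'n" and G :: "'i \<Rightarrow> real^'p^'n" and x0 :: "real^'n"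
  assumes t0: "0 \<le> t0" and h: "0 < h"
    and r: "\<And>t. t0 \<le> t \<Longrightarrow> r t \<in> measurable (F t) (count_space UNIV)"
    and indep: "independent_processes P t0 r w"
    and kernel: "\<And>t T a i j. t0 \<le> t \<Longrightarrow> finite T \<Longrightarrow> T \<subseteq> {t0..t} \<Longrightarrow>
           \<P>(\<omega> in P. r t \<omega> = i \<and> (\<forall>s\<in>T. r s \<omega> = a s)) > 0 \<Longrightarrow>
           \<P>(\<omega> in P. r (t + h) \<omega> = j \<bar> r t \<omega> = i \<and> (\<forall>s\<in>T. r s \<omega> = a s)) = \<pi> i j"
    and contr: "\<And>i v. (\<Sum>j\<in>UNIV. \<pi> i j * ((v + h *\<^sub>R (A i *v v)) \<bullet> (Q j *v (v + h *\<^sub>R (A i *v v)))))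
          \<le> (1 - \<alpha> * h) * (v \<bullet> (Q i *v v))"
    and near: "\<And>i. norm (\<Sum>j\<in>UNIV. \<pi> i j *\<^sub>R Q j) \<le> norm (Q i) + 1"
  defines "e \<equiv> \<lambda>k \<omega>. euler A G t0 h x0 (\<lambda>t. r t \<omega>) (\<lambda>t. w t \<omega>) k"
  shows "expectation (\<lambda>\<omega>. e (Suc k) \<omega> \<bullet> (Q (r (grid t0 h (Suc k)) \<omega>) *v e (Suc k) \<omega>))
    \<le> (1 - \<alpha> * h) * expectation (\<lambda>\<omega>. e k \<omega> \<bullet> (Q (r (grid t0 h k) \<omega>) *v e k \<omega>))
      + h * (real CARD('p) * (\<Sum>i\<in>UNIV. (norm (Q i) + 1) * (norm (G i))\<^sup>2))"
proof -
  define t where "t = grid t0 h k"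
  \<comment> \<open>The modes at grid points 0 to \<open>k\<close> determine iterate
    \<open>Suc k\<close>, and none of these points exceeds \<open>t\<close>, so
    \<open>kernel\<close> applies.\<close>
  define T where "T = grid t0 h ` {..k}"
  define R where "R i = (\<Sum>j\<in>UNIV. \<pi> i j *\<^sub>R Q j)" for i
  \<comment> \<open>The energy after the step for a frozen mode path \<open>a\<close> and a fixed
    next mode \<open>j\<close>, hence a function of \<open>w\<close> alone.\<close>
  define Z where "Z j a \<omega> = euler A G t0 h x0 a (\<lambda>t. w t \<omega>) (Suc k) \<bullet> (Q j *v euler A G t0 h x0 a (\<lambda>t. w t \<omega>) (Suc k))"
    for j \<omega> and a :: "real \<Rightarrow> 'i"
  have t: "t0 \<le> t" "0 \<le> t" "t \<in> T" "finite T" "T \<subseteq> {t0..t}"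
    using t0 h by (auto simp: t_def T_def grid_le_iff) (simp_all add: grid_def)
  have tS: "grid t0 h (Suc k) = t + h" by (simp add: t_def grid_Suc)
  have R: "u \<bullet> (R i *v u) = (\<Sum>j\<in>UNIV. \<pi> i j * (u \<bullet> (Q j *v u)))" for i u
  proof -
    have "(\<Sum>j\<in>S. f j) *v u = (\<Sum>j\<in>S. f j *v u)" for S :: "'i set" and f :: "'i \<Rightarrow> real^'n^'n"
      by (induction S rule: infinite_finite_induct) (simp_all add: matrix_vector_mult_add_rdistrib)
    then have "R i *v u = (\<Sum>j\<in>UNIV. \<pi> i j *\<^sub>R (Q j *v u))"
      by (simp add: R_def scaleR_matrix_vector_assoc)
    then show ?thesis by (simp add: inner_sum_right)
  qed
  let ?W = "sigma (space P) {w t -` E \<inter> space P | t E. t \<ge> 0 \<and> E \<in> sets borel}"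
  have W: "w t \<in> borel_measurable ?W" if "0 \<le> t" for t
  proof (rule measurableI)
    have pow: "{w t -` E \<inter> space P | t E. t \<ge> 0 \<and> E \<in> sets borel} \<subseteq> Pow (space P)" by auto
    show "w t -` E \<inter> space ?W \<in> sets ?W" if "E \<in> sets borel" for E
      unfolding sets_measure_of[OF pow] space_measure_of[OF pow]
      using \<open>0 \<le> t\<close> that by (intro sigma_sets.Basic) auto
  qed simp
  have Zm: "Z j a \<in> borel_measurable ?W" for j a
  proof -
    have "(\<lambda>\<omega>. euler A G t0 h x0 (\<lambda>t. (\<lambda>t \<omega>. a t) t \<omega>) (\<lambda>t. w t \<omega>) (Suc k)) \<in> borel_measurable ?W"
      using t0 h by (intro euler_measurable W) (simp_all add: grid_def)
    then show ?thesis
      unfolding Z_def[abs_def] by (intro borel_measurable_inner borel_measurable_matrix_vector_mult borel_measurable_const) simp_all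
  qed
  have Zi: "integrable P (Z j a)" for j a
  proof -
    have "0 \<le> t0" "0 \<le> h" using t0 h by simp_all
    note sq = euler_square_integrable[OF this, of "\<lambda>t \<omega>. a t" A G x0 "Suc k"]
    show ?thesis
      unfolding Z_def[abs_def]
      using integrable_quadratic_form[of "\<lambda>_. j", OF _ measurable_filtration[OF sq(1)] sq(2), of Q] by simp
  qed
  have Zc: "Z j a = Z j b" if "\<And>s. s \<in> T \<Longrightarrow> a s = b s" for j a b
    unfolding Z_def[abs_def] using that euler_cong[of "Suc k" a t0 h b A G x0] by (simp add: T_def del: euler.simps)
  have rP: "r s \<in> measurable P (count_space UNIV)" if "t0 \<le> s" for s
    by (rule measurable_filtration[OF r[OF that]])
  have sub: "T \<subseteq> {t0..}" using t(5) by auto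
  note mk = markov_expectation[OF indep rP kernel[OF t(1,4,5)] t(4) sub t(3) less_imp_le[OF h] Zm Zi Zc]
  have Zr: "Z j (\<lambda>s. r s \<omega>) \<omega> = e (Suc k) \<omega> \<bullet> (Q j *v e (Suc k) \<omega>)" for j \<omega>
    unfolding Z_def e_def ..
  have mode: "(\<Sum>j\<in>UNIV. (if r (t + h) \<omega> = j then 1 else 0) * Z j (\<lambda>s. r s \<omega>) \<omega>)
      = e (Suc k) \<omega> \<bullet> (Q (r (t + h) \<omega>) *v e (Suc k) \<omega>)" for \<omega>
    unfolding Zr by (simp add: if_distrib[of "\<lambda>x. x * _"] cong: if_cong)
  have "has_bochner_integral P (\<lambda>\<omega>. \<Sum>j\<in>UNIV. (if r (t + h) \<omega> = j then 1 else 0) * Z j (\<lambda>s. r s \<omega>) \<omega>)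
     (\<Sum>j\<in>UNIV. expectation (\<lambda>\<omega>. \<pi> (r t \<omega>) j * Z j (\<lambda>s. r s \<omega>) \<omega>))"
    by (intro has_bochner_integral_sum mk(2))
  then have "expectation (\<lambda>\<omega>. e (Suc k) \<omega> \<bullet> (Q (r (t + h) \<omega>) *v e (Suc k) \<omega>))
     = (\<Sum>j\<in>UNIV. expectation (\<lambda>\<omega>. \<pi> (r t \<omega>) j * Z j (\<lambda>s. r s \<omega>) \<omega>))"
    unfolding mode by (rule has_bochner_integral_integral_eq)
  also have "\<dots> = expectation (\<lambda>\<omega>. e (Suc k) \<omega> \<bullet> (R (r t \<omega>) *v e (Suc k) \<omega>))"
    unfolding R Zr[symmetric] by (rule Bochner_Integration.integral_sum[symmetric, OF mk(1)])
  also have "\<dots> \<le> expectation (\<lambda>\<omega>. (e k \<omega> + h *\<^sub>R (A (r t \<omega>) *v e k \<omega>)) \<bullet> (R (r t \<omega>) *v (e k \<omega> + h *\<^sub>R (A (r t \<omega>) *v e k \<omega>))))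
      + h * (real CARD('p) * (\<Sum>i\<in>UNIV. norm (R i) * (norm (G i))\<^sup>2))"
  proof -
    have "0 \<le> t0" "0 \<le> h" using t0 h by simp_all
    note sq = euler_square_integrable[OF this r, of A G x0 k, folded t_def]
    have eS: "e (Suc k) \<omega> = e k \<omega> + h *\<^sub>R (A (r t \<omega>) *v e k \<omega>) + G (r t \<omega>) *v (w (t + h) \<omega> - w t \<omega>)" for \<omega>
      unfolding e_def by (simp add: t_def grid_Suc)
    show ?thesis
      unfolding eS using euler_step(2)[OF t(2) \<open>0 \<le> h\<close> r[OF t(1)] sq, of A G R] unfolding e_def .
  qed
  also have "expectation (\<lambda>\<omega>. (e k \<omega> + h *\<^sub>R (A (r t \<omega>) *v e k \<omega>)) \<bullet> (R (r t \<omega>) *v (e k \<omega> + h *\<^sub>R (A (r t \<omega>) *v e k \<omega>))))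
     \<le> expectation (\<lambda>\<omega>. (1 - \<alpha> * h) * (e k \<omega> \<bullet> (Q (r t \<omega>) *v e k \<omega>)))"
  proof (rule integral_mono)
    have "0 \<le> t0" "0 \<le> h" using t0 h by simp_all
    note sq = euler_square_integrable[OF this r, of A G x0 k, folded t_def]
    note eP = measurable_filtration[OF sq(1)]
    have rt: "r t \<in> measurable P (count_space UNIV)" by (rule rP[OF t(1)])
    show "integrable P (\<lambda>\<omega>. (1 - \<alpha> * h) * (e k \<omega> \<bullet> (Q (r t \<omega>) *v e k \<omega>)))"
      unfolding e_def by (intro integrable_mult_right integrable_quadratic_form rt eP sq(2))
    have m: "(\<lambda>\<omega>. h *\<^sub>R (A (r t \<omega>) *v e k \<omega>)) \<in> borel_measurable P"
      unfolding e_def by (intro borel_measurable_scaleR borel_measurable_const borel_measurable_matrix_vector_mult eP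
          measurable_compose[OF rt]) simp
    have "integrable P (\<lambda>\<omega>. h\<^sup>2 * (norm (A (r t \<omega>) *v e k \<omega>))\<^sup>2)"
      unfolding e_def by (intro integrable_mult_right square_integrable_matrix rt eP sq(2))
    then have i: "integrable P (\<lambda>\<omega>. (norm (h *\<^sub>R (A (r t \<omega>) *v e k \<omega>)))\<^sup>2)"
      by (simp add: power_mult_distrib)
    show "integrable P (\<lambda>\<omega>. (e k \<omega> + h *\<^sub>R (A (r t \<omega>) *v e k \<omega>)) \<bullet> (R (r t \<omega>) *v (e k \<omega> + h *\<^sub>R (A (r t \<omega>) *v e k \<omega>))))"
      by (intro integrable_quadratic_form rt borel_measurable_add square_integrable_add m i)
        (use eP sq(2) in \<open>simp_all add: e_def\<close>)
    show "(e k \<omega> + h *\<^sub>R (A (r t \<omega>) *v e k \<omega>)) \<bullet> (R (r t \<omega>) *v (e k \<omega> + h *\<^sub>R (A (r t \<omega>) *v e k \<omega>)))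
      \<le> (1 - \<alpha> * h) * (e k \<omega> \<bullet> (Q (r t \<omega>) *v e k \<omega>))" for \<omega>
      unfolding R by (rule contr)
  qed
  also have "h * (real CARD('p) * (\<Sum>i\<in>UNIV. norm (R i) * (norm (G i))\<^sup>2))
     \<le> h * (real CARD('p) * (\<Sum>i\<in>UNIV. (norm (Q i) + 1) * (norm (G i))\<^sup>2))"
    using h near by (intro mult_left_mono sum_mono mult_right_mono) (auto simp: R_def)
  finally show ?thesis
    by (simp add: tS t_def[symmetric])
qed

text \<open>The affine recursion has the fixed point \<open>\<beta> / \<alpha>\<close>, and
  \<open>\<alpha> * h \<le> 1\<close> keeps its factor nonnegative, so the bound propagates by
  induction; the geometric factor is compared with an exponential in \<open>real k * h\<close>, and
  \<open>c\<close> converts energy into mean square.\<close>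

lemma euler_energy_bound:
  fixes r :: "real \<Rightarrow> 'w \<Rightarrow> 'i::finite" and A Q :: "'i \<Rightarrow> real^'n^'n" and G :: "'i \<Rightarrow> real^'p^'n" and x0 :: "real^'n"
  assumes t0: "0 \<le> t0" and h: "0 < h"
    and r: "\<And>t. t0 \<le> t \<Longrightarrow> r t \<in> measurable (F t) (count_space UNIV)"
    and indep: "independent_processes P t0 r w"
    and kernel: "\<And>t T a i j. t0 \<le> t \<Longrightarrow> finite T \<Longrightarrow> T \<subseteq> {t0..t} \<Longrightarrow>
           \<P>(\<omega> in P. r t \<omega> = i \<and> (\<forall>s\<in>T. r s \<omega> = a s)) > 0 \<Longrightarrow>
           \<P>(\<omega> in P. r (t + h) \<omega> = j \<bar> r t \<omega> = i \<and> (\<forall>s\<in>T. r s \<omega> = a s)) = \<pi> i j"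
    and contr: "\<And>i v. (\<Sum>j\<in>UNIV. \<pi> i j * ((v + h *\<^sub>R (A i *v v)) \<bullet> (Q j *v (v + h *\<^sub>R (A i *v v)))))
          \<le> (1 - \<alpha> * h) * (v \<bullet> (Q i *v v))"
    and near: "\<And>i. norm (\<Sum>j\<in>UNIV. \<pi> i j *\<^sub>R Q j) \<le> norm (Q i) + 1"
    and \<alpha>: "0 < \<alpha>" "\<alpha> * h \<le> 1"
    and Q: "0 < c" "\<And>i v. c * (norm v)\<^sup>2 \<le> v \<bullet> (Q i *v v)"
  defines "e \<equiv> \<lambda>k \<omega>. euler A G t0 h x0 (\<lambda>t. r t \<omega>) (\<lambda>t. w t \<omega>) k"
    and "\<beta> \<equiv> real CARD('p) * (\<Sum>i\<in>UNIV. (norm (Q i) + 1) * (norm (G i))\<^sup>2)"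
  shows "(\<integral>\<^sup>+\<omega>. ennreal ((norm (e k \<omega>))\<^sup>2) \<partial>P)
    \<le> ennreal ((exp (- \<alpha> * (real k * h)) * ((\<Sum>i\<in>UNIV. norm (Q i)) * (norm x0)\<^sup>2) + \<beta> / \<alpha>) / c)"
proof -
  define v where "v k = expectation (\<lambda>\<omega>. e k \<omega> \<bullet> (Q (r (grid t0 h k) \<omega>) *v e k \<omega>))" for k
  let ?V = "(\<Sum>i\<in>UNIV. norm (Q i)) * (norm x0)\<^sup>2"
  have "0 \<le> h" using h by simp
  note sq = euler_square_integrable[OF t0 this r, of A G x0]
  have int: "integrable P (\<lambda>\<omega>. e k \<omega> \<bullet> (Q (r (grid t0 h k) \<omega>) *v e k \<omega>))" for k
    unfolding e_def using h
    by (intro integrable_quadratic_form measurable_filtration[OF r] measurable_filtration[OF sq(1)] sq(2))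
      (simp_all add: grid_def)
  have v0: "v 0 \<le> ?V"
  proof -
    have le: "x0 \<bullet> (Q i *v x0) \<le> ?V" for i
      using inner_matrix_le[of x0 "Q i" x0] mult_right_mono[OF norm_finite_le_sum[of Q i], of "(norm x0)\<^sup>2"]
      by (simp add: power2_eq_square mult.assoc)
    have "v 0 \<le> expectation (\<lambda>\<omega>. ?V)"
      unfolding v_def using int[of 0] le by (intro integral_mono) (simp_all add: e_def)
    then show ?thesis by (simp add: prob_space)
  qed
  have step: "v (Suc k) \<le> (1 - \<alpha> * h) * v k + h * \<beta>" for k
    unfolding v_def e_def \<beta>_def by (rule euler_energy_step[OF t0 h r indep kernel contr near])
  have "v k \<le> (1 - \<alpha> * h) ^ k * ?V + \<beta> / \<alpha>" for k
  proof (induction k)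
    case 0
    have "0 \<le> \<beta> / \<alpha>" using \<alpha> by (simp add: \<beta>_def sum_nonneg)
    then show ?case using v0 by simp
  next
    case (Suc k)
    have "v (Suc k) \<le> (1 - \<alpha> * h) * ((1 - \<alpha> * h) ^ k * ?V + \<beta> / \<alpha>) + h * \<beta>"
      using step[of k] mult_left_mono[OF Suc, of "1 - \<alpha> * h"] \<alpha> by simp
    also have "\<dots> = (1 - \<alpha> * h) ^ Suc k * ?V + \<beta> / \<alpha>"
      using \<alpha> by (simp add: field_simps)
    finally show ?case .
  qed
  also have "(1 - \<alpha> * h) ^ k * ?V \<le> exp (- \<alpha> * (real k * h)) * ?V"
  proof (rule mult_right_mono)
    have "(1 - \<alpha> * h) ^ k \<le> exp (- (\<alpha> * h)) ^ k"
      using \<alpha> exp_ge_add_one_self[of "- (\<alpha> * h)"] by (intro power_mono) auto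
    also have "\<dots> = exp (- \<alpha> * (real k * h))"
      using exp_of_nat_mult[of k "- (\<alpha> * h)"] by (simp add: mult_ac)
    finally show "(1 - \<alpha> * h) ^ k \<le> exp (- \<alpha> * (real k * h))" .
  qed (simp add: sum_nonneg)
  finally have vk: "v k \<le> exp (- \<alpha> * (real k * h)) * ?V + \<beta> / \<alpha>" by simp
  have "c * expectation (\<lambda>\<omega>. (norm (e k \<omega>))\<^sup>2) = expectation (\<lambda>\<omega>. c * (norm (e k \<omega>))\<^sup>2)" by simp
  also have "\<dots> \<le> v k"
    unfolding v_def by (rule integral_mono) (use sq(2) int Q in \<open>simp_all add: e_def\<close>)
  also note vk
  finally have "expectation (\<lambda>\<omega>. (norm (e k \<omega>))\<^sup>2) \<le> (exp (- \<alpha> * (real k * h)) * ?V + \<beta> / \<alpha>) / c"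
    using Q(1) by (simp add: field_simps)
  moreover have "(\<integral>\<^sup>+\<omega>. ennreal ((norm (e k \<omega>))\<^sup>2) \<partial>P) = ennreal (expectation (\<lambda>\<omega>. (norm (e k \<omega>))\<^sup>2))"
    using sq(2) by (intro nn_integral_eq_integral) (simp_all add: e_def)
  ultimately show ?thesis by (simp add: ennreal_leI)
qed

end

section \<open>Convergence of the Euler scheme\<close>

text \<open>Subtracting the summed scheme from the integral equation leaves the noise error
  \<open>D j\<close>, the Riemann error of the drift, and a sum of earlier errors with factor
  \<open>L * h\<close>, to which the discrete Gronwall inequality applies. The estimate is purely
  pathwise: the stochastic integral is represented by what the drift integral leaves of
  \<open>X\<close>.\<close>

lemma euler_error_bound:
  fixes A :: "'i::finite \<Rightarrow> real^'n^'n" and G :: "'i \<Rightarrow> real^'p^'n" and X :: "real \<Rightarrow> real^'n"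
  assumes h: "h \<ge> 0"
    and D: "\<And>j. j \<le> N \<Longrightarrow> D j = X (grid a h j) - x0 - integral {a..grid a h j} (\<lambda>s. A (\<rho> s) *v X s)
        - (\<Sum>i<j. G (\<rho> (grid a h i)) *v (\<nu> (grid a h (Suc i)) - \<nu> (grid a h i)))"
    and riemann: "\<And>j. j \<le> N \<Longrightarrow> norm (integral {a..grid a h j} (\<lambda>s. A (\<rho> s) *v X s)
        - (\<Sum>i<j. h *\<^sub>R (A (\<rho> (grid a h i)) *v X (grid a h i)))) \<le> \<delta>"
  defines "L \<equiv> \<Sum>i\<in>UNIV. norm (A i)"
  shows "norm (X (grid a h N) - euler A G a h x0 \<rho> \<nu> N)
    \<le> (norm (D N) + \<delta>) + L * h * exp (L * h * real N) * (\<Sum>i<N. norm (D i) + \<delta>)"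
proof (rule discrete_gronwall[where e = "\<lambda>j. norm (X (grid a h j) - euler A G a h x0 \<rho> \<nu> j)" and b = "\<lambda>j. norm (D j) + \<delta>"])
  have L: "L \<ge> 0" unfolding L_def by (simp add: sum_nonneg)
  then show "0 \<le> L * h" using h by simp
  have "0 \<le> \<delta>" using order_trans[OF norm_ge_zero riemann[of 0]] by simp
  then show "0 \<le> norm (D j) + \<delta>" for j by simp
  fix j assume j: "j \<le> N"
  let ?e = "\<lambda>j. X (grid a h j) - euler A G a h x0 \<rho> \<nu> j"
  let ?R = "integral {a..grid a h j} (\<lambda>s. A (\<rho> s) *v X s) - (\<Sum>i<j. h *\<^sub>R (A (\<rho> (grid a h i)) *v X (grid a h i)))"
  let ?S = "\<Sum>i<j. h *\<^sub>R (A (\<rho> (grid a h i)) *v ?e i)"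
  have eq: "?e j = D j + ?R + ?S"
    unfolding D[OF j] euler_eq_sum[of A G a h x0 \<rho> \<nu> j]
    by (simp add: matrix_vector_mult_diff_distrib scaleR_diff_right sum_subtractf)
  have S: "norm ?S \<le> (\<Sum>i<j. L * h * norm (?e i))"
  proof (rule sum_norm_le)
    fix i
    have "norm (A (\<rho> (grid a h i)) *v ?e i) \<le> L * norm (?e i)"
      using norm_matrix_vector_mult_le[of "A (\<rho> (grid a h i))" "?e i"]
        mult_right_mono[OF norm_finite_le_sum[of A "\<rho> (grid a h i)"] norm_ge_zero[of "?e i"]]
      unfolding L_def by linarith
    from mult_left_mono[OF this h] show "norm (h *\<^sub>R (A (\<rho> (grid a h i)) *v ?e i)) \<le> L * h * norm (?e i)"
      using h by (simp only: norm_scaleR abs_of_nonneg mult_ac)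
  qed
  have "norm (D j + ?R + ?S) \<le> norm (D j) + norm ?R + norm ?S"
    using norm_triangle_ineq[of "D j + ?R" ?S] norm_triangle_ineq[of "D j" ?R] by linarith
  then show "norm (?e j) \<le> norm (D j) + \<delta> + L * h * (\<Sum>i<j. norm (?e i))"
    using S riemann[OF j] unfolding eq sum_distrib_left by linarith
qed

lemma sum_sq_le:
  fixes f :: "nat \<Rightarrow> real"
  shows "(\<Sum>i<N. f i)\<^sup>2 \<le> real N * (\<Sum>i<N. (f i)\<^sup>2)"
  using Cauchy_Schwarz_ineq_sum[of "\<lambda>_. 1" f "{..<N}"] by simp

section \<open>Almost sure convergence of the scheme and passage to the limit\<close>

context wiener_filtration
begin

text \<open>\<open>D N j\<close> is the Ito integral of \<open>G (r s \<omega>)\<close> minus the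
  elementary integral of its left-point interpolation, so \<open>ito_integral_error\<close> bounds
  its mean square. The bound for the full interval serves for every \<open>j\<close>, because the
  interpolations for different \<open>j\<close> agree on their common range. It tends to 0 by
  dominated convergence, used once in time along each path and once over the outcomes.\<close>

lemma euler_noise_error:
  fixes r :: "real \<Rightarrow> 'w \<Rightarrow> 'i::finite" and G :: "'i \<Rightarrow> real^'p^'n" and x :: "real \<Rightarrow> 'w \<Rightarrow> real^'n"
  assumes sol: "jump_system_solution P F w r t0 q A G x0 r0 x" and t: "0 \<le> t0" "t0 < t"
  defines "h \<equiv> \<lambda>N. (t - t0) / real N"
    and "D \<equiv> \<lambda>N j \<omega>. x (grid t0 ((t - t0) / real N) j) \<omega> - x0
        - integral {t0..grid t0 ((t - t0) / real N) j} (\<lambda>s. A (r s \<omega>) *v x s \<omega>)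
        - (\<Sum>i<j. G (r (grid t0 ((t - t0) / real N) i) \<omega>) *v
            (w (grid t0 ((t - t0) / real N) (Suc i)) \<omega> - w (grid t0 ((t - t0) / real N) i) \<omega>))"
  obtains \<epsilon> where "\<epsilon> \<longlonglongrightarrow> 0" "\<And>N. N > 0 \<Longrightarrow> \<epsilon> N < \<infinity>"
    "\<And>N j. N > 0 \<Longrightarrow> j \<le> N \<Longrightarrow> D N j \<in> borel_measurable P"
    "\<And>N j. N > 0 \<Longrightarrow> j \<le> N \<Longrightarrow> (\<integral>\<^sup>+\<omega>. ennreal ((norm (D N j \<omega>))\<^sup>2) \<partial>P) \<le> \<epsilon> N"
proof -
  have r: "r s \<in> measurable (F s) (count_space UNIV)" if "t0 \<le> s" for s
    using sol that by (simp add: jump_system_solution_def)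
  have ito: "has_ito_integral P F w t0 s (\<lambda>s \<omega>. G (r s \<omega>))
      (\<lambda>\<omega>. x s \<omega> - x0 - integral {t0..s} (\<lambda>s. A (r s \<omega>) *v x s \<omega>))" if "t0 \<le> s" for s
    using sol that by (simp add: jump_system_solution_def)
  have cadlag: "AE \<omega> in P. \<forall>s\<ge>t0. (\<forall>\<^sub>F u in at_right s. r u \<omega> = r s \<omega>) \<and>
      (s > t0 \<longrightarrow> (\<exists>j. \<forall>\<^sub>F u in at_left s. r u \<omega> = j))"
    using sol by (simp add: jump_system_solution_def markov_chain_def)
  define g where "g = (\<Sum>i\<in>UNIV. norm (G i))"
  have g: "norm (G i) \<le> g" "0 \<le> g" for i
    unfolding g_def by (simp_all add: norm_finite_le_sum sum_nonneg)
  have h: "0 < h N" if "0 < N" for N using t that by (simp add: h_def)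
  have last: "grid t0 (h N) N = t" if "0 < N" for N using that by (simp add: h_def grid_last)
  have ge: "t0 \<le> grid t0 (h N) j" if "0 < N" for N j using h[OF that] by (simp add: grid_def)
  have elem: "elementary_process P F t0 (grid t0 (h N) j) j (grid t0 (h N)) (\<lambda>i \<omega>. G (r (grid t0 (h N) i) \<omega>))"
    if "0 < N" for N j
    unfolding elementary_process_def
  proof (intro conjI allI impI)
    show "grid t0 (h N) i < grid t0 (h N) (Suc i)" for i using h[OF that] by (simp add: grid_Suc)
    show "(\<lambda>\<omega>. G (r (grid t0 (h N) i) \<omega>)) \<in> borel_measurable (F (grid t0 (h N) i))" for i
      by (rule measurable_compose[OF r[OF ge[OF that]]]) simp
    show "\<exists>c. \<forall>\<omega>\<in>space P. norm (G (r (grid t0 (h N) i) \<omega>)) \<le> c" for i using g by blast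
  qed simp_all
  define ev where "ev N j s \<omega> = elementary_value j (grid t0 (h N)) (\<lambda>i \<omega>. G (r (grid t0 (h N) i) \<omega>)) s \<omega>" for N j s \<omega>
  have ev: "ev N j s \<omega> = step_fun (grid t0 (h N)) j (\<lambda>s. G (r s \<omega>)) s" for N j s \<omega>
    by (simp add: ev_def elementary_value_def step_fun_def)
  \<comment> \<open>The squared interpolation error up to grid point \<open>j\<close>, on the
    product space so that Fubini applies.\<close>
  define u where "u N j = (\<lambda>(\<omega>, s). ennreal ((norm (indicator {t0..grid t0 (h N) j} s *\<^sub>R G (r s \<omega>) - ev N j s \<omega>))\<^sup>2))" for N j
  note err = ito_integral_error[OF ito[OF ge] elem t(1), folded ev_def]
  have um [measurable]: "u N j \<in> borel_measurable (P \<Otimes>\<^sub>M lborel)" if "0 < N" for N j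
    using err(2,3)[OF that that, of j] unfolding u_def case_prod_unfold by measurable
  have fst: "(\<integral>\<^sup>+x. u N j x \<partial>(P \<Otimes>\<^sub>M lborel)) = (\<integral>\<^sup>+\<omega>. \<integral>\<^sup>+s. u N j (\<omega>, s) \<partial>lborel \<partial>P)" if "0 < N" for N j
    using um[OF that] by (rule lborel.nn_integral_fst[symmetric])
  have mono: "(\<integral>\<^sup>+s. u N j (\<omega>, s) \<partial>lborel) \<le> (\<integral>\<^sup>+s. u N N (\<omega>, s) \<partial>lborel)" if N: "0 < N" "j \<le> N" for N j \<omega>
  proof (rule nn_integral_mono_AE)
    \<comment> \<open>At this point the closed indicator is 1 but the half-open interpolation is 0,
      so the comparison with \<open>u N N\<close> can fail there.\<close>
    have "AE s in lborel. s \<noteq> grid t0 (h N) j" by (rule AE_lborel_singleton)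
    then show "AE s in lborel. u N j (\<omega>, s) \<le> u N N (\<omega>, s)"
    proof eventually_elim
      case (elim s)
      show ?case
      proof (cases "s \<in> {t0..<grid t0 (h N) j}")
        case True
        moreover have "grid t0 (h N) j \<le> grid t0 (h N) N" using N h by (simp add: grid_le_iff)
        moreover obtain i where i: "i < j" "grid t0 (h N) i \<le> s" "s < grid t0 (h N) (Suc i)"
        proof -
          obtain i where "i < j" "s - h N < grid t0 (h N) i" "grid t0 (h N) i \<le> s"
            using step_fun_cell[OF h[OF N(1)], where a = t0 and s = s and k = j and f = "\<lambda>s. G (r s \<omega>)"] True by auto
          then show thesis by (intro that) (auto simp: grid_Suc)
        qed
        ultimately show ?thesis
          using step_fun_grid[OF h[OF N(1)] i, where f = "\<lambda>s. G (r s \<omega>)"]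
            step_fun_grid[OF h[OF N(1)] _ i(2,3), where f = "\<lambda>s. G (r s \<omega>)" and k = N] N
          by (simp add: u_def ev)
      next
        case False
        then have "s \<notin> {t0..grid t0 (h N) j}" using elim by auto
        then have "u N j (\<omega>, s) = 0"
          using False less_imp_le[OF h[OF N(1)]] by (simp add: u_def ev step_fun_eq_0)
        then show ?thesis by simp
      qed
    qed
  qed
  have bound: "u N N (\<omega>, s) \<le> ennreal ((2 * g)\<^sup>2) * indicator {t0..t} s" if N: "0 < N" for N \<omega> s
  proof (cases "s \<in> {t0..t}")
    case True
    have "norm (ev N N s \<omega>) \<le> g"
      unfolding ev using True g last[OF N] by (intro step_fun_bound h[OF N]) auto
    then have "norm (indicator {t0..t} s *\<^sub>R G (r s \<omega>) - ev N N s \<omega>) \<le> 2 * g"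
      using True g(1)[of "r s \<omega>"] norm_triangle_ineq4[of "G (r s \<omega>)" "ev N N s \<omega>"] by simp
    then have "(norm (indicator {t0..t} s *\<^sub>R G (r s \<omega>) - ev N N s \<omega>))\<^sup>2 \<le> (2 * g)\<^sup>2"
      by (intro power_mono) auto
    then show ?thesis using True by (simp add: u_def last[OF N] ennreal_leI)
  next
    case False
    then have "s \<notin> {t0..<grid t0 (h N) N}" using last[OF N] by auto
    then have "ev N N s \<omega> = 0"
      unfolding ev by (rule step_fun_eq_0[OF less_imp_le[OF h[OF N]]])
    then show ?thesis using False by (simp add: u_def last[OF N])
  qed
  have int_bound: "(\<integral>\<^sup>+s. ennreal ((2 * g)\<^sup>2) * indicator {t0..t} s \<partial>lborel) = ennreal ((2 * g)\<^sup>2 * (t - t0))"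
    using t by (subst nn_integral_cmult) (auto simp: ennreal_mult)
  have inner_bound: "(\<integral>\<^sup>+s. u N N (\<omega>, s) \<partial>lborel) \<le> ennreal ((2 * g)\<^sup>2 * (t - t0))" if "0 < N" for N \<omega>
    unfolding int_bound[symmetric] by (intro nn_integral_mono bound that)
  define \<epsilon> where "\<epsilon> N = 4 * (\<integral>\<^sup>+\<omega>. \<integral>\<^sup>+s. u N N (\<omega>, s) \<partial>lborel \<partial>P)" for N
  show thesis
  proof
    show "D N j \<in> borel_measurable P" and "(\<integral>\<^sup>+\<omega>. ennreal ((norm (D N j \<omega>))\<^sup>2) \<partial>P) \<le> \<epsilon> N"
      if N: "0 < N" "j \<le> N" for N j
    proof -
      let ?I = "elementary_integral w j (grid t0 (h N)) (\<lambda>i \<omega>. G (r (grid t0 (h N) i) \<omega>))"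
      have D: "D N j = (\<lambda>\<omega>. x (grid t0 (h N) j) \<omega> - x0 - integral {t0..grid t0 (h N) j} (\<lambda>s. A (r s \<omega>) *v x s \<omega>) - ?I \<omega>)"
        unfolding D_def h_def elementary_integral_def by (rule refl)
      show "D N j \<in> borel_measurable P"
        unfolding D by (intro borel_measurable_diff[OF err(1)] N elementary_integral_measurable[OF elem] t)
      have "(\<integral>\<^sup>+\<omega>. ennreal ((norm (D N j \<omega>))\<^sup>2) \<partial>P) \<le> 4 * (\<integral>\<^sup>+x. u N j x \<partial>(P \<Otimes>\<^sub>M lborel))"
        unfolding D u_def by (rule err(4)) (use N in auto)
      also have "\<dots> \<le> \<epsilon> N"
        unfolding \<epsilon>_def fst[OF N(1)] by (intro mult_left_mono nn_integral_mono mono N) auto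
      finally show "(\<integral>\<^sup>+\<omega>. ennreal ((norm (D N j \<omega>))\<^sup>2) \<partial>P) \<le> \<epsilon> N" .
    qed
    show "\<epsilon> N < \<infinity>" if "0 < N" for N
    proof -
      have "(\<integral>\<^sup>+\<omega>. \<integral>\<^sup>+s. u N N (\<omega>, s) \<partial>lborel \<partial>P) \<le> (\<integral>\<^sup>+\<omega>. ennreal ((2 * g)\<^sup>2 * (t - t0)) \<partial>P)"
        by (intro nn_integral_mono inner_bound that)
      also have "\<dots> < \<infinity>" by (simp add: emeasure_space_1)
      finally show ?thesis by (simp add: \<epsilon>_def ennreal_mult_less_top)
    qed
    have "(\<lambda>n. \<integral>\<^sup>+\<omega>. \<integral>\<^sup>+s. u (Suc n) (Suc n) (\<omega>, s) \<partial>lborel \<partial>P) \<longlonglongrightarrow> (\<integral>\<^sup>+\<omega>. 0 \<partial>P)"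
    proof (rule nn_integral_dominated_convergence[where w = "\<lambda>_. ennreal ((2 * g)\<^sup>2 * (t - t0))"])
      show "(\<lambda>\<omega>. \<integral>\<^sup>+s. u (Suc n) (Suc n) (\<omega>, s) \<partial>lborel) \<in> borel_measurable P" for n
        by (intro lborel.borel_measurable_nn_integral_fst um) simp
      show "AE \<omega> in P. (\<integral>\<^sup>+s. u (Suc n) (Suc n) (\<omega>, s) \<partial>lborel) \<le> ennreal ((2 * g)\<^sup>2 * (t - t0))" for n
        by (intro AE_I2 inner_bound) simp
      show "(\<integral>\<^sup>+\<omega>. ennreal ((2 * g)\<^sup>2 * (t - t0)) \<partial>P) < \<infinity>" by (simp add: emeasure_space_1)
      show "AE \<omega> in P. (\<lambda>n. \<integral>\<^sup>+s. u (Suc n) (Suc n) (\<omega>, s) \<partial>lborel) \<longlonglongrightarrow> 0"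
        using cadlag AE_space
      proof eventually_elim
        case (elim \<omega>)
        have "(\<lambda>n. \<integral>\<^sup>+s. u (Suc n) (Suc n) (\<omega>, s) \<partial>lborel) \<longlonglongrightarrow> (\<integral>\<^sup>+s. 0 \<partial>(lborel :: real measure))"
        proof (rule nn_integral_dominated_convergence[where w = "\<lambda>s. ennreal ((2 * g)\<^sup>2) * indicator {t0..t} s"])
          show "(\<lambda>s. u (Suc n) (Suc n) (\<omega>, s)) \<in> borel_measurable lborel" for n
            using um[of "Suc n" "Suc n"] elim(2) by (intro measurable_compose[OF measurable_Pair1']) auto
          show "AE s in lborel. u (Suc n) (Suc n) (\<omega>, s) \<le> ennreal ((2 * g)\<^sup>2) * indicator {t0..t} s" for n
            by (intro AE_I2 bound) simp
          show "(\<integral>\<^sup>+s. ennreal ((2 * g)\<^sup>2) * indicator {t0..t} s \<partial>lborel) < \<infinity>" unfolding int_bound by simp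
          \<comment> \<open>Besides the jumps, \<open>t0\<close> is removed because constancy on
            both sides is unknown there, and \<open>t\<close> because the step functions vanish
            there.\<close>
          let ?E = "{s \<in> {t0<..t}. \<not> (\<forall>\<^sub>F u in at s. r u \<omega> = r s \<omega>)} \<union> {t0, t}"
          have "finite ?E" using cadlag_finite_jumps[of t0 "\<lambda>s. r s \<omega>" t] elim(1) by auto
          then have "AE s in lborel. s \<notin> ?E" by (intro AE_not_in finite_imp_null_set_lborel)
          then show "AE s in lborel. (\<lambda>n. u (Suc n) (Suc n) (\<omega>, s)) \<longlonglongrightarrow> 0"
          proof eventually_elim
            case s: (elim s)
            show ?case
            proof (cases "s \<in> {t0..t}")
              case True
              then have s': "t0 \<le> s" "s < t" "\<forall>\<^sub>F u in at s. r u \<omega> = r s \<omega>" using s by auto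
              from s'(3) have "\<forall>\<^sub>F u in at s. G (r s \<omega>) = G (r u \<omega>)" by eventually_elim simp
              then have "isCont (\<lambda>s. G (r s \<omega>)) s"
                unfolding isCont_def by (rule Lim_transform_eventually[OF tendsto_const])
              then have "(\<lambda>n. ev (Suc n) (Suc n) s \<omega>) \<longlonglongrightarrow> G (r s \<omega>)"
                unfolding ev h_def by (rule LIMSEQ_Suc[OF step_fun_tendsto[OF s'(1,2)]])
              then have "(\<lambda>n. ennreal ((norm (G (r s \<omega>) - ev (Suc n) (Suc n) s \<omega>))\<^sup>2)) \<longlonglongrightarrow> ennreal ((norm (G (r s \<omega>) - G (r s \<omega>)))\<^sup>2)"
                by (intro tendsto_intros)
              then show ?thesis using True by (simp add: u_def last)
            next
              case False
              then show ?thesis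
                using bound[of "Suc n" \<omega> s for n] by simp
            qed
          qed
        qed simp_all
        then show ?case by simp
      qed
    qed simp_all
    then have "(\<lambda>n. 4 * (\<integral>\<^sup>+\<omega>. \<integral>\<^sup>+s. u (Suc n) (Suc n) (\<omega>, s) \<partial>lborel \<partial>P)) \<longlonglongrightarrow> 4 * (\<integral>\<^sup>+\<omega>. 0 \<partial>P)"
      by (intro ennreal_tendsto_cmult) auto
    then have "(\<lambda>n. \<epsilon> (Suc n)) \<longlonglongrightarrow> 0" by (simp add: \<epsilon>_def)
    then show "\<epsilon> \<longlonglongrightarrow> 0" by (rule LIMSEQ_imp_Suc)
  qed
qed


text \<open>Convergence in mean of the squared noise errors gives almost sure convergence along a
  subsequence; off a null set the Gronwall bound then works path by path. One subsequence has to
  serve all grid points, so their errors are gathered in the single random variable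
  \<open>V\<close>.\<close>

lemma euler_converges:
  fixes r :: "real \<Rightarrow> 'w \<Rightarrow> 'i::finite" and G :: "'i \<Rightarrow> real^'p^'n" and x :: "real \<Rightarrow> 'w \<Rightarrow> real^'n"
  assumes sol: "jump_system_solution P F w r t0 q A G x0 r0 x" and t: "0 \<le> t0" "t0 < t"
  obtains N where "strict_mono N" "\<And>n. N n > 0"
    "AE \<omega> in P. (\<lambda>n. euler A G t0 ((t - t0) / real (N n)) x0 (\<lambda>s. r s \<omega>) (\<lambda>s. w s \<omega>) (N n)) \<longlonglongrightarrow> x t \<omega>"
proof -
  let ?T = "t - t0"
  define h where "h N = ?T / real N" for N
  define D where "D N j \<omega> = x (grid t0 (h N) j) \<omega> - x0 - integral {t0..grid t0 (h N) j} (\<lambda>s. A (r s \<omega>) *v x s \<omega>)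
        - (\<Sum>i<j. G (r (grid t0 (h N) i) \<omega>) *v (w (grid t0 (h N) (Suc i)) \<omega> - w (grid t0 (h N) i) \<omega>))" for N j \<omega>
  have "\<exists>\<epsilon>. \<epsilon> \<longlonglongrightarrow> 0 \<and> (\<forall>N>0. \<epsilon> N < \<infinity>) \<and> (\<forall>N j. N > 0 \<longrightarrow> j \<le> N \<longrightarrow> D N j \<in> borel_measurable P \<and>
      (\<integral>\<^sup>+\<omega>. ennreal ((norm (D N j \<omega>))\<^sup>2) \<partial>P) \<le> \<epsilon> N)"
    unfolding D_def[abs_def] h_def by (rule euler_noise_error[OF sol t]) blast
  then obtain \<epsilon> where \<epsilon>: "\<epsilon> \<longlonglongrightarrow> 0" "\<And>N. N > 0 \<Longrightarrow> \<epsilon> N < \<infinity>"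
    and Dm: "\<And>N j. N > 0 \<Longrightarrow> j \<le> N \<Longrightarrow> D N j \<in> borel_measurable P"
    and D2: "\<And>N j. N > 0 \<Longrightarrow> j \<le> N \<Longrightarrow> (\<integral>\<^sup>+\<omega>. ennreal ((norm (D N j \<omega>))\<^sup>2) \<partial>P) \<le> \<epsilon> N"
    by blast
  \<comment> \<open>The two quantities in the Gronwall bound: the error at the end and the time
    integral of the squared errors. Its mean is at most \<open>(1 + ?T) * \<epsilon> N\<close>,
    since every grid point obeys the same bound and the weights add up to \<open>?T\<close>.\<close>
  define V where "V N \<omega> = (norm (D N N \<omega>))\<^sup>2 + (\<Sum>i<N. h N * (norm (D N i \<omega>))\<^sup>2)" for N \<omega>
  have h: "0 < h N" if "0 < N" for N using t that by (simp add: h_def)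
  have V0: "0 \<le> V N \<omega>" for N \<omega>
    unfolding V_def h_def using t by (intro add_nonneg_nonneg sum_nonneg mult_nonneg_nonneg) auto
  have Vint: "(\<integral>\<^sup>+\<omega>. ennreal (V N \<omega>) \<partial>P) \<le> ennreal (1 + ?T) * \<epsilon> N" and Vm: "V N \<in> borel_measurable P"
    if N: "0 < N" for N
  proof -
    have m: "(\<lambda>\<omega>. (norm (D N j \<omega>))\<^sup>2) \<in> borel_measurable P" if "j \<le> N" for j
      using Dm[OF N that] by measurable
    show "V N \<in> borel_measurable P"
      unfolding V_def[abs_def]
      by (intro borel_measurable_add borel_measurable_sum borel_measurable_times borel_measurable_const m) auto
    have "(\<integral>\<^sup>+\<omega>. ennreal (V N \<omega>) \<partial>P)
       = (\<integral>\<^sup>+\<omega>. ennreal ((norm (D N N \<omega>))\<^sup>2) + (\<Sum>i<N. ennreal (h N) * ennreal ((norm (D N i \<omega>))\<^sup>2)) \<partial>P)"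
    proof (rule nn_integral_cong)
      fix \<omega>
      have "ennreal (\<Sum>i<N. h N * (norm (D N i \<omega>))\<^sup>2) = (\<Sum>i<N. ennreal (h N) * ennreal ((norm (D N i \<omega>))\<^sup>2))"
        using h[OF N] by (simp add: sum_ennreal[symmetric] ennreal_mult)
      moreover have "0 \<le> (\<Sum>i<N. h N * (norm (D N i \<omega>))\<^sup>2)"
        using h[OF N] by (intro sum_nonneg) simp
      ultimately show "ennreal (V N \<omega>) = ennreal ((norm (D N N \<omega>))\<^sup>2) + (\<Sum>i<N. ennreal (h N) * ennreal ((norm (D N i \<omega>))\<^sup>2))"
        by (simp add: V_def)
    qed
    also have "\<dots> = (\<integral>\<^sup>+\<omega>. ennreal ((norm (D N N \<omega>))\<^sup>2) \<partial>P) + (\<Sum>i<N. ennreal (h N) * (\<integral>\<^sup>+\<omega>. ennreal ((norm (D N i \<omega>))\<^sup>2) \<partial>P))"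
    proof -
      have e: "(\<lambda>\<omega>. ennreal ((norm (D N i \<omega>))\<^sup>2)) \<in> borel_measurable P" if "i \<le> N" for i
        by (rule measurable_compose[OF m[OF that] measurable_ennreal])
      have eh: "(\<lambda>\<omega>. ennreal (h N) * ennreal ((norm (D N i \<omega>))\<^sup>2)) \<in> borel_measurable P" if "i \<in> {..<N}" for i
        using that by (intro borel_measurable_times_ennreal borel_measurable_const e) auto
      have "(\<integral>\<^sup>+\<omega>. (\<Sum>i<N. ennreal (h N) * ennreal ((norm (D N i \<omega>))\<^sup>2)) \<partial>P)
         = (\<Sum>i<N. ennreal (h N) * (\<integral>\<^sup>+\<omega>. ennreal ((norm (D N i \<omega>))\<^sup>2) \<partial>P))"
        by (subst nn_integral_sum[OF eh]) (auto intro!: sum.cong nn_integral_cmult e[OF less_imp_le])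
      then show ?thesis
        by (subst nn_integral_add[OF e borel_measurable_sum[OF eh]]) auto
    qed
    also have "\<dots> \<le> \<epsilon> N + (\<Sum>i<N. ennreal (h N) * \<epsilon> N)"
      using N by (intro add_mono sum_mono mult_left_mono D2) auto
    also have "\<dots> = ennreal (1 + ?T) * \<epsilon> N"
    proof -
      have "of_nat N * ennreal (h N) = ennreal ?T"
        using N h[OF N] by (simp add: h_def ennreal_of_nat_eq_real_of_nat flip: ennreal_mult')
      then have "(\<Sum>i<N. ennreal (h N) * \<epsilon> N) = ennreal ?T * \<epsilon> N"
        by (simp flip: mult.assoc)
      moreover have "ennreal (1 + ?T) = 1 + ennreal ?T" using t by (simp add: ennreal_plus)
      ultimately show ?thesis by (simp add: distrib_right)
    qed
    finally show "(\<integral>\<^sup>+\<omega>. ennreal (V N \<omega>) \<partial>P) \<le> ennreal (1 + ?T) * \<epsilon> N" .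
  qed
  have Vi: "integrable P (V N)" if "0 < N" for N
  proof (rule integrableI_nonneg[OF Vm[OF that]])
    show "(\<integral>\<^sup>+\<omega>. ennreal (V N \<omega>) \<partial>P) < \<infinity>"
      using le_less_trans[OF Vint[OF that]] \<epsilon>(2)[OF that] by (simp add: ennreal_mult_less_top)
  qed (simp add: V0)
  have "(\<lambda>n. ennreal (1 + ?T) * \<epsilon> (Suc n)) \<longlonglongrightarrow> ennreal (1 + ?T) * 0"
    by (intro ennreal_tendsto_cmult LIMSEQ_Suc \<epsilon>(1)) simp
  then have up: "(\<lambda>n. ennreal (1 + ?T) * \<epsilon> (Suc n)) \<longlonglongrightarrow> 0" by simp
  have "(\<lambda>n. ennreal (expectation (V (Suc n)))) \<longlonglongrightarrow> 0"
  proof (rule tendsto_sandwich[OF _ _ tendsto_const up])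
    have "ennreal (expectation (V (Suc n))) \<le> ennreal (1 + ?T) * \<epsilon> (Suc n)" for n
      using nn_integral_eq_integral[OF Vi[of "Suc n"]] Vint[of "Suc n"] V0 by simp
    then show "\<forall>\<^sub>F n in sequentially. ennreal (expectation (V (Suc n))) \<le> ennreal (1 + ?T) * \<epsilon> (Suc n)" by simp
  qed simp
  then have "(\<lambda>n. expectation (V (Suc n))) \<longlonglongrightarrow> 0"
    using tendsto_ennreal_iff[of "\<lambda>n. expectation (V (Suc n))" sequentially 0] V0 by simp
  then have "(\<lambda>n. expectation (\<lambda>\<omega>. norm (V (Suc n) \<omega>))) \<longlonglongrightarrow> 0"
    using V0 by simp
  then obtain \<sigma> where \<sigma>: "strict_mono \<sigma>" "AE \<omega> in P. (\<lambda>n. V (Suc (\<sigma> n)) \<omega>) \<longlonglongrightarrow> 0"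
    using tendsto_L1_AE_subseq[of P "\<lambda>n. V (Suc n)"] Vi by auto
  define N where "N n = Suc (\<sigma> n)" for n
  have N: "strict_mono N" using \<sigma>(1) by (simp add: N_def strict_mono_def)
  show thesis
  proof (rule that[OF N])
    show "N n > 0" for n by (simp add: N_def)
    have cadlag: "AE \<omega> in P. \<forall>s\<ge>t0. (\<forall>\<^sub>F u in at_right s. r u \<omega> = r s \<omega>) \<and>
        (s > t0 \<longrightarrow> (\<exists>j. \<forall>\<^sub>F u in at_left s. r u \<omega> = j))"
      using sol by (simp add: jump_system_solution_def markov_chain_def)
    have xc: "AE \<omega> in P. continuous_on {t0..} (\<lambda>s. x s \<omega>)"
      using sol by (simp add: jump_system_solution_def)
    from \<sigma>(2) cadlag xc
    show "AE \<omega> in P. (\<lambda>n. euler A G t0 (?T / real (N n)) x0 (\<lambda>s. r s \<omega>) (\<lambda>s. w s \<omega>) (N n)) \<longlonglongrightarrow> x t \<omega>"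
    proof eventually_elim
      case (elim \<omega>)
      let ?f = "\<lambda>s. A (r s \<omega>) *v x s \<omega>"
      define L where "L = (\<Sum>i\<in>UNIV. norm (A i))"
      have L: "0 \<le> L" by (simp add: L_def sum_nonneg)
      \<comment> \<open>The starting time is added because continuity from both sides is unknown
        there.\<close>
      let ?E = "{s \<in> {t0<..t}. \<not> (\<forall>\<^sub>F u in at s. r u \<omega> = r s \<omega>)} \<union> {t0}"
      have fin: "finite ?E" using cadlag_finite_jumps[of t0 "\<lambda>s. r s \<omega>" t] elim(2) by auto
      have cont: "isCont ?f s" if s: "s \<in> {t0..t} - ?E" for s
      proof -
        have s': "t0 < s" "\<forall>\<^sub>F u in at s. r u \<omega> = r s \<omega>" using s by auto
        have "isCont (\<lambda>s. x s \<omega>) s"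
          using continuous_on_interior[OF elim(3), of s] s'(1) by (simp add: interior_real_atLeast)
        then have "isCont (\<lambda>u. A (r s \<omega>) *v x u \<omega>) s"
          by (intro bounded_linear.isCont[OF matrix_vector_mul_bounded_linear])
        moreover have "\<forall>\<^sub>F u in at s. A (r s \<omega>) *v x u \<omega> = ?f u"
          using s'(2) by eventually_elim simp
        ultimately show ?thesis
          unfolding isCont_def by (rule Lim_transform_eventually)
      qed
      have "compact ((\<lambda>s. x s \<omega>) ` {t0..t})"
        by (intro compact_continuous_image continuous_on_subset[OF elim(3)]) auto
      then obtain B where B: "\<And>s. s \<in> {t0..t} \<Longrightarrow> norm (x s \<omega>) \<le> B"
        using compact_imp_bounded[THEN bounded_iff[THEN iffD1]] by fastforce
      have fB: "norm (?f s) \<le> L * B" if "s \<in> {t0..t}" for s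
        using norm_matrix_vector_mult_le[of "A (r s \<omega>)" "x s \<omega>"]
          mult_mono[OF norm_finite_le_sum[of A "r s \<omega>"] B[OF that]] L unfolding L_def by simp
      have "\<exists>\<rho>. \<rho> \<longlonglongrightarrow> 0 \<and> (\<forall>N j. j \<le> N \<longrightarrow> N > 0 \<longrightarrow>
          norm (integral {t0..grid t0 (h N) j} ?f - (\<Sum>i<j. h N *\<^sub>R ?f (grid t0 (h N) i))) \<le> \<rho> N)"
        unfolding h_def by (rule riemann_sums_converge[OF t(2) fin cont fB]) (assumption, assumption, blast)
      then obtain \<rho> where \<rho>: "\<rho> \<longlonglongrightarrow> 0"
        "\<And>N j. j \<le> N \<Longrightarrow> N > 0 \<Longrightarrow> norm (integral {t0..grid t0 (h N) j} ?f - (\<Sum>i<j. h N *\<^sub>R ?f (grid t0 (h N) i))) \<le> \<rho> N"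
        by blast
      let ?e = "\<lambda>N. x t \<omega> - euler A G t0 (h N) x0 (\<lambda>s. r s \<omega>) (\<lambda>s. w s \<omega>) N"
      let ?C = "L * exp (L * ?T)"
      have bound: "norm (?e N) \<le> sqrt (V N \<omega>) + \<rho> N + ?C * (sqrt (?T * V N \<omega>) + ?T * \<rho> N)" if N: "0 < N" for N
      proof -
        have hN: "h N * real N = ?T" using N by (simp add: h_def)
        have last: "grid t0 (h N) N = t" using N by (simp add: h_def grid_last)
        have "norm (x (grid t0 (h N) N) \<omega> - euler A G t0 (h N) x0 (\<lambda>s. r s \<omega>) (\<lambda>s. w s \<omega>) N)
           \<le> (norm (D N N \<omega>) + \<rho> N) + L * h N * exp (L * h N * real N) * (\<Sum>i<N. norm (D N i \<omega>) + \<rho> N)"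
          unfolding L_def
          by (rule euler_error_bound) (use h[OF N] \<rho>(2) N in \<open>simp_all add: D_def\<close>)
        moreover have "L * h N * exp (L * h N * real N) * (\<Sum>i<N. norm (D N i \<omega>) + \<rho> N)
            = ?C * (h N * (\<Sum>i<N. norm (D N i \<omega>)) + ?T * \<rho> N)"
          unfolding mult.assoc[of L] hN by (simp add: sum.distrib distrib_left mult_ac flip: hN)
        moreover have "norm (D N N \<omega>) \<le> sqrt (V N \<omega>)"
          unfolding V_def using h[OF N] by (intro real_le_rsqrt) (simp add: sum_nonneg)
        \<comment> \<open>Cauchy-Schwarz with weights \<open>h N\<close>, whose total is
          \<open>?T\<close>; this is what lets the time integral of squares in \<open>V\<close>
          control the sum from the Gronwall bound.\<close>
        moreover have "h N * (\<Sum>i<N. norm (D N i \<omega>)) \<le> sqrt (?T * V N \<omega>)"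
        proof (rule real_le_rsqrt)
          have "(h N * (\<Sum>i<N. norm (D N i \<omega>)))\<^sup>2 \<le> (h N)\<^sup>2 * (real N * (\<Sum>i<N. (norm (D N i \<omega>))\<^sup>2))"
            unfolding power_mult_distrib by (intro mult_left_mono sum_sq_le) simp
          also have "\<dots> = ?T * (\<Sum>i<N. h N * (norm (D N i \<omega>))\<^sup>2)"
            unfolding hN[symmetric] by (simp add: sum_distrib_left power2_eq_square mult_ac)
          also have "\<dots> \<le> ?T * V N \<omega>"
            using t by (intro mult_left_mono) (simp_all add: V_def)
          finally show "(h N * (\<Sum>i<N. norm (D N i \<omega>)))\<^sup>2 \<le> ?T * V N \<omega>" .
        qed
        then have "?C * (h N * (\<Sum>i<N. norm (D N i \<omega>)) + ?T * \<rho> N) \<le> ?C * (sqrt (?T * V N \<omega>) + ?T * \<rho> N)"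
          using L by (intro mult_left_mono) auto
        ultimately show ?thesis unfolding last by linarith
      qed
      have \<rho>N: "(\<lambda>n. \<rho> (N n)) \<longlonglongrightarrow> 0"
        using LIMSEQ_subseq_LIMSEQ[OF \<rho>(1) N] by (simp add: o_def)
      have VN: "(\<lambda>n. V (N n) \<omega>) \<longlonglongrightarrow> 0" using elim(1) by (simp add: N_def)
      have "(\<lambda>n. sqrt (V (N n) \<omega>) + \<rho> (N n) + ?C * (sqrt (?T * V (N n) \<omega>) + ?T * \<rho> (N n)))
         \<longlonglongrightarrow> sqrt 0 + 0 + ?C * (sqrt (?T * 0) + ?T * 0)"
        by (intro tendsto_intros \<rho>N VN)
      then have "(\<lambda>n. sqrt (V (N n) \<omega>) + \<rho> (N n) + ?C * (sqrt (?T * V (N n) \<omega>) + ?T * \<rho> (N n))) \<longlonglongrightarrow> 0"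
        by simp
      then have "(\<lambda>n. ?e (N n)) \<longlonglongrightarrow> 0"
        by (rule Lim_null_comparison[rotated]) (intro always_eventually allI bound, simp add: N_def)
      then have "(\<lambda>n. x t \<omega> - ?e (N n)) \<longlonglongrightarrow> x t \<omega> - 0"
        by (intro tendsto_diff tendsto_const)
      then show ?case by (simp add: h_def)
    qed
  qed
qed

text \<open>The identity \<open>real (N n) * h n = t - t0\<close> makes the energy bound the same
  for all small steps of the sequence, so it survives the limit. The hypothesis \<open>contr\<close>
  ranges over all transition functions because that of the given chain is obtained inside the proof,
  whereas \<alpha> is fixed beforehand.\<close>

lemma mean_square_bound:
  fixes r :: "real \<Rightarrow> 'w \<Rightarrow> 'i::finite" and A Q :: "'i \<Rightarrow> real^'n^'n" and G :: "'i \<Rightarrow> real^'p^'n"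
  assumes sol: "jump_system_solution P F w r t0 q A G x0 r0 x" and t: "0 \<le> t0" "t0 < t"
    and \<alpha>: "0 < \<alpha>"
    and contr: "\<And>p :: real \<Rightarrow> 'i \<Rightarrow> 'i \<Rightarrow> real.
       (\<And>i j. ((\<lambda>h. (p h i j - (if j = i then 1 else 0)) / h) \<longlongrightarrow> q i j) (at_right 0)) \<Longrightarrow>
       \<forall>\<^sub>F h in at_right 0. \<forall>i v. (\<Sum>j\<in>UNIV. p h i j * ((v + h *\<^sub>R (A i *v v)) \<bullet> (Q j *v (v + h *\<^sub>R (A i *v v)))))
          \<le> (1 - \<alpha> * h) * (v \<bullet> (Q i *v v))"
    and Q: "0 < c" "\<And>i v. c * (norm v)\<^sup>2 \<le> v \<bullet> (Q i *v v)"
  defines "\<beta> \<equiv> real CARD('p) * (\<Sum>i\<in>UNIV. (norm (Q i) + 1) * (norm (G i))\<^sup>2)"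
  shows "(\<integral>\<^sup>+\<omega>. ennreal (x t \<omega> \<bullet> x t \<omega>) \<partial>P)
    \<le> ennreal ((exp (- \<alpha> * (t - t0)) * ((\<Sum>i\<in>UNIV. norm (Q i)) * (norm x0)\<^sup>2) + \<beta> / \<alpha>) / c)"
proof -
  have r: "r s \<in> measurable (F s) (count_space UNIV)" if "t0 \<le> s" for s
    using sol that by (simp add: jump_system_solution_def)
  have indep: "independent_processes P t0 r w"
    using sol by (simp add: jump_system_solution_def)
  have "markov_chain P t0 q r" using sol by (simp add: jump_system_solution_def)
  then obtain p :: "real \<Rightarrow> 'i \<Rightarrow> 'i \<Rightarrow> real" where
    p1: "\<forall>i j. j \<noteq> i \<longrightarrow> (\<lambda>h. p h i j - q i j * h) \<in> o[at_right 0](\<lambda>h. h)" and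
    p2: "\<forall>i. (\<lambda>h. p h i i - (1 + q i i * h)) \<in> o[at_right 0](\<lambda>h. h)" and
    p3: "\<forall>t\<ge>t0. \<forall>h>0. \<forall>T (a :: real \<Rightarrow> 'i) i j. finite T \<longrightarrow> T \<subseteq> {t0..t} \<longrightarrow>
           \<P>(\<omega> in P. r t \<omega> = i \<and> (\<forall>s\<in>T. r s \<omega> = a s)) > 0 \<longrightarrow>
           \<P>(\<omega> in P. r (t + h) \<omega> = j \<bar> r t \<omega> = i \<and> (\<forall>s\<in>T. r s \<omega> = a s)) = p h i j"
    unfolding markov_chain_def by (elim conjE exE) (rule that)
  have off: "(\<lambda>h. p h i j - q i j * h) \<in> o[at_right 0](\<lambda>h. h)" if "j \<noteq> i" for i j
    using p1 that by simp
  have diag: "(\<lambda>h. p h i i - (1 + q i i * h)) \<in> o[at_right 0](\<lambda>h. h)" for i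
    using p2 by simp
  have kernel: "\<P>(\<omega> in P. r (t + h) \<omega> = j \<bar> r t \<omega> = i \<and> (\<forall>s\<in>T. r s \<omega> = a s)) = p h i j"
    if "t0 \<le> t" "0 < h" "finite T" "T \<subseteq> {t0..t}" "\<P>(\<omega> in P. r t \<omega> = i \<and> (\<forall>s\<in>T. r s \<omega> = a s)) > 0"
    for t h T a i j
    using p3[rule_format, OF that(1,2,3,4)] that(5) by blast
  \<comment> \<open>The expansions on and off the diagonal are merged into one difference
    quotient.\<close>
  have rate: "((\<lambda>h. (p h i j - (if j = i then 1 else 0)) / h) \<longlongrightarrow> q i j) (at_right 0)" for i j
  proof -
    have "(\<lambda>h. p h i j - (if j = i then 1 else 0) - q i j * h) \<in> o[at_right 0](\<lambda>h. h)"
      using off[of j i] diag[of i] by (cases "j = i") (simp_all add: algebra_simps)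
    then have "((\<lambda>h. (p h i j - (if j = i then 1 else 0) - q i j * h) / h) \<longlongrightarrow> 0) (at_right 0)"
      by (rule smalloD_tendsto)
    then have "((\<lambda>h. (p h i j - (if j = i then 1 else 0) - q i j * h) / h + q i j) \<longlongrightarrow> 0 + q i j) (at_right 0)"
      by (intro tendsto_add tendsto_const)
    moreover have "\<forall>\<^sub>F h in at_right 0. (p h i j - (if j = i then 1 else 0) - q i j * h) / h + q i j
        = (p h i j - (if j = i then 1 else 0)) / h"
      using eventually_at_right_less[of "0::real"] by eventually_elim (simp add: field_simps)
    ultimately show ?thesis
      by (simp only: add_0_left) (rule Lim_transform_eventually)
  qed
  have plim: "((\<lambda>h. p h i j) \<longlongrightarrow> (if j = i then 1 else 0)) (at_right 0)" for i j
  proof -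
    have "((\<lambda>h. h * ((p h i j - (if j = i then 1 else 0)) / h) + (if j = i then 1 else 0)) \<longlongrightarrow> 0 * q i j + (if j = i then 1 else 0)) (at_right 0)"
      by (intro tendsto_add tendsto_mult rate tendsto_const tendsto_ident_at)
    moreover have "\<forall>\<^sub>F h in at_right 0. h * ((p h i j - (if j = i then 1 else 0)) / h) + (if j = i then 1 else 0) = p h i j"
      using eventually_at_right_less[of "0::real"] by eventually_elim simp
    ultimately show ?thesis
      by (simp only: add_0_left mult_zero_left) (rule Lim_transform_eventually)
  qed
  \<comment> \<open>The transition probabilities tend to the identity, so the averaged weight tends
    to \<open>Q i\<close>; the margin 1 is the one built into \<beta>.\<close>
  have near: "\<forall>\<^sub>F h in at_right 0. \<forall>i. norm (\<Sum>j\<in>UNIV. p h i j *\<^sub>R Q j) \<le> norm (Q i) + 1"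
  proof (rule eventually_all_finite)
    fix i
    have "((\<lambda>h. norm (\<Sum>j\<in>UNIV. p h i j *\<^sub>R Q j)) \<longlongrightarrow> norm (\<Sum>j\<in>UNIV. (if j = i then 1 else 0) *\<^sub>R Q j)) (at_right 0)"
      by (intro tendsto_intros plim)
    moreover have "(\<Sum>j\<in>UNIV. (if j = i then 1 else 0) *\<^sub>R Q j) = Q i"
      by (simp add: if_distrib[of "\<lambda>x. x *\<^sub>R _"] cong: if_cong)
    ultimately have "((\<lambda>h. norm (\<Sum>j\<in>UNIV. p h i j *\<^sub>R Q j)) \<longlongrightarrow> norm (Q i)) (at_right 0)" by simp
    then have "\<forall>\<^sub>F h in at_right 0. norm (\<Sum>j\<in>UNIV. p h i j *\<^sub>R Q j) < norm (Q i) + 1"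
      by (rule order_tendstoD) simp
    then show "\<forall>\<^sub>F h in at_right 0. norm (\<Sum>j\<in>UNIV. p h i j *\<^sub>R Q j) \<le> norm (Q i) + 1"
      by eventually_elim simp
  qed
  have "((\<lambda>h. \<alpha> * h) \<longlongrightarrow> \<alpha> * 0) (at_right 0)" by (intro tendsto_intros)
  then have small: "\<forall>\<^sub>F h in at_right 0. \<alpha> * h < 1" by (rule order_tendstoD) simp
  obtain N where N: "strict_mono N" "\<And>n. N n > 0"
    "AE \<omega> in P. (\<lambda>n. euler A G t0 ((t - t0) / real (N n)) x0 (\<lambda>s. r s \<omega>) (\<lambda>s. w s \<omega>) (N n)) \<longlonglongrightarrow> x t \<omega>"
    by (rule euler_converges[OF sol t]) (rule that)
  define h where "h n = (t - t0) / real (N n)" for n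
  define e where "e n \<omega> = euler A G t0 (h n) x0 (\<lambda>s. r s \<omega>) (\<lambda>s. w s \<omega>) (N n)" for n \<omega>
  let ?C = "ennreal ((exp (- \<alpha> * (t - t0)) * ((\<Sum>i\<in>UNIV. norm (Q i)) * (norm x0)\<^sup>2) + \<beta> / \<alpha>) / c)"
  have hpos: "0 < h n" for n using t N(2)[of n] by (simp add: h_def)
  have "h \<longlonglongrightarrow> 0"
    using LIMSEQ_subseq_LIMSEQ[OF lim_const_over_n[of "t - t0"] N(1)] by (simp add: h_def[abs_def] o_def)
  then have hlim: "filterlim h (at_right 0) sequentially"
    by (rule tendsto_imp_filterlim_at_right) (simp add: hpos)
  have "\<forall>\<^sub>F n in sequentially. (\<integral>\<^sup>+\<omega>. ennreal ((norm (e n \<omega>))\<^sup>2) \<partial>P) \<le> ?C"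
    using eventually_compose_filterlim[OF contr[OF rate] hlim] eventually_compose_filterlim[OF near hlim]
      eventually_compose_filterlim[OF small hlim]
  proof eventually_elim
    case (elim n)
    have "real (N n) * h n = t - t0" using N(2)[of n] by (simp add: h_def)
    then show ?case
      using euler_energy_bound[OF t(1) hpos r indep kernel[OF _ hpos] elim(1)[rule_format] elim(2)[rule_format] \<alpha>
          less_imp_le[OF elim(3)] Q, where k = "N n" and ?x0.0 = x0 and G = G]
      unfolding e_def \<beta>_def by simp
  qed
  then have "liminf (\<lambda>n. \<integral>\<^sup>+\<omega>. ennreal ((norm (e n \<omega>))\<^sup>2) \<partial>P) \<le> ?C"
    by (intro order_trans[OF Liminf_le_Limsup Limsup_bounded]) auto
  moreover have "(\<integral>\<^sup>+\<omega>. ennreal (x t \<omega> \<bullet> x t \<omega>) \<partial>P) \<le> (\<integral>\<^sup>+\<omega>. liminf (\<lambda>n. ennreal ((norm (e n \<omega>))\<^sup>2)) \<partial>P)"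
  proof (rule nn_integral_mono_AE)
    show "AE \<omega> in P. ennreal (x t \<omega> \<bullet> x t \<omega>) \<le> liminf (\<lambda>n. ennreal ((norm (e n \<omega>))\<^sup>2))"
      using N(3)
    proof eventually_elim
      case (elim \<omega>)
      then have "(\<lambda>n. ennreal ((norm (e n \<omega>))\<^sup>2)) \<longlonglongrightarrow> ennreal ((norm (x t \<omega>))\<^sup>2)"
        unfolding e_def h_def by (intro tendsto_intros)
      then have "liminf (\<lambda>n. ennreal ((norm (e n \<omega>))\<^sup>2)) = ennreal ((norm (x t \<omega>))\<^sup>2)"
        by (rule lim_imp_Liminf[rotated]) simp
      then show ?case by (simp add: power2_norm_eq_inner)
    qed
  qed
  moreover have "(\<integral>\<^sup>+\<omega>. liminf (\<lambda>n. ennreal ((norm (e n \<omega>))\<^sup>2)) \<partial>P) \<le> liminf (\<lambda>n. \<integral>\<^sup>+\<omega>. ennreal ((norm (e n \<omega>))\<^sup>2) \<partial>P)"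
  proof (rule nn_integral_liminf)
    fix n
    have "e n \<in> borel_measurable P"
      unfolding e_def[abs_def]
      by (rule measurable_filtration[OF euler_square_integrable(1)[OF t(1) less_imp_le[OF hpos] r]])
    then show "(\<lambda>\<omega>. ennreal ((norm (e n \<omega>))\<^sup>2)) \<in> borel_measurable P" by measurable
  qed
  ultimately show ?thesis by (meson order_trans)
qed

end

section \<open>A mean-square bound uniform over realisations and initial conditions\<close>

theorem proposition2:
  fixes q :: "'i::finite \<Rightarrow> 'i \<Rightarrow> real"
    and A :: "'i \<Rightarrow> real^'n^'n"
    and B :: "'i \<Rightarrow> real^'m^'n"
    and C :: "'i \<Rightarrow> real^'n^'p"
    and D :: "'i \<Rightarrow> real^'p^'p"
    and S :: "'i \<Rightarrow> real^'n^'n"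
    and Y :: "'i \<Rightarrow> real^'p^'p"
    and F :: "'i \<Rightarrow> real^'p^'m"
    and t0 :: real
  assumes "t0 \<ge> 0"
    and "generator_matrix q"
    and "\<And>i. sym_pos_def (S i)"
    and "\<And>i. sym_pos_def (Y i)"
    and "\<And>i. neg_def_on (lmi_index i) (lmi_matrix q A B C S F i)"
    and "\<And>i. C i ** S i - Y i ** C i = 0"
  shows "let K = (\<lambda>i. F i ** matrix_inv (Y i)) in
           ubs_mean_square TYPE('w) t0 q (closed_loop_drift A B C K) (closed_loop_diffusion B D K)"
proof -
  define K where "K = (\<lambda>i. F i ** matrix_inv (Y i))"
  define A' where "A' = closed_loop_drift A B C K"
  define G where "G = closed_loop_diffusion B D K"
  define Q where "Q i = matrix_inv (S i)" for i
  have Q: "sym_pos_def (Q i)" for i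
    unfolding Q_def by (rule sym_pos_def_inv[OF assms(3)])
  have neg: "2 * ((Q i *v v) \<bullet> (A' i *v v)) + (\<Sum>j\<in>UNIV. q i j * (v \<bullet> (Q j *v v))) < 0" if "v \<noteq> 0" for i v
    unfolding Q_def A'_def K_def
    by (rule lyapunov_of_lmi[where S = S and Y = Y]) (use assms that in auto)
  \<comment> \<open>The constants \<alpha>, \<open>c\<close> and \<beta> are fixed before any
    realisation is considered, as the order of quantifiers in \<open>ubs_mean_square\<close>
    demands.\<close>
  obtain \<alpha> where \<alpha>: "\<alpha> > 0"
    "\<And>p :: real \<Rightarrow> 'i \<Rightarrow> 'i \<Rightarrow> real.
       (\<And>i j. ((\<lambda>h. (p h i j - (if j = i then 1 else 0)) / h) \<longlongrightarrow> q i j) (at_right 0)) \<Longrightarrow>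
       \<forall>\<^sub>F h in at_right 0. \<forall>i v. (\<Sum>j\<in>UNIV. p h i j * ((v + h *\<^sub>R (A' i *v v)) \<bullet> (Q j *v (v + h *\<^sub>R (A' i *v v)))))
          \<le> (1 - \<alpha> * h) * (v \<bullet> (Q i *v v))"
    by (rule discrete_lyapunov[OF Q neg]) (assumption, rule that, assumption, blast)
  have "\<exists>c>0. \<forall>v. c * (norm v)\<^sup>2 \<le> v \<bullet> (Q i *v v)" for i
  proof (rule quadratic_form_coercive[of "\<lambda>v. v \<bullet> (Q i *v v)"])
    show "continuous_on UNIV (\<lambda>v. v \<bullet> (Q i *v v))"
      by (intro continuous_intros matrix_vector_mult_linear_continuous_on)
    show "(a *\<^sub>R v) \<bullet> (Q i *v (a *\<^sub>R v)) = a\<^sup>2 * (v \<bullet> (Q i *v v))" for a v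
      by (simp add: matrix_vector_mult_scaleR power2_eq_square)
    show "v \<noteq> 0 \<Longrightarrow> 0 < v \<bullet> (Q i *v v)" for v using Q by (simp add: sym_pos_def_def)
  qed blast
  moreover have "d * (norm v)\<^sup>2 \<le> x" if "c * (norm v)\<^sup>2 \<le> x" "d \<le> c" for c d x and v :: "real^'n"
    using order_trans[OF mult_right_mono[OF that(2), of "(norm v)\<^sup>2"] that(1)] by simp
  ultimately obtain c where c: "c > 0" "\<And>i v. c * (norm v)\<^sup>2 \<le> v \<bullet> (Q i *v v)"
    using finite_common_lower_bound[of "\<lambda>i c. \<forall>v. c * (norm v)\<^sup>2 \<le> v \<bullet> (Q i *v v)"] by blast
  define \<beta> where "\<beta> = real CARD('p) * (\<Sum>i\<in>UNIV. (norm (Q i) + 1) * (norm (G i))\<^sup>2)"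
  \<comment> \<open>The summand 1 eventually exceeds the decaying contribution of the initial state,
    whatever \<open>x0\<close> is.\<close>
  define M where "M = (1 + \<beta> / \<alpha>) / c"
  have "0 \<le> \<beta>" by (simp add: \<beta>_def sum_nonneg)
  then have "M > 0" using \<alpha>(1) c(1) by (simp add: M_def add_pos_nonneg)
  moreover have "Limsup at_top (\<lambda>t. \<integral>\<^sup>+\<omega>. ennreal (x t \<omega> \<bullet> x t \<omega>) \<partial>P) \<le> ennreal M"
    if sol: "jump_system_solution P \<F> w r t0 q A' G x0 r0 x"
    for x0 r0 and P :: "'w measure" and \<F> w r x
  proof (rule Limsup_bounded)
    interpret wiener_filtration P \<F> w
      using sol by unfold_locales (simp_all add: jump_system_solution_def)
    let ?V = "(\<Sum>i\<in>UNIV. norm (Q i)) * (norm x0)\<^sup>2"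
    have "((\<lambda>t. exp (- \<alpha> * (t - t0))) \<longlongrightarrow> 0) at_top"
      using \<alpha>(1) by real_asymp
    then have "((\<lambda>t. exp (- \<alpha> * (t - t0)) * ?V) \<longlongrightarrow> 0) at_top"
      by (rule tendsto_mult_left_zero)
    then have "\<forall>\<^sub>F t in at_top. exp (- \<alpha> * (t - t0)) * ?V < 1" by (rule order_tendstoD) simp
    then show "\<forall>\<^sub>F t in at_top. (\<integral>\<^sup>+\<omega>. ennreal (x t \<omega> \<bullet> x t \<omega>) \<partial>P) \<le> ennreal M"
      using eventually_gt_at_top[of t0]
    proof eventually_elim
      case (elim t)
      have "(\<integral>\<^sup>+\<omega>. ennreal (x t \<omega> \<bullet> x t \<omega>) \<partial>P) \<le> ennreal ((exp (- \<alpha> * (t - t0)) * ?V + \<beta> / \<alpha>) / c)"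
        unfolding \<beta>_def by (rule mean_square_bound[OF sol assms(1) elim(2) \<alpha> c])
      also have "\<dots> \<le> ennreal M"
        unfolding M_def using elim(1) c(1) by (intro ennreal_leI divide_right_mono) auto
      finally show ?case .
    qed
  qed
  ultimately show ?thesis
    unfolding Let_def ubs_mean_square_def K_def[symmetric] A'_def[symmetric] G_def[symmetric] by blast
qed

end
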